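(* Let $G$ be a finitely generated nilpotent group equipped with a generating $k$-tuple $S=(s_1,\dots,s_k)$. Then for every $k$-tuple $a=(\alpha_1,\dots,\alpha_k)\in(0,\infty]^k$ such that $\alpha_i\,\ell(s_i)>2$ for all $i=1,\dots,k$, $$\mu_{S,a}^{(n)}(e)\simeq\Phi_G(n)\simeq n^{-D(G)/2}.$$
   Context: $e$ is the identity of $G$; repetitions are allowed in $S$. The probability measure $\mu_{S,a}$ on $G$ is $$\mu_{S,a}(g)=\frac1k\sum_{i=1}^k c(\alpha_i)\sum_{m\in\mathbb Z}(1+|m|)^{-\alpha_i-1}\mathbf 1_{s_i^m}(g),\qquad c(\alpha)^{-1}=\sum_{m\in\mathbb Z}(1+|m|)^{-\alpha-1},$$ with the convention that for $\alpha=\infty$ the quantity $(1+|m|)^{-\alpha-1}$ equals $1$ if $m\in\{0,\pm1\}$ and $0$ otherwise. $\mu^{(n)}$ is the $n$-fold convolution power. $G_1=G$, $G_j=[G,G_{j-1}]$ is the lower central series, and $D(G)=\sum_{j\ge1}j\,\mathrm{rank}(G_j/G_{j+1})$ (torsion-free rank). The commutator length $\ell(g)\in\{1,2,\dots\}\cup\{\infty\}$ of $g\in G$ is the supremum of the integers $\ell$ such that $g^m\in G_\ell$ for some integer $m\ge1$; torsion elements have $\ell(g)=\infty$. $\Phi_G$ is the $\simeq$-equivalence class of $n\mapsto u_A^{(2n)}(e)$, where $u_A$ is the uniform probability measure on a finite symmetric generating set $A$ of $G$ (this class does not depend on $A$). $f\simeq g$ means that there are constants $c_1,\dots,c_4>0$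 with $c_1f(c_2t)\le g(t)\le c_3f(c_4t)$ for all large $t$; in particular $\mu^{(n)}(e)\simeq n^{-D}$ means $c\,n^{-D}\le\mu^{(n)}(e)\le C\,n^{-D}$ for some $c,C>0$ and all large integers $n$. *)

theory Defs
  imports "HOL-Analysis.Analysis" "HOL-Algebra.Algebra"
begin

section \<open>Lower central series, torsion-free rank, commutator length\<close>

definition commutator_subgroup :: "('a, 'b) monoid_scheme \<Rightarrow> 'a set \<Rightarrow> 'a set \<Rightarrow> 'a set" where
  "commutator_subgroup G H K =
     generate G {x \<otimes>\<^bsub>G\<^esub> y \<otimes>\<^bsub>G\<^esub> inv\<^bsub>G\<^esub> x \<otimes>\<^bsub>G\<^esub> inv\<^bsub>G\<^esub> y | x y. x \<in> H \<and> y \<in> K}"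

text \<open>The series is indexed from 1; the value at 0 is a dummy.\<close>

fun lower_central :: "('a, 'b) monoid_scheme \<Rightarrow> nat \<Rightarrow> 'a set" where
  "lower_central G 0 = carrier G"
| "lower_central G (Suc 0) = carrier G"
| "lower_central G (Suc (Suc j)) = commutator_subgroup G (carrier G) (lower_central G (Suc j))"

definition nilpotent_group :: "('a, 'b) monoid_scheme \<Rightarrow> bool" where
  "nilpotent_group G \<longleftrightarrow> group G \<and> (\<exists>j\<ge>1. lower_central G j = {\<one>\<^bsub>G\<^esub>})"

definition int_independent :: "('a, 'b) monoid_scheme \<Rightarrow> 'a set \<Rightarrow> bool" where
  "int_independent Q B \<longleftrightarrow>
     finite B \<and> B \<subseteq> carrier Q \<and>
     (\<forall>m :: 'a \<Rightarrow> int. finprod Q (\<lambda>b. b [^]\<^bsub>Q\<^esub> m b) B = \<one>\<^bsub>Q\<^esub> \<longrightarrow> (\<forall>b\<in>B. m b = 0))"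

text \<open>For abelian groups of finite torsion-free rank only: the supremum in \<open>nat\<close> of an
  unbounded set is a junk value. The sections of the lower central series of a finitely
  generated group are finitely generated, so the supremum below is then a maximum.\<close>

definition torsion_free_rank :: "('a, 'b) monoid_scheme \<Rightarrow> nat" where
  "torsion_free_rank Q = Sup {card B | B. int_independent Q B}"

text \<open>For a nilpotent group only finitely many terms of the sum are nonzero.\<close>

definition hom_dim :: "('a, 'b) monoid_scheme \<Rightarrow> real" where
  "hom_dim G = (\<Sum>\<^sub>\<infinity>j\<in>{1..}. real j *
     real (torsion_free_rank (G\<lparr>carrier := lower_central G j\<rparr> Mod lower_central G (Suc j))))"

definition commutator_length :: "('a, 'b) monoid_scheme \<Rightarrow> 'a \<Rightarrow> enat" where
  "commutator_length G g =
     Sup {enat l | l. l \<ge> 1 \<and> (\<exists>m::nat. m \<ge> 1 \<and> g [^]\<^bsub>G\<^esub> m \<in> lower_central G l)}"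

section \<open>Convolution powers\<close>

definition conv :: "('a, 'b) monoid_scheme \<Rightarrow> ('a \<Rightarrow> real) \<Rightarrow> ('a \<Rightarrow> real) \<Rightarrow> 'a \<Rightarrow> real" where
  "conv G f h x = (\<Sum>\<^sub>\<infinity>y\<in>carrier G. f y * h (inv\<^bsub>G\<^esub> y \<otimes>\<^bsub>G\<^esub> x))"

definition conv_power :: "('a, 'b) monoid_scheme \<Rightarrow> ('a \<Rightarrow> real) \<Rightarrow> nat \<Rightarrow> 'a \<Rightarrow> real" where
  "conv_power G f n = (conv G f ^^ n) (indicator {\<one>\<^bsub>G\<^esub>})"

section \<open>The measures\<close>

definition stable_weight :: "ereal \<Rightarrow> int \<Rightarrow> real" where
  "stable_weight \<alpha> m =
     (if \<alpha> = \<infinity> then (if m \<in> {-1, 0, 1} then 1 else 0)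
      else (1 + real_of_int \<bar>m\<bar>) powr (- real_of_ereal \<alpha> - 1))"

definition stable_const :: "ereal \<Rightarrow> real" where
  "stable_const \<alpha> = inverse (\<Sum>\<^sub>\<infinity>m::int. stable_weight \<alpha> m)"

definition stable_measure ::
  "('a, 'b) monoid_scheme \<Rightarrow> nat \<Rightarrow> (nat \<Rightarrow> 'a) \<Rightarrow> (nat \<Rightarrow> ereal) \<Rightarrow> 'a \<Rightarrow> real" where
  "stable_measure G k s \<alpha> g =
     1 / real k * (\<Sum>i=1..k. stable_const (\<alpha> i) *
       (\<Sum>\<^sub>\<infinity>m::int. stable_weight (\<alpha> i) m * indicator {s i [^]\<^bsub>G\<^esub> m} g))"

definition uniform_on :: "'a set \<Rightarrow> 'a \<Rightarrow> real" where
  "uniform_on A g = indicator A g / real (card A)"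

definition symmetric_generating_set :: "('a, 'b) monoid_scheme \<Rightarrow> 'a set \<Rightarrow> bool" where
  "symmetric_generating_set G A \<longleftrightarrow>
     finite A \<and> A \<noteq> {} \<and> A \<subseteq> carrier G \<and> (\<forall>x\<in>A. inv\<^bsub>G\<^esub> x \<in> A) \<and> generate G A = carrier G"

text \<open>The representative, given by \<open>A\<close>, of the equivalence class \<open>\<Phi>\<^sub>G\<close>.\<close>

definition Phi :: "('a, 'b) monoid_scheme \<Rightarrow> 'a set \<Rightarrow> nat \<Rightarrow> real" where
  "Phi G A n = conv_power G (uniform_on A) (2 * n) \<one>\<^bsub>G\<^esub>"

section \<open>Asymptotic equivalence\<close>

definition asymp_similar :: "(real \<Rightarrow> real) \<Rightarrow> (real \<Rightarrow> real) \<Rightarrow> bool" (infix \<open>\<simeq>\<close> 50) where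
  "f \<simeq> g \<longleftrightarrow> (\<exists>c1>0. \<exists>c2>0. \<exists>c3>0. \<exists>c4>0.
     \<forall>\<^sub>F t in at_top. c1 * f (c2 * t) \<le> g t \<and> g t \<le> c3 * f (c4 * t))"

text \<open>Sequences are compared after extension to step functions on the half-line, since the
  rescaled arguments \<open>c2 * t\<close> and \<open>c4 * t\<close> need not be integers.\<close>

definition step_ext :: "(nat \<Rightarrow> real) \<Rightarrow> real \<Rightarrow> real" where
  "step_ext u t = u (nat \<lfloor>t\<rfloor>)"

end

theory Submission
  imports Defs
begin

text \<open>
  Both walks are symmetric, and the theorem is a statement about the geometry of balls. Let
  \<open>|x|\<close> be the word length for a finite symmetric generating set, let \<open>V r\<close> be the number of
  elements of length at most \<open>r\<close>, and let \<open>D = hom_dim G\<close>. Two properties of a finitely generated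
  nilpotent group are used (\<open>volume_and_distortion\<close>): \<open>V r\<close> is comparable to \<open>r ^ D\<close>, and if some
  positive power of \<open>g\<close> lies in the \<open>L\<close>-th term of the lower central series, then the length of
  \<open>g [^] m\<close> is \<open>O(|m| powr (1 / L))\<close>. By the second property the condition \<open>\<alpha> * \<ell> > 2\<close> on the
  commutator length makes the sum over \<open>m\<close> of \<open>(1 + |m|) powr (- \<alpha> - 1) * |s [^] m|\<^sup>2\<close> finite:
  each step of the long range walk has a finite second moment, as a step of the walk with bounded
  steps has, and from there on the two walks are treated alike.

  Upper bound (\<open>ret2_upper\<close>). The probability \<open>a n\<close> of return at time \<open>2 * n\<close> is the squared
  \<open>\<ell>\<^sup>2\<close> norm of the distribution at time \<open>n\<close>. Comparing this distribution with its average over a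
  ball of radius \<open>r\<close> gives the Nash type inequality
  \<open>a n \<le> 1 / V r + K * r\<^sup>2 * (a n - a (n + 1))\<close>, because averaging bounds the supremum by
  \<open>1 / V r\<close> and because translating by an element of length \<open>r\<close> costs \<open>r\<^sup>2\<close> times the energy
  lost in one step. Taking \<open>r\<close> of the order of \<open>sqrt n\<close> yields the decay \<open>n powr (- D / 2)\<close>.

  Lower bound (\<open>ret2_lower\<close>). The function \<open>max (R - |x|) 0\<close> is Lipschitz, so one step of a walk
  with finite second moment removes only a fraction \<open>O(1 / R\<^sup>2)\<close> of its squared norm. The squared
  norms of the iterates are log-convex; hence with \<open>R\<close> a large multiple of \<open>sqrt n\<close> half of it
  survives \<open>n\<close> steps, and a function supported in a ball of radius \<open>R\<close> can keep its norm only if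
  the probability of return is at least \<open>1 / (2 * V R)\<close>.

  Geometry. All left-normed commutators in the generators serve as letters \<open>y q\<close>, of weight
  \<open>w q\<close>. At the scale \<open>r\<close> a letter of weight \<open>w\<close> is given the cost \<open>1 / r ^ w\<close>, and words of cost 1
  turn out to be, up to constants in \<open>r\<close>, the ball of radius \<open>r\<close>. In one direction, collecting the
  letters in order multiplies costs by constants only (\<open>conj_letter\<close>, \<open>collect\<close>), since a commutator
  has the sum of the weights of its entries; so every word of cost 1 has a normal form whose
  exponents are bounded by \<open>(C * r) ^ w q\<close> (\<open>normal_form\<close>). In the other direction,
  \<open>[x\<^sub>1 [^] n, \<dots>, x\<^sub>j [^] n]\<close> is a word of length \<open>O(n)\<close> that agrees with \<open>[x\<^sub>1, \<dots>, x\<^sub>j] [^] (n ^ j)\<close>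
  up to the next term of the series, and descending induction on the weight shows that normal forms
  are short (\<open>short_powers_step\<close>). Only letters of infinite order modulo the later ones contribute to
  the growth, and those of weight \<open>j\<close> are counted by the torsion-free rank of the \<open>j\<close>-th section
  (\<open>torsion_free_rank_section\<close>).
\<close>

section \<open>The lower central series\<close>

text \<open>The left-normed commutators in \<open>A\<close>. The index is one less than the weight, so that
  they lie in \<open>lower_central G (Suc n)\<close>.\<close>

primrec simple_comms :: "('a, 'b) monoid_scheme \<Rightarrow> 'a set \<Rightarrow> nat \<Rightarrow> 'a set" where
  "simple_comms G A 0 = A"
| "simple_comms G A (Suc n) =
     (\<Union>x\<in>A. \<Union>t\<in>simple_comms G A n. {x \<otimes>\<^bsub>G\<^esub> t \<otimes>\<^bsub>G\<^esub> inv\<^bsub>G\<^esub> x \<otimes>\<^bsub>G\<^esub> inv\<^bsub>G\<^esub> t})"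

context group begin

abbreviation comm :: "'a \<Rightarrow> 'a \<Rightarrow> 'a" where
  "comm x y \<equiv> x \<otimes> y \<otimes> inv x \<otimes> inv y"

abbreviation LC :: "nat \<Rightarrow> 'a set" where "LC \<equiv> lower_central G"

lemma cancel_inv_left [simp]:
  "x \<in> carrier G \<Longrightarrow> y \<in> carrier G \<Longrightarrow> x \<otimes> (inv x \<otimes> y) = y"
  "x \<in> carrier G \<Longrightarrow> y \<in> carrier G \<Longrightarrow> inv x \<otimes> (x \<otimes> y) = y"
  by (simp_all flip: m_assoc)

lemma inv_comm: "x \<in> carrier G \<Longrightarrow> y \<in> carrier G \<Longrightarrow> inv (comm x y) = comm y x"
  by (simp add: inv_mult_group m_assoc)

lemma comm_mult_left:
  assumes "x \<in> carrier G" "y \<in> carrier G" "t \<in> carrier G"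
  shows "comm (x \<otimes> y) t = (x \<otimes> comm y t \<otimes> inv x) \<otimes> comm x t"
  using assms by (simp add: inv_mult_group m_assoc)

text \<open>This is the preimage of the centralizer of the image of \<open>t\<close> in \<open>G/K\<close>. Because it is a
  subgroup, a statement about all commutators \<open>[x, t]\<close> modulo \<open>K\<close> needs to be checked only
  for \<open>x\<close> in a generating set.\<close>

lemma centralizer_mod_normal:
  assumes K: "K \<lhd> G" and t: "t \<in> carrier G"
  shows "subgroup {x \<in> carrier G. comm x t \<in> K} G"
proof
  interpret K: normal K G by (rule K)
  show "{x \<in> carrier G. comm x t \<in> K} \<subseteq> carrier G" by auto
  show "\<one> \<in> {x \<in> carrier G. comm x t \<in> K}" using t by simp
  fix x y assume xy: "x \<in> {x \<in> carrier G. comm x t \<in> K}" "y \<in> {x \<in> carrier G. comm x t \<in> K}"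
  have "x \<otimes> comm y t \<otimes> inv x \<in> K" using xy by (intro K.inv_op_closed2) auto
  then show "x \<otimes> y \<in> {x \<in> carrier G. comm x t \<in> K}"
    using xy comm_mult_left[of x y t] t K.m_closed by auto
next
  interpret K: normal K G by (rule K)
  fix x assume x: "x \<in> {x \<in> carrier G. comm x t \<in> K}"
  then have xc: "x \<in> carrier G" by auto
  have "comm (inv x) t = inv x \<otimes> inv (comm x t) \<otimes> x"
    using xc t by (simp add: inv_mult_group m_assoc)
  moreover have "inv x \<otimes> inv (comm x t) \<otimes> x \<in> K"
    using x by (intro K.inv_op_closed1) auto
  ultimately show "inv x \<in> {x \<in> carrier G. comm x t \<in> K}" using xc by auto
qed

lemma comm_swap_mem:
  assumes "subgroup K G" "x \<in> carrier G" "y \<in> carrier G" "comm x y \<in> K"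
  shows "comm y x \<in> K"
  using inv_comm[of x y] subgroup.m_inv_closed[OF assms(1,4)] assms(2,3) by auto

lemma generate_subset_centralizer:
  assumes "K \<lhd> G" "t \<in> carrier G" "S \<subseteq> carrier G" "\<And>x. x \<in> S \<Longrightarrow> comm x t \<in> K" "x \<in> generate G S"
  shows "comm x t \<in> K"
proof -
  have "generate G S \<subseteq> {x \<in> carrier G. comm x t \<in> K}"
    by (rule generate_subgroup_incl[OF _ centralizer_mod_normal[OF assms(1,2)]]) (use assms in auto)
  then show ?thesis using assms(5) by auto
qed

lemma normal_if_comm:
  assumes K: "subgroup K G" and c: "\<And>x k. x \<in> carrier G \<Longrightarrow> k \<in> K \<Longrightarrow> comm x k \<in> K"
  shows "K \<lhd> G"
  unfolding normal_inv_iff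
proof (intro conjI K ballI)
  fix x h assume x: "x \<in> carrier G" and h: "h \<in> K"
  have hc: "h \<in> carrier G" using h K subgroup.mem_carrier by metis
  have "x \<otimes> h \<otimes> inv x = comm x h \<otimes> h" using x hc by (simp add: m_assoc)
  then show "x \<otimes> h \<otimes> inv x \<in> K" using subgroup.m_closed[OF K c[OF x h] h] by metis
qed

text \<open>The two facts support each other: a commutator \<open>[x, k]\<close> with \<open>k\<close> in the next term is
  one of the generators of that term as soon as the next term is contained in the present
  one.\<close>

lemma LC_normal_decreasing: "LC j \<lhd> G \<and> LC (Suc j) \<subseteq> LC j"
proof (induction j)
  case 0
  then show ?case
    by (simp add: normal_if_comm subgroup_self)
next
  case (Suc j)
  have n: "LC (Suc j) \<lhd> G"
  proof (cases j)
    case 0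
    then show ?thesis by (simp add: normal_if_comm subgroup_self)
  next
    case (Suc i)
    interpret N: normal "LC j" G using Suc.IH by simp
    define S where "S = {x \<otimes> y \<otimes> inv x \<otimes> inv y | x y. x \<in> carrier G \<and> y \<in> LC (Suc i)}"
    have S: "LC (Suc j) = generate G S" unfolding Suc S_def by (simp add: commutator_subgroup_def)
    have Sc: "S \<subseteq> carrier G" unfolding S_def using N.subset Suc by auto
    show ?thesis
    proof (rule normal_if_comm)
      show "subgroup (LC (Suc j)) G" unfolding S by (rule generate_is_subgroup[OF Sc])
      fix x k assume x: "x \<in> carrier G" and k: "k \<in> LC (Suc j)"
      then have "k \<in> LC j" using Suc.IH by auto
      then show "comm x k \<in> LC (Suc j)" unfolding S
        by (intro generate.incl) (use x in \<open>auto simp: S_def Suc\<close>)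
    qed
  qed
  interpret N: normal "LC (Suc j)" G by (rule n)
  have "LC (Suc (Suc j)) \<subseteq> LC (Suc j)"
    unfolding lower_central.simps commutator_subgroup_def
  proof (rule generate_subgroup_incl[OF _ N.is_subgroup], clarify)
    fix x y assume x: "x \<in> carrier G" and y: "y \<in> LC (Suc j)"
    show "comm x y \<in> LC (Suc j)"
      using N.inv_op_closed2[OF x y] y N.m_closed by simp
  qed
  with n show ?case by simp
qed

lemma LC_normal: "LC j \<lhd> G" using LC_normal_decreasing by blast

lemma LC_subgroup: "subgroup (LC j) G" using LC_normal normal_imp_subgroup by blast

lemma LC_carrier: "x \<in> LC j \<Longrightarrow> x \<in> carrier G"
  using LC_subgroup subgroup.mem_carrier by metis

lemma LC_inv: "x \<in> LC j \<Longrightarrow> inv x \<in> LC j"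
  by (rule subgroup.m_inv_closed[OF LC_subgroup])

lemma LC_mult: "x \<in> LC j \<Longrightarrow> y \<in> LC j \<Longrightarrow> x \<otimes> y \<in> LC j"
  by (rule subgroup.m_closed[OF LC_subgroup])

lemma LC_antimono: "i \<le> j \<Longrightarrow> LC j \<subseteq> LC i"
  by (rule lift_Suc_antimono_le) (use LC_normal_decreasing in auto)

lemma comm_LC_Suc:
  assumes "x \<in> carrier G" "y \<in> LC j" "j \<ge> 1"
  shows "comm x y \<in> LC (Suc j)"
proof -
  obtain i where "j = Suc i" using assms(3) by (cases j) auto
  then show ?thesis using assms
    by (auto simp: commutator_subgroup_def intro!: generate.incl)
qed

text \<open>An elementwise form of the three subgroups lemma. Conjugation by \<open>u\<close> multiplies \<open>y\<close> by
  \<open>[u, y]\<close>, which \<open>x\<close> does not move, and it does not see the difference \<open>[inv y, inv x]\<close>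
  between \<open>y\<close> and \<open>x\<inverse> y x\<close>. Hence \<open>x u x\<inverse>\<close> and \<open>u\<close> conjugate \<open>y\<close> to the same element.\<close>

lemma commute_comm_inv:
  assumes c: "x \<in> carrier G" "u \<in> carrier G" "y \<in> carrier G"
    and cx: "x \<otimes> comm u y = comm u y \<otimes> x"
    and ud: "u \<otimes> comm (inv y) (inv x) = comm (inv y) (inv x) \<otimes> u"
  shows "comm (comm (inv u) x) y = \<one>"
proof -
  define cc where "cc = comm u y"
  define d where "d = comm (inv y) (inv x)"
  have cl [simp]: "cc \<in> carrier G" "d \<in> carrier G" using c by (auto simp: cc_def d_def)
  have yd: "y \<otimes> d = inv x \<otimes> y \<otimes> x" using c by (simp add: d_def m_assoc)
  have cy: "cc \<otimes> y = u \<otimes> y \<otimes> inv u" using c by (simp add: cc_def m_assoc)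
  have "x \<otimes> u \<otimes> inv x \<otimes> y \<otimes> x \<otimes> inv u \<otimes> inv x = x \<otimes> (u \<otimes> (inv x \<otimes> y \<otimes> x) \<otimes> inv u) \<otimes> inv x"
    using c by (simp add: m_assoc)
  also have "\<dots> = x \<otimes> (u \<otimes> y \<otimes> (d \<otimes> inv u)) \<otimes> inv x"
    unfolding yd[symmetric] using c by (simp add: m_assoc)
  also have "d \<otimes> inv u = inv u \<otimes> d"
    using ud c cl unfolding d_def[symmetric]
    by (metis inv_closed inv_solve_left inv_solve_right m_assoc m_closed)
  also have "x \<otimes> (u \<otimes> y \<otimes> (inv u \<otimes> d)) \<otimes> inv x = x \<otimes> ((cc \<otimes> y) \<otimes> d) \<otimes> inv x"
    unfolding cy using c by (simp add: m_assoc)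
  also have "\<dots> = (x \<otimes> cc) \<otimes> (y \<otimes> d) \<otimes> inv x" using c by (simp add: m_assoc)
  also have "\<dots> = cc \<otimes> y" unfolding yd cx[folded cc_def] using c by (simp add: m_assoc)
  finally have e: "x \<otimes> u \<otimes> inv x \<otimes> y \<otimes> x \<otimes> inv u \<otimes> inv x = u \<otimes> y \<otimes> inv u" unfolding cy .
  have "comm (comm (inv u) x) y = inv u \<otimes> (x \<otimes> u \<otimes> inv x \<otimes> y \<otimes> x \<otimes> inv u \<otimes> inv x) \<otimes> u \<otimes> inv y"
    using c by (simp add: m_assoc inv_mult_group)
  then show ?thesis unfolding e using c by (simp add: m_assoc)
qed

text \<open>The quotient enters only through a homomorphism with kernel \<open>K\<close>; congruences modulo
  \<open>K\<close> then become equations between images.\<close>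

lemma quotient_hom:
  assumes "K \<lhd> G"
  shows "\<exists>(Q :: 'a set monoid) \<pi>. group_hom G Q \<pi> \<and> (\<forall>a \<in> carrier G. \<pi> a = \<one>\<^bsub>Q\<^esub> \<longleftrightarrow> a \<in> K)"
proof (intro exI conjI ballI)
  interpret K: normal K G by (rule assms)
  show "group_hom G (G Mod K) (\<lambda>a. K #> a)"
    by (intro group_hom.intro group_hom_axioms.intro K.factorgroup_is_group is_group K.r_coset_hom_Mod)
  show "K #> a = \<one>\<^bsub>G Mod K\<^esub> \<longleftrightarrow> a \<in> K" if "a \<in> carrier G" for a
    using that K.rcos_const K.is_subgroup coset_join1[OF _ that K.is_subgroup] by (auto simp: FactGroup_def)
qed

text \<open>Induction on \<open>i\<close>. Modulo \<open>LC (Suc i + j)\<close> the induction hypothesis says that \<open>[u, y]\<close>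
  is central and that \<open>LC i\<close> commutes with \<open>LC (Suc j)\<close>; these are the two hypotheses of
  \<open>commute_comm_inv\<close>, which then disposes of the generators \<open>[x, u]\<close> of \<open>LC (Suc i)\<close>.\<close>

lemma comm_LC:
  assumes "i \<ge> 1" "j \<ge> 1" "u \<in> LC i" "y \<in> LC j"
  shows "comm u y \<in> LC (i + j)"
  using assms
proof (induction i arbitrary: u j y rule: nat_induct_at_least)
  case base
  then show ?case using comm_LC_Suc[of u y j] LC_carrier by simp
next
  case (Suc i)
  define K where "K = LC (Suc i + j)"
  interpret K: normal K G unfolding K_def by (rule LC_normal)
  obtain Q :: "'a set monoid" and \<pi> where Q: "group_hom G Q \<pi>"
    and one: "\<And>a. a \<in> carrier G \<Longrightarrow> \<pi> a = \<one>\<^bsub>Q\<^esub> \<longleftrightarrow> a \<in> K"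
    using quotient_hom[OF K.normal_axioms] by metis
  interpret h: group_hom G Q \<pi> by (rule Q)
  have hcomm: "h.H.comm (\<pi> a) (\<pi> b) = \<pi> (comm a b)" if "a \<in> carrier G" "b \<in> carrier G" for a b
    using that by simp
  have commute: "\<pi> a \<otimes>\<^bsub>Q\<^esub> \<pi> b = \<pi> b \<otimes>\<^bsub>Q\<^esub> \<pi> a"
    if "a \<in> carrier G" "b \<in> carrier G" "comm a b \<in> K" for a b
  proof -
    have "comm a b \<in> carrier G" using that by simp
    then have "h.H.comm (\<pi> a) (\<pi> b) = \<one>\<^bsub>Q\<^esub>"
      unfolding hcomm[OF that(1,2)] using one that(3) by blast
    then show ?thesis using that
      by (metis h.H.inv_closed h.H.inv_solve_right h.H.l_one h.H.m_closed h.hom_closed)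
  qed
  have y: "y \<in> carrier G" using Suc.prems LC_carrier by auto
  have key: "comm (comm x u) y \<in> K" if x: "x \<in> carrier G" and u: "u \<in> LC i" for x u
  proof -
    define v where "v = inv u"
    have v: "v \<in> LC i" "v \<in> carrier G" "u = inv v" "u \<in> carrier G"
      using LC_inv[OF u] LC_carrier[OF u] unfolding v_def by auto
    have 1: "comm v y \<in> LC (i + j)" using Suc.IH v Suc.prems by auto
    have 2: "comm x (comm v y) \<in> K" unfolding K_def using comm_LC_Suc[OF x 1] Suc.prems by simp
    have "inv y \<in> LC j" using Suc.prems LC_inv by auto
    then have "comm (inv x) (inv y) \<in> LC (Suc j)" using comm_LC_Suc[of "inv x" "inv y" j] x Suc.prems by simp
    then have 3: "comm (inv y) (inv x) \<in> LC (Suc j)"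
      using comm_swap_mem[OF LC_subgroup, of "inv x" "inv y"] x y by auto
    have 4: "comm v (comm (inv y) (inv x)) \<in> K"
      using Suc.IH[OF _ v(1) 3] unfolding K_def by simp
    have "h.H.comm (h.H.comm (inv\<^bsub>Q\<^esub> \<pi> v) (\<pi> x)) (\<pi> y) = \<one>\<^bsub>Q\<^esub>"
      apply (rule h.H.commute_comm_inv)
      using commute[OF _ _ 2] commute[OF _ _ 4] x y v by simp_all
    then have "\<pi> (comm (comm (inv v) x) y) = \<one>\<^bsub>Q\<^esub>"
      using x y v by simp
    moreover have "comm (comm (inv v) x) y \<in> carrier G" using x y v by simp
    ultimately have "comm (comm (inv v) x) y \<in> K" using one by blast
    then have "comm (comm u x) y \<in> K" unfolding v(3) .
    have sg: "subgroup {z \<in> carrier G. comm z y \<in> K} G"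
      by (rule centralizer_mod_normal[OF _ y]) (rule K.normal_axioms)
    have mem: "comm u x \<in> {z \<in> carrier G. comm z y \<in> K}"
      using \<open>comm (comm u x) y \<in> K\<close> x v(4) by blast
    have "inv (comm u x) \<in> {z \<in> carrier G. comm z y \<in> K}"
      by (rule subgroup.m_inv_closed[OF sg mem])
    then show ?thesis unfolding inv_comm[OF v(4) x] by blast
  qed
  obtain i' where i': "i = Suc i'" using \<open>1 \<le> i\<close> by (cases i) auto
  define S where "S = {x \<otimes> y \<otimes> inv x \<otimes> inv y | x y. x \<in> carrier G \<and> y \<in> LC i}"
  have "LC (Suc i) = generate G S" unfolding S_def i' by (simp add: commutator_subgroup_def)
  moreover have "S \<subseteq> carrier G" unfolding S_def using LC_carrier by auto
  ultimately have "comm u y \<in> K"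
    using generate_subset_centralizer[OF K.normal_axioms y, of S u] key Suc.prems
    unfolding S_def by blast
  then show ?case unfolding K_def .
qed

end

section \<open>Graded letters and the cost of words\<close>

text \<open>Many estimates below hold for each letter with a constant of its own; since there are
  finitely many letters the constants can be made equal.\<close>

lemma finite_uniform_const:
  fixes P :: "'i \<Rightarrow> real \<Rightarrow> bool"
  assumes "finite A" "\<And>a. a \<in> A \<Longrightarrow> \<exists>C. P a C" "\<And>a C C'. P a C \<Longrightarrow> C \<le> C' \<Longrightarrow> P a C'"
  shows "\<exists>C\<ge>1. \<forall>a\<in>A. P a C"
proof -
  obtain c where c: "\<And>a. a \<in> A \<Longrightarrow> P a (c a)" using assms(2) by metis
  have "c a \<le> 1 + (\<Sum>b\<in>A. \<bar>c b\<bar>)" if "a \<in> A" for a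
    using member_le_sum[of a A "\<lambda>b. \<bar>c b\<bar>"] that assms(1) by auto
  moreover have "(\<Sum>b\<in>A. \<bar>c b\<bar>) \<ge> 0" by (simp add: sum_nonneg)
  ultimately have "1 \<le> 1 + (\<Sum>b\<in>A. \<bar>c b\<bar>) \<and> (\<forall>a\<in>A. P a (1 + (\<Sum>b\<in>A. \<bar>c b\<bar>)))"
    using c assms(3) by (meson le_add_same_cancel1)
  then show ?thesis by (rule exI)
qed

lemma finite_simple_comms: "finite A \<Longrightarrow> finite (simple_comms G A n)"
  by (induction n) auto

declare lower_central.simps(3) [simp del]

context group begin

lemma simple_comms_LC: "A \<subseteq> carrier G \<Longrightarrow> simple_comms G A n \<subseteq> LC (Suc n)"
proof (induction n)
  case (Suc n)
  then show ?case using comm_LC_Suc[of _ _ "Suc n"] by (auto simp del: lower_central.simps)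
qed simp

text \<open>Each term is generated, modulo the next one, by the commutators of letters. The
  subgroup \<open>K\<close> on the right is normal because \<open>[G, K]\<close> is already inside the last term, so
  in \<open>[x, u]\<close> both entries may be replaced by generators, one after the other.\<close>

lemma LC_generated_step:
  assumes A: "A \<subseteq> carrier G" "generate G A = carrier G"
  shows "LC (Suc n) = generate G (simple_comms G A n \<union> LC (Suc (Suc n)))"
proof
  show "generate G (simple_comms G A n \<union> LC (Suc (Suc n))) \<subseteq> LC (Suc n)"
    by (rule generate_subgroup_incl[OF _ LC_subgroup])
       (use simple_comms_LC[OF A(1)] LC_antimono[of "Suc n" "Suc (Suc n)"] in auto)
next
  show "LC (Suc n) \<subseteq> generate G (simple_comms G A n \<union> LC (Suc (Suc n)))"
  proof (induction n)
    case 0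
    have "generate G A \<subseteq> generate G (simple_comms G A 0 \<union> LC (Suc (Suc 0)))"
      by (rule mono_generate) auto
    then show ?case using A(2) by simp
  next
    case (Suc n)
    define S where "S = simple_comms G A (Suc n) \<union> LC (Suc (Suc (Suc n)))"
    define K where "K = generate G S"
    have Ssub: "S \<subseteq> LC (Suc (Suc n))"
      unfolding S_def using simple_comms_LC[OF A(1), of "Suc n"]
        LC_antimono[of "Suc (Suc n)" "Suc (Suc (Suc n))"] by auto
    have KL: "K \<subseteq> LC (Suc (Suc n))" unfolding K_def
      by (rule generate_subgroup_incl[OF Ssub LC_subgroup])
    have Ks: "subgroup K G" unfolding K_def
      by (rule generate_is_subgroup) (use Ssub LC_carrier in blast)
    have SK: "S \<subseteq> K" unfolding K_def by (auto intro: generate.incl)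
    then have LK: "LC (Suc (Suc (Suc n))) \<subseteq> K" unfolding S_def by auto
    have Kn: "K \<lhd> G"
    proof (rule normal_if_comm[OF Ks])
      fix x k assume "x \<in> carrier G" "k \<in> K"
      then show "comm x k \<in> K" using comm_LC_Suc[of x k "Suc (Suc n)"] KL LK by auto
    qed
    have 1: "comm x t \<in> K" if x: "x \<in> carrier G" and t: "t \<in> simple_comms G A n" for x t
    proof -
      have tc: "t \<in> carrier G" using t simple_comms_LC[OF A(1), of n] LC_carrier by blast
      have "comm a t \<in> K" if "a \<in> A" for a
        using that t SK unfolding S_def by auto
      then show ?thesis
        using generate_subset_centralizer[OF Kn tc A(1), of x] x A(2) by blast
    qed
    have 2: "comm x u \<in> K" if x: "x \<in> carrier G" and u: "u \<in> LC (Suc n)" for x u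
    proof -
      have g: "comm t x \<in> K" if "t \<in> simple_comms G A n \<union> LC (Suc (Suc n))" for t
      proof -
        have tc: "t \<in> carrier G" using that simple_comms_LC[OF A(1), of n] LC_carrier by blast
        have "comm x t \<in> K"
          using that 1[OF x] comm_LC_Suc[OF x, of t "Suc (Suc n)"] LK by auto
        then show ?thesis using comm_swap_mem[OF Ks x tc] by blast
      qed
      have sc: "simple_comms G A n \<union> LC (Suc (Suc n)) \<subseteq> carrier G"
        using simple_comms_LC[OF A(1), of n] LC_carrier by blast
      have "comm u x \<in> K"
        using generate_subset_centralizer[OF Kn x sc g] Suc.IH u by blast
      then show ?thesis using comm_swap_mem[OF Ks _ x] u LC_carrier by blast
    qed
    have "LC (Suc (Suc n)) \<subseteq> K"
      unfolding lower_central.simps commutator_subgroup_def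
      by (rule generate_subgroup_incl[OF _ Ks]) (use 2 in blast)
    then show ?case unfolding K_def S_def .
  qed
qed

lemma LC_generated:
  assumes A: "A \<subseteq> carrier G" "generate G A = carrier G" and m: "LC (Suc m) = {\<one>}"
  shows "LC (Suc k) = generate G (\<Union>n\<in>{k..<m}. simple_comms G A n)"
proof (cases "k \<le> m")
  case True
  then show ?thesis
  proof (induction k rule: inc_induct)
    case base
    then show ?case using m by (simp add: generate_empty)
  next
    case (step k)
    define U where "U = (\<Union>n\<in>{Suc k..<m}. simple_comms G A n)"
    have U: "(\<Union>n\<in>{k..<m}. simple_comms G A n) = simple_comms G A k \<union> U"
    proof -
      have "{k..<m} = insert k {Suc k..<m}" using step by auto
      then show ?thesis unfolding U_def by simp
    qed
    have c: "simple_comms G A k \<union> U \<subseteq> carrier G"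
      unfolding U_def using simple_comms_LC[OF A(1)] LC_carrier by blast
    have "generate G (simple_comms G A k \<union> LC (Suc (Suc k))) \<subseteq> generate G (simple_comms G A k \<union> U)"
    proof (rule generate_subgroup_incl[OF _ generate_is_subgroup[OF c]])
      have "generate G U \<subseteq> generate G (simple_comms G A k \<union> U)" by (rule mono_generate) auto
      then show "simple_comms G A k \<union> LC (Suc (Suc k)) \<subseteq> generate G (simple_comms G A k \<union> U)"
        using step.IH unfolding U_def by (auto intro: generate.incl)
    qed
    moreover have "generate G (simple_comms G A k \<union> U) \<subseteq> generate G (simple_comms G A k \<union> LC (Suc (Suc k)))"
      by (rule mono_generate) (use step.IH in \<open>auto simp: U_def intro: generate.incl\<close>)
    ultimately show ?case unfolding U using LC_generated_step[OF A, of k] by simp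
  qed
next
  case False
  then have "LC (Suc k) \<subseteq> {\<one>}" using LC_antimono[of "Suc m" "Suc k"] m by simp
  then have "LC (Suc k) = {\<one>}" using subgroup.one_closed[OF LC_subgroup] by blast
  then show ?thesis using False by (simp add: generate_empty)
qed

end

lemma (in group) int_pow_cases:
  assumes "x \<in> carrier G"
  shows "x [^] (a :: int) = (if 0 \<le> a then x [^] nat a else inv x [^] nat (- a))"
proof (cases "0 \<le> a")
  case True
  then show ?thesis using int_pow_int[of G x "nat a"] by simp
next
  case False
  then have "x [^] a = inv (x [^] (- a))" using assms int_pow_neg[of x a] by simp
  also have "\<dots> = inv (x [^] nat (- a))" using int_pow_int[of G x "nat (- a)"] False by simp
  finally show ?thesis using False assms nat_pow_inv[of x "nat (- a)"] by simp
qed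

lemma power_weight_le: "1 \<le> (r::real) \<Longrightarrow> k \<le> n \<Longrightarrow> 0 \<le> C \<Longrightarrow> C / r ^ n \<le> C / r ^ k"
  by (intro divide_left_mono power_increasing mult_pos_pos) auto

text \<open>In such a group every element is a product of powers of the letters in increasing
  order, and the terms of the lower central series can be recognised by the weights that
  occur.\<close>

locale graded_letters = group G for G :: "('a, 'b) monoid_scheme" (structure) +
  fixes N :: nat and y :: "nat \<Rightarrow> 'a" and w :: "nat \<Rightarrow> nat"
  assumes y_closed [simp]: "q < N \<Longrightarrow> y q \<in> carrier G"
    and w_pos: "q < N \<Longrightarrow> 1 \<le> w q"
    and w_mono: "p \<le> q \<Longrightarrow> q < N \<Longrightarrow> w p \<le> w q"
    and LC_letters: "1 \<le> k \<Longrightarrow> lower_central G k = generate G {y q | q. q < N \<and> k \<le> w q}"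

text \<open>The letters are all left-normed commutators in \<open>A\<close> of weight at most \<open>j\<close>, where \<open>LC j\<close>
  is trivial, sorted by weight.\<close>

lemma (in group) graded_letters_exist:
  assumes A: "finite A" "A \<subseteq> carrier G" "generate G A = carrier G"
    and nil: "\<exists>j\<ge>1. LC j = {\<one>}"
  shows "\<exists>N y w. graded_letters G N y w \<and> (\<forall>x\<in>A. \<exists>q<N. y q = x \<and> w q = 1) \<and>
    (\<forall>q<N. y q \<in> simple_comms G A (w q - 1))"
proof -
  obtain j where j: "j \<ge> 1" "LC j = {\<one>}" using nil by blast
  then have "LC (Suc j) \<subseteq> {\<one>}" using LC_antimono[of j "Suc j"] by auto
  then have m: "LC (Suc j) = {\<one>}" using subgroup.one_closed[OF LC_subgroup] by blast
  define Z where "Z = (SIGMA n:{..<j}. simple_comms G A n)"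
  have "finite Z" unfolding Z_def using finite_simple_comms[OF A(1)] by auto
  then obtain xs where xs: "set xs = Z" using finite_list by auto
  define zs where "zs = sort_key fst xs"
  have zs: "set zs = Z" "sorted (map fst zs)" unfolding zs_def using xs by auto
  define y where "y = (\<lambda>q. snd (zs ! q))"
  define w where "w = (\<lambda>q. Suc (fst (zs ! q)))"
  have zq: "y q \<in> simple_comms G A (w q - 1)" "w q \<le> j" if "q < length zs" for q
    using nth_mem[OF that] unfolding zs(1) Z_def y_def w_def by auto
  have ex: "\<exists>q<length zs. y q = t \<and> w q = Suc n" if "n < j" "t \<in> simple_comms G A n" for n t
  proof -
    have "(n, t) \<in> set zs" using that unfolding zs(1) Z_def by auto
    then obtain q where "q < length zs" "zs ! q = (n, t)" by (auto simp: in_set_conv_nth)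
    then show ?thesis unfolding y_def w_def by auto
  qed
  have gl: "graded_letters G (length zs) y w"
  proof
    show "y q \<in> carrier G" if "q < length zs" for q
      using zq(1)[OF that] simple_comms_LC[OF A(2)] LC_carrier by blast
    show "1 \<le> w q" for q by (simp add: w_def)
    show "w p \<le> w q" if "p \<le> q" "q < length zs" for p q
      using sorted_nth_mono[OF zs(2) that(1)] that by (simp add: w_def)
    show "LC k = generate G {y q |q. q < length zs \<and> k \<le> w q}" if "1 \<le> k" for k
    proof -
      obtain k' where k: "k = Suc k'" using \<open>1 \<le> k\<close> by (cases k) auto
      have "(\<Union>n\<in>{k'..<j}. simple_comms G A n) = {y q |q. q < length zs \<and> k \<le> w q}" (is "?A = ?B")
      proof
        show "?A \<subseteq> ?B" using ex k by fastforce
        show "?B \<subseteq> ?A"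
        proof clarify
          fix q assume "q < length zs" "k \<le> w q"
          then show "y q \<in> ?A" using zq[of q] k by (intro UN_I[of "w q - 1"]) auto
        qed
      qed
      then show ?thesis using LC_generated[OF A(2,3) m, of k'] k by simp
    qed
  qed
  show ?thesis
    by (intro exI[of _ "length zs"] exI[of _ y] exI[of _ w] conjI gl)
       (use ex[of 0] zq j in auto)
qed

context graded_letters begin

text \<open>Words in the letters of index at least \<open>p\<close>, measured at the scale \<open>r\<close>: a letter of
  weight \<open>w\<close> costs \<open>1 / r ^ w\<close>, and \<open>word_le p r l x\<close> says that \<open>x\<close> is the value of a word
  of total cost at most \<open>l\<close>. A word of cost 1 may contain \<open>r ^ w\<close> letters of weight \<open>w\<close>,
  which is what a ball of radius \<open>r\<close> should contain: a commutator of weight \<open>w\<close> whose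
  entries are \<open>r\<close>-th powers is the \<open>r ^ w\<close>-th power of a letter up to higher weights. Words
  grow on the left, so that in the collection of \<open>y p\<close> the part already collected is never
  conjugated.\<close>

inductive word_le :: "nat \<Rightarrow> real \<Rightarrow> real \<Rightarrow> 'a \<Rightarrow> bool" for p r where
  one: "0 \<le> l \<Longrightarrow> word_le p r l \<one>"
| step: "word_le p r l x \<Longrightarrow> p \<le> q \<Longrightarrow> q < N \<Longrightarrow> t \<in> {y q, inv (y q)} \<Longrightarrow> word_le p r (l + 1 / r ^ w q) (t \<otimes> x)"

lemma letter_closed: "q < N \<Longrightarrow> t \<in> {y q, inv (y q)} \<Longrightarrow> t \<in> carrier G"
  by auto

lemma word_le_carrier [simp]: "word_le p r l x \<Longrightarrow> x \<in> carrier G"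
  by (induction rule: word_le.induct) auto

lemma word_le_nonneg: "word_le p r l x \<Longrightarrow> 0 < r \<Longrightarrow> 0 \<le> l"
  by (induction rule: word_le.induct) auto

lemma word_le_mono: "word_le p r l x \<Longrightarrow> l \<le> l' \<Longrightarrow> word_le p r l' x"
proof (induction arbitrary: l' rule: word_le.induct)
  case (one l)
  then show ?case by (auto intro: word_le.one)
next
  case (step l x q t)
  have "word_le p r ((l' - 1 / r ^ w q) + 1 / r ^ w q) (t \<otimes> x)"
    by (intro word_le.step step.IH step.hyps) (use step.prems in auto)
  then show ?case by simp
qed

lemma word_le_mult: "word_le p r l x \<Longrightarrow> word_le p r l' x' \<Longrightarrow> 0 < r \<Longrightarrow> word_le p r (l + l') (x \<otimes> x')"
proof (induction rule: word_le.induct)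
  case (one l)
  then show ?case using word_le_mono[of p r l' x' "l + l'"] by simp
next
  case (step l x q t)
  have "word_le p r ((l + l') + 1 / r ^ w q) (t \<otimes> (x \<otimes> x'))"
    by (intro word_le.step step.IH step.hyps step.prems)
  then show ?case
    using letter_closed[OF step.hyps(3,4)] step.hyps(1) step.prems(1) by (simp add: m_assoc algebra_simps)
qed

lemma word_le_letter: "p \<le> q \<Longrightarrow> q < N \<Longrightarrow> t \<in> {y q, inv (y q)} \<Longrightarrow> word_le p r (1 / r ^ w q) t"
  using word_le.step[OF word_le.one, of 0 p q t r] letter_closed[of q t] by auto

lemma word_le_inv: "word_le p r l x \<Longrightarrow> 0 < r \<Longrightarrow> word_le p r l (inv x)"
proof (induction rule: word_le.induct)
  case (one l)
  then show ?case by (simp add: word_le.one)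
next
  case (step l x q t)
  have "inv t \<in> {y q, inv (y q)}" using step.hyps by auto
  from word_le_mult[OF step.IH[OF step.prems] word_le_letter[OF step.hyps(2,3) this] step.prems]
  show ?case using letter_closed[OF step.hyps(3,4)] step.hyps(1) by (simp add: inv_mult_group)
qed

lemma word_le_tail: "word_le p r l x \<Longrightarrow> p' \<le> p \<Longrightarrow> word_le p' r l x"
proof (induction rule: word_le.induct)
  case (one l)
  then show ?case by (simp add: word_le.one)
next
  case (step l x q t)
  then show ?case by (intro word_le.step) auto
qed

text \<open>Since all weights are at least 1, enlarging the scale by a factor \<open>K\<close> divides every
  cost by at least \<open>K\<close>. In this way constants in the cost are traded for constants in the
  radius.\<close>

lemma word_le_scale:
  assumes "word_le p r l x" "0 < r" "1 \<le> K"
  shows "word_le p (K * r) (l / K) x"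
  using assms
proof (induction rule: word_le.induct)
  case (one l)
  then show ?case by (simp add: word_le.one)
next
  case (step l x q t)
  have "K ^ 1 \<le> K ^ w q" using w_pos[OF step.hyps(3)] step.prems by (intro power_increasing) auto
  then have "1 / (K * r) ^ w q \<le> 1 / r ^ w q / K"
    using step.prems by (simp add: power_mult_distrib divide_simps mult.commute)
  then have "l / K + 1 / (K * r) ^ w q \<le> (l + 1 / r ^ w q) / K" by (simp add: add_divide_distrib)
  then show ?case using word_le_mono[OF word_le.step[OF step.IH step.hyps(2,3,4)]] step.prems by simp
qed

lemma word_le_unit:
  assumes "word_le p r l x" "0 < r" "l \<le> K" "1 \<le> K"
  shows "word_le p (K * r) 1 x"
  using word_le_mono[OF word_le_scale[OF assms(1,2,4)], of 1] assms by simp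

lemma word_le_pow: "word_le p r l x \<Longrightarrow> 0 < r \<Longrightarrow> word_le p r (real n * l) (x [^] n)"
proof (induction n)
  case 0
  then show ?case by (simp add: word_le.one)
next
  case (Suc n)
  then show ?case using word_le_mult[of p r "real n * l" "x [^] n" l x] by (simp add: algebra_simps)
qed

lemma word_le_int_pow:
  assumes "word_le p r l x" "0 < r"
  shows "word_le p r (of_int \<bar>a\<bar> * l) (x [^] (a::int))"
proof (cases "0 \<le> a")
  case True
  then have "x [^] a = x [^] nat a" using int_pow_cases[OF word_le_carrier[OF assms(1)], of a] by simp
  then show ?thesis using word_le_pow[OF assms, of "nat a"] True by simp
next
  case False
  then have "x [^] a = inv x [^] nat (- a)" using int_pow_cases[OF word_le_carrier[OF assms(1)], of a] by simp
  then show ?thesis using word_le_pow[OF word_le_inv[OF assms] assms(2), of "nat (- a)"] False by simp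
qed

text \<open>The conclusion is preserved by products and inverses, because conjugation by a fixed
  \<open>z\<close> is a homomorphism. The set \<open>Z r\<close> will consist of the powers of one letter that are
  admitted at the scale \<open>r\<close>.\<close>

lemma word_le_generate_conj:
  assumes x: "x \<in> generate G {y q | q. P q}" and P: "\<And>q. P q \<Longrightarrow> q < N"
    and Z: "\<And>r. Z r \<subseteq> carrier G"
    and gens: "\<And>q. P q \<Longrightarrow> \<exists>C\<ge>0. \<forall>r\<ge>1. \<forall>z\<in>Z r. word_le p r (C / r ^ k) (inv z \<otimes> y q \<otimes> z)"
  shows "\<exists>C\<ge>0. \<forall>r\<ge>1. \<forall>z\<in>Z r. word_le p r (C / r ^ k) (inv z \<otimes> x \<otimes> z)"
  using x
proof (induction rule: generate.induct)
  case one
  then show ?case using Z by (intro exI[of _ 0]) (auto intro!: word_le.one simp: subset_iff)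
next
  case (incl h)
  then show ?case using gens by auto
next
  case (inv h)
  then obtain q where q: "P q" "h = y q" by auto
  obtain C where C: "C \<ge> 0" "\<forall>r\<ge>1. \<forall>z\<in>Z r. word_le p r (C / r ^ k) (inv z \<otimes> y q \<otimes> z)"
    using gens[OF q(1)] by auto
  have "word_le p r (C / r ^ k) (inv z \<otimes> inv h \<otimes> z)" if "r \<ge> 1" "z \<in> Z r" for r z
  proof -
    have z: "z \<in> carrier G" using Z that by auto
    have "inv z \<otimes> inv h \<otimes> z = inv (inv z \<otimes> y q \<otimes> z)"
      using q P[OF q(1)] z by (simp add: inv_mult_group m_assoc)
    then show ?thesis using word_le_inv C that by simp
  qed
  then show ?case using C by auto
next
  case (eng h1 h2)
  obtain C1 where C1: "C1 \<ge> 0" "\<forall>r\<ge>1. \<forall>z\<in>Z r. word_le p r (C1 / r ^ k) (inv z \<otimes> h1 \<otimes> z)"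
    using eng.IH by auto
  obtain C2 where C2: "C2 \<ge> 0" "\<forall>r\<ge>1. \<forall>z\<in>Z r. word_le p r (C2 / r ^ k) (inv z \<otimes> h2 \<otimes> z)"
    using eng.IH by auto
  have S: "{y q | q. P q} \<subseteq> carrier G" using P by auto
  have "word_le p r ((C1 + C2) / r ^ k) (inv z \<otimes> (h1 \<otimes> h2) \<otimes> z)" if r: "r \<ge> 1" and zr: "z \<in> Z r" for r z
  proof -
    have z: "z \<in> carrier G" using Z zr by auto
    have h: "h1 \<in> carrier G" "h2 \<in> carrier G"
      using eng.hyps generate_in_carrier[OF S] by auto
    have "inv z \<otimes> (h1 \<otimes> h2) \<otimes> z = (inv z \<otimes> h1 \<otimes> z) \<otimes> (inv z \<otimes> h2 \<otimes> z)"
      using h z by (simp add: m_assoc)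
    moreover have "word_le p r (C1 / r ^ k + C2 / r ^ k) \<dots>"
      using C1 C2 r zr by (intro word_le_mult) auto
    ultimately show ?thesis by (simp add: add_divide_distrib)
  qed
  then show ?case using C1 C2 by (intro exI[of _ "C1 + C2"]) auto
qed

lemma word_le_generate:
  assumes x: "x \<in> generate G {y q | q. p \<le> q \<and> q < N \<and> k \<le> w q}"
  shows "\<exists>C\<ge>0. \<forall>r\<ge>1. word_le p r (C / r ^ k) x"
proof -
  have xc: "x \<in> carrier G" by (rule generate_in_carrier[OF _ x]) auto
  have "\<exists>C\<ge>0. \<forall>r\<ge>1. \<forall>z\<in>{\<one>}. word_le p r (C / r ^ k) (inv z \<otimes> x \<otimes> z)"
  proof (rule word_le_generate_conj[OF x])
    fix q assume q: "p \<le> q \<and> q < N \<and> k \<le> w q"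
    have "word_le p r (1 / r ^ k) (y q)" if "r \<ge> 1" for r
      using word_le_mono[OF word_le_letter[of p q "y q" r]] power_weight_le[of r k "w q" 1] q that by auto
    then show "\<exists>C\<ge>0. \<forall>r\<ge>1. \<forall>z\<in>{\<one>}. word_le p r (C / r ^ k) (inv z \<otimes> y q \<otimes> z)"
      using q by (intro exI[of _ 1]) auto
  qed auto
  then show ?thesis using xc by simp
qed

text \<open>With \<open>c = [inv (y q), inv e]\<close> one has \<open>inv e \<otimes> y q \<otimes> e = y q \<otimes> c\<close>, so conjugating
  \<open>y q\<close> by \<open>e [^] a\<close> multiplies it by the conjugates of \<open>c\<close> by the lower powers of \<open>e\<close>.\<close>

lemma word_le_conj_pow:
  assumes "e \<in> carrier G" "q < N" "0 < r" "p \<le> q"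
    and c: "\<And>b::nat. b < a \<Longrightarrow> word_le p r l (inv (e [^] b) \<otimes> (inv (y q) \<otimes> inv e \<otimes> y q \<otimes> e) \<otimes> e [^] b)"
  shows "word_le p r (1 / r ^ w q + real a * l) (inv (e [^] a) \<otimes> y q \<otimes> e [^] a)"
  using c
proof (induction a)
  case 0
  then show ?case using word_le_letter[OF assms(4,2), of "y q"] assms by simp
next
  case (Suc a)
  have IH: "word_le p r (1 / r ^ w q + real a * l) (inv (e [^] a) \<otimes> y q \<otimes> e [^] a)"
    using Suc by simp
  have sp: "e [^] Suc a = e \<otimes> e [^] a" using assms(1) nat_pow_Suc2 by blast
  have "(inv (e [^] a) \<otimes> y q \<otimes> e [^] a) \<otimes> (inv (e [^] a) \<otimes> (inv (y q) \<otimes> inv e \<otimes> y q \<otimes> e) \<otimes> e [^] a)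
     = inv (e [^] Suc a) \<otimes> y q \<otimes> e [^] Suc a"
    unfolding sp using assms by (simp add: m_assoc inv_mult_group)
  moreover have "word_le p r ((1 / r ^ w q + real a * l) + l) \<dots>"
    unfolding calculation[symmetric] by (rule word_le_mult[OF IH Suc.prems[of a] assms(3)]) simp
  moreover have "(1 / r ^ w q + real a * l) + l = 1 / r ^ w q + real (Suc a) * l"
    by (simp add: algebra_simps)
  ultimately show ?case by metis
qed

text \<open>The key estimate: conjugating a letter by an admitted power of an earlier letter
  multiplies its cost by a constant only. The conjugation creates up to \<open>r ^ w p\<close>
  commutators of weight \<open>w p + w q\<close>, each of cost \<open>C / r ^ (w p + w q)\<close>; as these involve
  later letters only, their own conjugates are controlled by descending induction on \<open>q\<close>.\<close>

lemma conj_letter: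
  assumes "p < q" "q < N"
  shows "\<exists>C\<ge>0. \<forall>r\<ge>1. \<forall>z\<in>{y p [^] a | a::int. of_int \<bar>a\<bar> \<le> r ^ w p}.
     word_le (Suc p) r (C / r ^ w q) (inv z \<otimes> y q \<otimes> z)"
  using assms
proof (induction "N - q" arbitrary: q rule: less_induct)
  case less
  have pN: "p < N" using less.prems by simp
  define Z where "Z = (\<lambda>r. {y p [^] a | a::int. of_int \<bar>a\<bar> \<le> (r::real) ^ w p})"
  have Zc: "Z r \<subseteq> carrier G" for r unfolding Z_def using pN by auto
  define k where "k = w p + w q"
  have bound: "\<exists>C\<ge>0. \<forall>r\<ge>1. \<forall>z\<in>Z r. word_le (Suc p) r (C / r ^ k) (inv z \<otimes> c \<otimes> z)"
    if "c \<in> LC k" for c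
  proof (rule word_le_generate_conj[OF _ _ Zc])
    show "c \<in> generate G {y q' | q'. q' < N \<and> k \<le> w q'}"
      using that LC_letters[of k] w_pos[OF pN] unfolding k_def by simp
    fix q' assume q': "q' < N \<and> k \<le> w q'"
    then have "q < q'" using w_mono[of q' q] w_pos[OF pN] less.prems unfolding k_def
      by (cases "q < q'") auto
    then have "N - q' < N - q" "p < q'" "q' < N" using less.prems q' by auto
    from less.hyps[OF this] obtain C where C: "C \<ge> 0"
      "\<forall>r\<ge>1. \<forall>z\<in>Z r. word_le (Suc p) r (C / r ^ w q') (inv z \<otimes> y q' \<otimes> z)"
      unfolding Z_def by blast
    have "word_le (Suc p) r (C / r ^ k) (inv z \<otimes> y q' \<otimes> z)" if "r \<ge> 1" "z \<in> Z r" for r z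
      using word_le_mono[OF C(2)[rule_format, OF that]] power_weight_le[of r k "w q'" C] q' that C(1) by auto
    then show "\<exists>C\<ge>0. \<forall>r\<ge>1. \<forall>z\<in>Z r. word_le (Suc p) r (C / r ^ k) (inv z \<otimes> y q' \<otimes> z)"
      using C(1) by auto
  qed auto
  have cmem: "inv (y q) \<otimes> inv e \<otimes> y q \<otimes> e \<in> LC k" if e: "e = y p \<or> e = inv (y p)" for e
  proof -
    have yl: "y i \<in> LC (w i)" if "i < N" for i
      unfolding LC_letters[OF w_pos[OF that]] using that by (auto intro: generate.incl)
    have "inv e \<in> LC (w p)" using yl[OF pN] LC_inv e pN by auto
    moreover have "inv (y q) \<in> LC (w q)" using yl less.prems LC_inv by auto
    ultimately have "comm (inv (y q)) (inv e) \<in> LC (w q + w p)"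
      by (intro comm_LC w_pos) (use pN less.prems in auto)
    moreover have "inv (inv e) = e" "inv (inv (y q)) = y q" using e pN less.prems by auto
    moreover have "w q + w p = k" unfolding k_def by simp
    ultimately show ?thesis by (simp only:)
  qed
  have one: "\<exists>C\<ge>0. \<forall>r\<ge>1. \<forall>a::nat. real a \<le> r ^ w p \<longrightarrow>
      word_le (Suc p) r (C / r ^ w q) (inv (e [^] a) \<otimes> y q \<otimes> e [^] a)"
    if e: "e = y p \<or> e = inv (y p)" for e
  proof -
    obtain C where C: "C \<ge> 0"
      "\<forall>r\<ge>1. \<forall>z\<in>Z r. word_le (Suc p) r (C / r ^ k) (inv z \<otimes> (inv (y q) \<otimes> inv e \<otimes> y q \<otimes> e) \<otimes> z)"
      using bound[OF cmem[OF e]] by blast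
    have ec: "e \<in> carrier G" using e pN by auto
    have "word_le (Suc p) r ((1 + C) / r ^ w q) (inv (e [^] a) \<otimes> y q \<otimes> e [^] a)"
      if r: "r \<ge> 1" and a: "real a \<le> r ^ w p" for r and a :: nat
    proof -
      have "word_le (Suc p) r (1 / r ^ w q + real a * (C / r ^ k)) (inv (e [^] a) \<otimes> y q \<otimes> e [^] a)"
      proof (rule word_le_conj_pow[OF ec])
        fix b :: nat assume "b < a"
        then have b: "real b \<le> r ^ w p" using a by simp
        have "e [^] b = y p [^] int b \<or> e [^] b = y p [^] (- int b)"
          using e int_pow_cases[of "y p" "int b"] int_pow_cases[of "y p" "- int b"] pN
          by (cases "b = 0") auto
        then have "e [^] b \<in> Z r" unfolding Z_def using b by force
        then show "word_le (Suc p) r (C / r ^ k) (inv (e [^] b) \<otimes> (inv (y q) \<otimes> inv e \<otimes> y q \<otimes> e) \<otimes> e [^] b)"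
          using C(2) r by blast
      qed (use less.prems r in auto)
      moreover have "1 / r ^ w q + real a * (C / r ^ k) \<le> (1 + C) / r ^ w q"
      proof -
        have "real a * (C / r ^ k) \<le> r ^ w p * (C / r ^ k)"
          using a C(1) r by (intro mult_right_mono) auto
        also have "\<dots> = C / r ^ w q" using r unfolding k_def by (simp add: power_add)
        finally show ?thesis by (simp add: add_divide_distrib)
      qed
      ultimately show ?thesis using word_le_mono by blast
    qed
    then show ?thesis using C(1) by (intro exI[of _ "1 + C"]) auto
  qed
  obtain C1 where C1: "C1 \<ge> 0" "\<forall>r\<ge>1. \<forall>a::nat. real a \<le> r ^ w p \<longrightarrow>
      word_le (Suc p) r (C1 / r ^ w q) (inv (y p [^] a) \<otimes> y q \<otimes> y p [^] a)"
    using one[of "y p"] by auto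
  obtain C2 where C2: "C2 \<ge> 0" "\<forall>r\<ge>1. \<forall>a::nat. real a \<le> r ^ w p \<longrightarrow>
      word_le (Suc p) r (C2 / r ^ w q) (inv (inv (y p) [^] a) \<otimes> y q \<otimes> inv (y p) [^] a)"
    using one[of "inv (y p)"] by auto
  have "word_le (Suc p) r ((C1 + C2) / r ^ w q) (inv z \<otimes> y q \<otimes> z)" if r: "r \<ge> 1" and "z \<in> Z r" for r z
  proof -
    obtain a :: int where a: "z = y p [^] a" "of_int \<bar>a\<bar> \<le> r ^ w p" using \<open>z \<in> Z r\<close> unfolding Z_def by auto
    have m: "C1 / r ^ w q \<le> (C1 + C2) / r ^ w q" "C2 / r ^ w q \<le> (C1 + C2) / r ^ w q"
      by (rule divide_right_mono; use C1(1) C2(1) r in simp)+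
    show ?thesis
    proof (cases "0 \<le> a")
      case True
      then have "z = y p [^] nat a" unfolding a(1) by (subst int_pow_cases) (use pN True in simp_all)
      moreover have "real (nat a) \<le> r ^ w p" using a(2) True by simp
      ultimately show ?thesis using word_le_mono[OF C1(2)[rule_format, OF r, of "nat a"] m(1)] by simp
    next
      case False
      then have "z = inv (y p) [^] nat (- a)" unfolding a(1) by (subst int_pow_cases) (use pN False in simp_all)
      moreover have "real (nat (- a)) \<le> r ^ w p" using a(2) False by simp
      ultimately show ?thesis using word_le_mono[OF C2(2)[rule_format, OF r, of "nat (- a)"] m(2)] by simp
    qed
  qed
  then show ?case using C1(1) C2(1) unfolding Z_def by (intro exI[of _ "C1 + C2"]) auto
qed

end

section \<open>Collection and normal forms\<close>

lemma abs_div_le_abs: "\<bar>m div int n\<bar> \<le> \<bar>m\<bar>"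
proof (cases "n = 0")
  case False
  then have n: "1 \<le> int n" by simp
  have e: "m = int n * (m div int n) + m mod int n" by simp
  have s: "0 \<le> m mod int n" "m mod int n < int n" using False by auto
  show ?thesis
  proof (cases "0 \<le> m div int n")
    case True
    then have "1 * (m div int n) \<le> int n * (m div int n)" using n by (intro mult_right_mono) auto
    then show ?thesis using True e s by linarith
  next
    case neg: False
    have "(m div int n + 1) * int n \<le> (m div int n + 1) * 1"
      using neg n by (intro mult_left_mono_neg) auto
    then have "int n * (m div int n) + int n \<le> m div int n + 1" by (simp add: algebra_simps)
    then have "m \<le> m div int n" using e s by linarith
    then show ?thesis using neg by linarith
  qed
qed simp

lemma (in group) int_pow_diff_solve:
  assumes "a \<in> carrier G" "h \<in> carrier G" "h' \<in> carrier G" "a [^] (i::int) \<otimes> h = a [^] (j::int) \<otimes> h'"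
  shows "a [^] (i - j) = h' \<otimes> inv h"
proof -
  have 1: "a [^] (i - j) = a [^] (- j) \<otimes> a [^] i"
    using assms(1) int_pow_mult[of a "- j" i] by simp
  have "a [^] i = (a [^] i \<otimes> h) \<otimes> inv h" using assms(1,2) by (simp add: m_assoc)
  also have "\<dots> = a [^] j \<otimes> (h' \<otimes> inv h)" unfolding assms(4) using assms(1-3) by (simp add: m_assoc)
  finally show ?thesis unfolding 1 using assms(1-3) by (simp add: int_pow_neg)
qed

context graded_letters begin

text \<open>All occurrences of \<open>y p\<close> are moved to the front. Each of the other letters is thereby
  conjugated by a power of \<open>y p\<close>, whose exponent is at most \<open>r ^ w p\<close> because the whole word
  costs at most 1; \<open>conj_letter\<close> bounds the new cost.\<close>

lemma collect:
  assumes pN: "p < N"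
  shows "\<exists>C\<ge>1. \<forall>r\<ge>1. \<forall>l x. word_le p r l x \<longrightarrow> l \<le> 1 \<longrightarrow>
    (\<exists>(m::int) v. x = y p [^] m \<otimes> v \<and> of_int \<bar>m\<bar> \<le> l * r ^ w p \<and> word_le (Suc p) r (C * l) v)"
proof -
  define Z where "Z = (\<lambda>r. {y p [^] a | a::int. of_int \<bar>a\<bar> \<le> (r::real) ^ w p})"
  define B where "B = (\<lambda>q C. \<forall>r\<ge>1. \<forall>z\<in>Z r. word_le (Suc p) r (C / r ^ w q) (inv z \<otimes> y q \<otimes> z))"
  have "\<exists>C\<ge>1. \<forall>q\<in>{p<..<N}. B q C"
  proof (rule finite_uniform_const)
    fix q assume "q \<in> {p<..<N}"
    then show "\<exists>C. B q C" using conj_letter[of p q] unfolding B_def Z_def by auto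
  next
    fix q C C' assume "B q C" and le: "C \<le> (C'::real)"
    then show "B q C'" unfolding B_def
      by (auto intro!: word_le_mono[of "Suc p" _ "C / _ ^ w q" _ "C' / _ ^ w q"] divide_right_mono)
  qed simp
  then obtain C where C: "C \<ge> 1"
    and B: "\<And>q r z. p < q \<Longrightarrow> q < N \<Longrightarrow> 1 \<le> r \<Longrightarrow> z \<in> Z r \<Longrightarrow> word_le (Suc p) r (C / r ^ w q) (inv z \<otimes> y q \<otimes> z)"
    unfolding B_def by auto
  have "\<exists>(m::int) v. x = y p [^] m \<otimes> v \<and> of_int \<bar>m\<bar> \<le> l * r ^ w p \<and> word_le (Suc p) r (C * l) v"
    if "word_le p r l x" "1 \<le> r" "l \<le> 1" for r l x
    using that
  proof (induction rule: word_le.induct)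
    case (one l)
    then show ?case
      using C by (intro exI[of _ 0] exI[of _ \<one>]) (auto intro!: word_le.one)
  next
    case (step l x q t)
    have r: "r > 0" using step.prems by simp
    have inv0: "0 < 1 / r ^ w q" using r by simp
    obtain m :: int and v where m: "x = y p [^] m \<otimes> v" "of_int \<bar>m\<bar> \<le> l * r ^ w p" "word_le (Suc p) r (C * l) v"
      using step.IH step.prems inv0 by fastforce
    have vc: "v \<in> carrier G" and tc: "t \<in> carrier G" using m letter_closed[OF step.hyps(3,4)] by auto
    have l: "0 \<le> l" "l \<le> 1" using word_le_nonneg[OF step.hyps(1) r] step.prems inv0 by linarith+
    show ?case
    proof (cases "q = p")
      case True
      obtain e :: int where e: "t = y p [^] e" "\<bar>e\<bar> = 1"
      proof (cases "t = y p")
        case True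
        then show thesis using that[of 1] pN by simp
      next
        case False
        then have "t = y p [^] (- 1 :: int)" using step.hyps(4) \<open>q = p\<close> pN int_pow_neg[of "y p" 1] by auto
        then show thesis using that[of "- 1"] by simp
      qed
      have "t \<otimes> x = y p [^] (e + m) \<otimes> v"
        using m(1) e(1) vc pN int_pow_mult[of "y p" e m] by (simp add: m_assoc)
      moreover have "of_int \<bar>e + m\<bar> \<le> (l + 1 / r ^ w q) * r ^ w p"
      proof -
        have "of_int \<bar>e + m\<bar> \<le> 1 + (of_int \<bar>m\<bar> :: real)" using e(2) by linarith
        then show ?thesis using m(2) True r by (simp add: algebra_simps)
      qed
      moreover have "word_le (Suc p) r (C * (l + 1 / r ^ w q)) v"
        by (rule word_le_mono[OF m(3)]) (use C r in auto)
      ultimately show ?thesis by blast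
    next
      case False
      define z where "z = y p [^] m"
      have zc: "z \<in> carrier G" unfolding z_def using pN by simp
      have "l * r ^ w p \<le> 1 * r ^ w p" using l r by (intro mult_right_mono) auto
      then have zZ: "z \<in> Z r" unfolding z_def Z_def using m(2) by force
      have conj: "word_le (Suc p) r (C / r ^ w q) (inv z \<otimes> y q \<otimes> z)"
        using False step.hyps step.prems zZ by (intro B) auto
      have "word_le (Suc p) r (C / r ^ w q) (inv z \<otimes> t \<otimes> z)"
      proof (cases "t = y q")
        case False
        then have "inv z \<otimes> t \<otimes> z = inv (inv z \<otimes> y q \<otimes> z)"
          using step.hyps zc by (auto simp: m_assoc inv_mult_group)
        then show ?thesis using word_le_inv[OF conj r] by simp
      qed (use conj in simp)
      then have "word_le (Suc p) r (C / r ^ w q + C * l) ((inv z \<otimes> t \<otimes> z) \<otimes> v)"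
        using m(3) r by (intro word_le_mult) auto
      moreover have "C / r ^ w q + C * l = C * (l + 1 / r ^ w q)" by (simp add: algebra_simps)
      moreover have "t \<otimes> x = z \<otimes> ((inv z \<otimes> t \<otimes> z) \<otimes> v)"
        unfolding m(1) z_def[symmetric] using zc vc tc by (simp add: m_assoc)
      moreover have "of_int \<bar>m\<bar> \<le> (l + 1 / r ^ w q) * r ^ w p"
        by (rule order_trans[OF m(2)]) (use r in \<open>simp add: mult_right_mono\<close>)
      ultimately show ?thesis unfolding z_def by metis
    qed
  qed
  then show ?thesis using C by blast
qed

definition tail_subgroup :: "nat \<Rightarrow> 'a set" where
  "tail_subgroup p = generate G {y q | q. p \<le> q \<and> q < N}"

text \<open>The order of \<open>y p\<close> modulo the later letters, with 0 standing for infinite order.\<close>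

definition rel_ord :: "nat \<Rightarrow> nat" where
  "rel_ord p = (if \<exists>n\<ge>1. y p [^] (n::nat) \<in> tail_subgroup (Suc p)
     then LEAST n. n \<ge> 1 \<and> y p [^] n \<in> tail_subgroup (Suc p) else 0)"

lemma tail_subgroup: "subgroup (tail_subgroup p) G"
  unfolding tail_subgroup_def by (rule generate_is_subgroup) auto

lemma rel_ord_pos:
  assumes "rel_ord p > 0"
  shows "y p [^] rel_ord p \<in> tail_subgroup (Suc p)"
proof -
  have "\<exists>n. n \<ge> 1 \<and> y p [^] (n::nat) \<in> tail_subgroup (Suc p)"
    using assms unfolding rel_ord_def by (auto split: if_splits)
  then show ?thesis using LeastI_ex[of "\<lambda>n. n \<ge> 1 \<and> y p [^] (n::nat) \<in> tail_subgroup (Suc p)"]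
    unfolding rel_ord_def by auto
qed

lemma rel_ord_le:
  assumes "y p [^] (n::nat) \<in> tail_subgroup (Suc p)" "n \<ge> 1"
  shows "0 < rel_ord p" "rel_ord p \<le> n"
proof -
  have ex: "\<exists>n\<ge>1. y p [^] (n::nat) \<in> tail_subgroup (Suc p)" using assms by blast
  then have e: "rel_ord p = (LEAST n. n \<ge> 1 \<and> y p [^] n \<in> tail_subgroup (Suc p))"
    unfolding rel_ord_def by simp
  show "0 < rel_ord p"
    using LeastI_ex[OF ex[unfolded Bex_def]] e by auto
  show "rel_ord p \<le> n" unfolding e by (rule Least_le) (use assms in auto)
qed

text \<open>Both uniqueness of exponents and the vanishing of exponents of small weight rest on
  this.\<close>

lemma int_pow_in_tail:
  assumes p: "p < N" and d: "y p [^] (d::int) \<in> tail_subgroup (Suc p)"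
    and bound: "0 < rel_ord p \<Longrightarrow> \<bar>d\<bar> < int (rel_ord p)"
  shows "d = 0"
proof (rule ccontr)
  assume "d \<noteq> 0"
  have "y p [^] \<bar>d\<bar> \<in> tail_subgroup (Suc p)"
    using d subgroup.m_inv_closed[OF tail_subgroup d] int_pow_neg[of "y p" d] p by (auto simp: abs_if)
  then have f: "y p [^] nat \<bar>d\<bar> \<in> tail_subgroup (Suc p)" using int_pow_int[of G "y p" "nat \<bar>d\<bar>"] by simp
  have "1 \<le> nat \<bar>d\<bar>" using \<open>d \<noteq> 0\<close> by simp
  from rel_ord_le[OF f this] have "0 < rel_ord p" "rel_ord p \<le> nat \<bar>d\<bar>" .
  then show False using bound by auto
qed

text \<open>If \<open>y p\<close> has finite relative order \<open>n\<close>, then \<open>y p [^] n\<close> is a fixed word in later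
  letters, all of weight at least \<open>w p\<close>, so that replacing \<open>n\<close>-th powers of \<open>y p\<close> by this
  word changes the cost by a constant factor only.\<close>

lemma collect_reduced:
  assumes p: "p < N"
  shows "\<exists>C\<ge>1. \<forall>r\<ge>1. \<forall>x. word_le p r 1 x \<longrightarrow>
    (\<exists>(m::int) v. x = y p [^] m \<otimes> v \<and> of_int \<bar>m\<bar> \<le> (C * r) ^ w p \<and>
       (0 < rel_ord p \<longrightarrow> 0 \<le> m \<and> m < int (rel_ord p)) \<and> word_le (Suc p) (C * r) 1 v)"
proof -
  obtain C where C: "C \<ge> 1" and coll: "\<And>r x. r \<ge> 1 \<Longrightarrow> word_le p r 1 x \<Longrightarrow>
    (\<exists>(m::int) v. x = y p [^] m \<otimes> v \<and> of_int \<bar>m\<bar> \<le> r ^ w p \<and> word_le (Suc p) r C v)"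
    using collect[OF p] by fastforce
  have pw: "r ^ w p \<le> (K * r) ^ w p" if "1 \<le> K" "1 \<le> r" for K r :: real
    using that by (intro power_mono) (auto simp: mult_le_cancel_right1)
  show ?thesis
  proof (cases "rel_ord p = 0")
    case True
    have "\<exists>(m::int) v. x = y p [^] m \<otimes> v \<and> of_int \<bar>m\<bar> \<le> (C * r) ^ w p \<and> word_le (Suc p) (C * r) 1 v"
      if r: "r \<ge> 1" and x: "word_le p r 1 x" for r x
    proof -
      obtain m :: int and v where m: "x = y p [^] m \<otimes> v" "of_int \<bar>m\<bar> \<le> r ^ w p" "word_le (Suc p) r C v"
        using coll[OF r x] by blast
      have "word_le (Suc p) (C * r) 1 v" using word_le_unit[OF m(3)] C r by simp
      moreover have "of_int \<bar>m\<bar> \<le> (C * r) ^ w p" using m(2) pw[OF C r] by linarith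
      ultimately show ?thesis using m(1) by blast
    qed
    then show ?thesis using C True by (intro exI[of _ C]) auto
  next
    case False
    define n where "n = rel_ord p"
    define g where "g = y p [^] n"
    have g: "g \<in> tail_subgroup (Suc p)" unfolding g_def n_def using rel_ord_pos False by simp
    have "{y q | q. Suc p \<le> q \<and> q < N} \<subseteq> {y q | q. Suc p \<le> q \<and> q < N \<and> w p \<le> w q}"
    proof clarify
      fix q assume "Suc p \<le> q" "q < N"
      then show "\<exists>q'. y q = y q' \<and> Suc p \<le> q' \<and> q' < N \<and> w p \<le> w q'"
        using w_mono[of p q] by (intro exI[of _ q]) simp
    qed
    from mono_generate[OF this] g
    have "g \<in> generate G {y q | q. Suc p \<le> q \<and> q < N \<and> w p \<le> w q}" unfolding tail_subgroup_def by blast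
    from word_le_generate[OF this] obtain C0 where C0: "C0 \<ge> 0" "\<And>r. r \<ge> 1 \<Longrightarrow> word_le (Suc p) r (C0 / r ^ w p) g"
      by blast
    define K where "K = C + C0 + real n"
    have K: "K \<ge> 1" unfolding K_def using C C0 by simp
    have "\<exists>(m::int) v. x = y p [^] m \<otimes> v \<and> of_int \<bar>m\<bar> \<le> (K * r) ^ w p \<and>
       (0 < rel_ord p \<longrightarrow> 0 \<le> m \<and> m < int (rel_ord p)) \<and> word_le (Suc p) (K * r) 1 v"
      if r: "r \<ge> 1" and x: "word_le p r 1 x" for r x
    proof -
      obtain m :: int and v where m: "x = y p [^] m \<otimes> v" "of_int \<bar>m\<bar> \<le> r ^ w p" "word_le (Suc p) r C v"
        using coll[OF r x] by blast
      have gc: "g \<in> carrier G" unfolding g_def using p by simp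
      define d where "d = m div int n"
      have n: "n \<ge> 1" using False unfolding n_def by simp
      have "y p [^] m = y p [^] (m mod int n) \<otimes> g [^] d"
      proof -
        have "g [^] d = y p [^] (int n * d)"
          unfolding g_def using p int_pow_pow[of "y p" "int n" d] int_pow_int[of G "y p" n]
          by (simp add: mult.commute)
        then show ?thesis using int_pow_mult[of "y p" "m mod int n" "int n * d"] p
          unfolding d_def by (simp add: mod_mult_div_eq mult.commute)
      qed
      then have xe: "x = y p [^] (m mod int n) \<otimes> (g [^] d \<otimes> v)"
        using m(1) word_le_carrier[OF m(3)] gc p by (simp add: m_assoc)
      have "\<bar>d\<bar> \<le> \<bar>m\<bar>" unfolding d_def by (rule abs_div_le_abs)
      then have "of_int \<bar>d\<bar> \<le> r ^ w p" using m(2) by linarith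
      then have dC: "of_int \<bar>d\<bar> * (C0 / r ^ w p) \<le> C0"
        using C0(1) r by (simp add: divide_simps mult.commute mult_left_mono)
      have "word_le (Suc p) r (of_int \<bar>d\<bar> * (C0 / r ^ w p) + C) (g [^] d \<otimes> v)"
        using C0(2)[OF r] m(3) r by (intro word_le_mult word_le_int_pow) auto
      then have "word_le (Suc p) (K * r) 1 (g [^] d \<otimes> v)"
        by (rule word_le_unit) (use dC r K in \<open>auto simp: K_def\<close>)
      moreover have "0 \<le> m mod int n" "m mod int n < int n" using n by auto
      moreover have "of_int \<bar>m mod int n\<bar> \<le> (K * r) ^ w p"
      proof -
        have "of_int \<bar>m mod int n\<bar> \<le> real n"
          using \<open>0 \<le> m mod int n\<close> \<open>m mod int n < int n\<close> by linarith
        also have "\<dots> \<le> K" unfolding K_def using C C0 by simp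
        also have "K \<le> (K * r) ^ 1" using K r by (simp add: mult_le_cancel_left1)
        also have "\<dots> \<le> (K * r) ^ w p" using K r w_pos[OF p]
          by (intro power_increasing) (auto intro: order_trans[OF K] simp: mult_le_cancel_left1)
        finally show ?thesis .
      qed
      ultimately show ?thesis using xe unfolding n_def by blast
    qed
    then show ?thesis using K by blast
  qed
qed

definition nfprod :: "nat \<Rightarrow> (nat \<Rightarrow> int) \<Rightarrow> 'a" where
  "nfprod p m = foldr (\<lambda>q a. y q [^] m q \<otimes> a) [p..<N] \<one>"

text \<open>The exponents of letters of finite relative order are remainders; those of the other
  letters are arbitrary. With this restriction the exponents of an element are unique.\<close>

definition nf_exps :: "nat \<Rightarrow> (nat \<Rightarrow> int) \<Rightarrow> bool" where
  "nf_exps p m \<longleftrightarrow> (\<forall>q. p \<le> q \<longrightarrow> q < N \<longrightarrow> 0 < rel_ord q \<longrightarrow> 0 \<le> m q \<and> m q < int (rel_ord q))"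

lemma nfprod_N [simp]: "nfprod N m = \<one>" by (simp add: nfprod_def)

lemma nfprod_step: "p < N \<Longrightarrow> nfprod p m = y p [^] m p \<otimes> nfprod (Suc p) m"
  by (simp add: nfprod_def upt_conv_Cons)

lemma nfprod_cong: "(\<And>q. p \<le> q \<Longrightarrow> q < N \<Longrightarrow> m q = m' q) \<Longrightarrow> nfprod p m = nfprod p m'"
  unfolding nfprod_def by (rule foldr_cong) auto

lemma nfprod_tail: "p \<le> N \<Longrightarrow> p' \<le> p \<Longrightarrow> nfprod p m \<in> tail_subgroup p'"
proof (induction p rule: inc_induct)
  case base
  then show ?case using subgroup.one_closed[OF tail_subgroup] by simp
next
  case (step n)
  have "y n \<in> tail_subgroup p'" unfolding tail_subgroup_def using step by (auto intro: generate.incl)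
  then have "y n [^] m n \<in> tail_subgroup p'" using group.int_pow_closed[OF subgroup.subgroup_is_group[OF tail_subgroup is_group]]
      int_pow_consistent[OF tail_subgroup] by fastforce
  then show ?case using step subgroup.m_closed[OF tail_subgroup] nfprod_step by simp
qed

lemma nfprod_closed [simp]: "p \<le> N \<Longrightarrow> nfprod p m \<in> carrier G"
  using nfprod_tail[of p p m] subgroup.mem_carrier[OF tail_subgroup] by blast

lemma nf_exps_Suc: "nf_exps p m \<Longrightarrow> nf_exps (Suc p) m"
  unfolding nf_exps_def by auto

lemma word_le_N: "word_le N r l x \<Longrightarrow> x = \<one>"
  by (induction rule: word_le.induct) auto

text \<open>Collection of the letters one after the other. Each step multiplies the scale by a
  constant.\<close>

lemma normal_form:
  assumes "p \<le> N"
  shows "\<exists>C\<ge>1. \<forall>r\<ge>1. \<forall>x. word_le p r 1 x \<longrightarrow>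
    (\<exists>m. x = nfprod p m \<and> nf_exps p m \<and> (\<forall>q. p \<le> q \<longrightarrow> q < N \<longrightarrow> of_int \<bar>m q\<bar> \<le> (C * r) ^ w q))"
  using assms
proof (induction p rule: inc_induct)
  case base
  then show ?case using word_le_N by (intro exI[of _ 1]) (auto simp: nf_exps_def)
next
  case (step p)
  then have p: "p < N" by simp
  obtain C2 where C2: "C2 \<ge> 1" "\<And>r x. r \<ge> 1 \<Longrightarrow> word_le (Suc p) r 1 x \<Longrightarrow>
    (\<exists>m. x = nfprod (Suc p) m \<and> nf_exps (Suc p) m \<and> (\<forall>q. Suc p \<le> q \<longrightarrow> q < N \<longrightarrow> of_int \<bar>m q\<bar> \<le> (C2 * r) ^ w q))"
    using step.IH by blast
  from collect_reduced[OF p] obtain C1 where C1: "C1 \<ge> 1" "\<forall>r\<ge>1. \<forall>x. word_le p r 1 x \<longrightarrow>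
    (\<exists>(m::int) v. x = y p [^] m \<otimes> v \<and> of_int \<bar>m\<bar> \<le> (C1 * r) ^ w p \<and>
       (0 < rel_ord p \<longrightarrow> 0 \<le> m \<and> m < int (rel_ord p)) \<and> word_le (Suc p) (C1 * r) 1 v)"
    by (elim exE conjE) (rule that)
  have "\<exists>m. x = nfprod p m \<and> nf_exps p m \<and> (\<forall>q. p \<le> q \<longrightarrow> q < N \<longrightarrow> of_int \<bar>m q\<bar> \<le> (C2 * C1 * r) ^ w q)"
    if r: "r \<ge> 1" and x: "word_le p r 1 x" for r x
  proof -
    obtain m0 :: int and v where m0: "x = y p [^] m0 \<otimes> v" "of_int \<bar>m0\<bar> \<le> (C1 * r) ^ w p"
      "0 < rel_ord p \<longrightarrow> 0 \<le> m0 \<and> m0 < int (rel_ord p)" "word_le (Suc p) (C1 * r) 1 v"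
      using C1(2)[rule_format, OF r x] by (elim exE conjE) (rule that)
    have C1r: "C1 * r \<ge> 1" using mult_mono[of 1 C1 1 r] C1(1) r by simp
    obtain m where m: "v = nfprod (Suc p) m" "nf_exps (Suc p) m"
      "\<And>q. Suc p \<le> q \<Longrightarrow> q < N \<Longrightarrow> of_int \<bar>m q\<bar> \<le> (C2 * (C1 * r)) ^ w q"
      using C2(2)[OF C1r m0(4)] by (elim exE conjE) blast
    define m' where "m' = m(p := m0)"
    have "nfprod (Suc p) m' = nfprod (Suc p) m" by (rule nfprod_cong) (auto simp: m'_def)
    then have "x = nfprod p m'" using nfprod_step[OF p, of m'] m0(1) m(1) by (simp add: m'_def)
    moreover have "nf_exps p m'" using m(2) m0(3) unfolding nf_exps_def m'_def by auto
    moreover have "of_int \<bar>m' q\<bar> \<le> (C2 * C1 * r) ^ w q" if "p \<le> q" "q < N" for q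
    proof (cases "q = p")
      case True
      have "(C1 * r) ^ w p \<le> (C2 * (C1 * r)) ^ w p"
        using C2(1) C1r by (intro power_mono) (auto simp: mult_le_cancel_right1)
      then show ?thesis using True m0(2) by (simp add: m'_def mult.assoc)
    next
      case False
      then show ?thesis using m(3)[of q] that by (simp add: m'_def mult.assoc)
    qed
    ultimately show ?thesis by blast
  qed
  moreover have "C2 * C1 \<ge> 1" using mult_mono[of 1 C2 1 C1] C1(1) C2(1) by simp
  ultimately show ?case by blast
qed

definition nf_within :: "real \<Rightarrow> (nat \<Rightarrow> int) \<Rightarrow> bool" where
  "nf_within r m \<longleftrightarrow> nf_exps 0 m \<and> (\<forall>q<N. of_int \<bar>m q\<bar> \<le> r ^ w q)"

lemma normal_form_within:
  "\<exists>C\<ge>1. \<forall>r\<ge>1. \<forall>x. word_le 0 r 1 x \<longrightarrow> (\<exists>m. x = nfprod 0 m \<and> nf_within (C * r) m)"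
  using normal_form[of 0] unfolding nf_within_def by simp

lemma nfprod_inj:
  assumes "p \<le> N" "nf_exps p m" "nf_exps p m'" "nfprod p m = nfprod p m'" "p \<le> q" "q < N"
  shows "m q = m' q"
  using assms
proof (induction p arbitrary: q rule: inc_induct)
  case (step p)
  then have p: "p < N" "Suc p \<le> N" by auto
  have e: "y p [^] m p \<otimes> nfprod (Suc p) m = y p [^] m' p \<otimes> nfprod (Suc p) m'"
    using step.prems(3) nfprod_step[OF p(1)] by simp
  have "y p [^] (m p - m' p) = nfprod (Suc p) m' \<otimes> inv (nfprod (Suc p) m)"
    by (rule int_pow_diff_solve[OF _ _ _ e]) (use p in auto)
  also have "\<dots> \<in> tail_subgroup (Suc p)"
    using p nfprod_tail[of "Suc p" "Suc p"] subgroup.m_closed[OF tail_subgroup] subgroup.m_inv_closed[OF tail_subgroup]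
    by auto
  finally have "m p - m' p = 0"
    by (rule int_pow_in_tail[OF p(1)]) (use step.prems(1,2) p in \<open>auto simp: nf_exps_def abs_if; force\<close>)
  then have mp: "m p = m' p" by simp
  have "nfprod (Suc p) m = nfprod (Suc p) m'"
    using e unfolding mp using p by simp
  then show ?case using step.IH[OF nf_exps_Suc nf_exps_Suc] step.prems mp
    by (cases "q = p") auto
qed simp

lemma LC_subset_tail:
  assumes "q < N" "w q < k" shows "LC k \<subseteq> tail_subgroup (Suc q)"
proof -
  have "Suc q \<le> q'" if "q' < N" "k \<le> w q'" for q'
    using w_mono[of q' q] assms that by (cases "Suc q \<le> q'") auto
  then have "{y q' |q'. q' < N \<and> k \<le> w q'} \<subseteq> {y q' |q'. Suc q \<le> q' \<and> q' < N}" by blast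
  from mono_generate[OF this] show ?thesis
    unfolding tail_subgroup_def using LC_letters[of k] assms by simp
qed

text \<open>The \<open>k\<close>-th term of the series lies in the subgroup generated by the letters after any
  letter of weight less than \<open>k\<close>, so the leading exponents must vanish one after the other.\<close>

lemma nfprod_LC:
  assumes "p \<le> N" "nf_exps p m" "nfprod p m \<in> LC k" "p \<le> q" "q < N" "w q < k"
  shows "m q = 0"
  using assms
proof (induction p arbitrary: q rule: inc_induct)
  case (step p)
  then have p: "p < N" "Suc p \<le> N" by auto
  have wp: "w p < k" using step.prems w_mono[of p q] by auto
  have e: "nfprod p m = y p [^] m p \<otimes> nfprod (Suc p) m" by (rule nfprod_step[OF p(1)])
  have t: "nfprod p m \<in> tail_subgroup (Suc p)" using LC_subset_tail[OF p(1) wp] step.prems by blast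
  have "y p [^] m p = nfprod p m \<otimes> inv (nfprod (Suc p) m)"
    unfolding e using p by (simp add: m_assoc)
  also have "\<dots> \<in> tail_subgroup (Suc p)"
    using p t nfprod_tail[of "Suc p" "Suc p"] subgroup.m_closed[OF tail_subgroup] subgroup.m_inv_closed[OF tail_subgroup]
    by auto
  finally have m0: "m p = 0"
    by (rule int_pow_in_tail[OF p(1)]) (use step.prems(1) p in \<open>auto simp: nf_exps_def\<close>)
  then have "nfprod (Suc p) m \<in> LC k" using step.prems e p by simp
  then show ?case using step.IH[OF nf_exps_Suc] step.prems m0
    by (cases "q = p") auto
qed simp

end

section \<open>Word length and distortion\<close>

primrec wball :: "('a, 'b) monoid_scheme \<Rightarrow> 'a set \<Rightarrow> nat \<Rightarrow> 'a set" where
  "wball G A 0 = {\<one>\<^bsub>G\<^esub>}"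
| "wball G A (Suc n) = (\<Union>x\<in>A. \<Union>z\<in>wball G A n. {x \<otimes>\<^bsub>G\<^esub> z})"

definition wlen :: "('a, 'b) monoid_scheme \<Rightarrow> 'a set \<Rightarrow> 'a \<Rightarrow> nat" where
  "wlen G A x = (LEAST n. x \<in> wball G A n)"

lemma finite_wball: "finite A \<Longrightarrow> finite (wball G A n)"
  by (induction n) auto

context group begin

lemma wball_closed: "A \<subseteq> carrier G \<Longrightarrow> wball G A n \<subseteq> carrier G"
  by (induction n) auto

lemma wball_mult:
  assumes "A \<subseteq> carrier G" "x \<in> wball G A m" "z \<in> wball G A n"
  shows "x \<otimes> z \<in> wball G A (m + n)"
  using assms(2)
proof (induction m arbitrary: x)
  case 0
  then show ?case using assms wball_closed[of A n] by auto
next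
  case (Suc m)
  then obtain a u where "a \<in> A" "u \<in> wball G A m" "x = a \<otimes> u" by auto
  moreover have "a \<in> carrier G" "u \<in> carrier G" "z \<in> carrier G"
    using calculation assms wball_closed[OF assms(1)] by blast+
  ultimately show ?case using Suc.IH by (auto simp: m_assoc)
qed

lemma wball_letter: "A \<subseteq> carrier G \<Longrightarrow> a \<in> A \<Longrightarrow> a \<in> wball G A (Suc 0)"
  by (auto intro!: bexI[of _ a])

end

locale sym_gen = group G for G :: "('a, 'b) monoid_scheme" (structure) +
  fixes A :: "'a set"
  assumes finite_gen: "finite A" and gen_closed: "A \<subseteq> carrier G" and one_gen: "\<one> \<in> A"
    and inv_gen: "\<And>x. x \<in> A \<Longrightarrow> inv x \<in> A" and generates: "generate G A = carrier G"
begin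

lemma wball_mono: "m \<le> n \<Longrightarrow> wball G A m \<subseteq> wball G A n"
proof (rule lift_Suc_mono_le[of "wball G A"])
  fix n
  show "wball G A n \<subseteq> wball G A (Suc n)"
  proof
    fix x assume x: "x \<in> wball G A n"
    then have "x = \<one> \<otimes> x" using wball_closed[OF gen_closed, of n] by auto
    then show "x \<in> wball G A (Suc n)" using x one_gen by auto
  qed
qed

lemma wball_inv: "x \<in> wball G A n \<Longrightarrow> inv x \<in> wball G A n"
proof (induction n arbitrary: x)
  case (Suc n)
  then obtain a u where a: "a \<in> A" "u \<in> wball G A n" "x = a \<otimes> u" by auto
  then have "inv u \<otimes> inv a \<in> wball G A (n + Suc 0)"
    using Suc.IH wball_letter[OF gen_closed inv_gen] by (intro wball_mult[OF gen_closed]) auto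
  moreover have "a \<in> carrier G" "u \<in> carrier G" using a gen_closed wball_closed[OF gen_closed] by blast+
  ultimately show ?case using a by (simp add: inv_mult_group del: wball.simps)
qed simp

lemma wball_exhaust:
  assumes "x \<in> carrier G" shows "\<exists>n. x \<in> wball G A n"
proof -
  have "x \<in> generate G A" using assms generates by simp
  then show ?thesis
  proof (induction rule: generate.induct)
    case one
    show ?case by (intro exI[of _ 0]) simp
  next
    case (incl h)
    then show ?case using wball_letter[OF gen_closed] by blast
  next
    case (inv h)
    then show ?case using wball_letter[OF gen_closed inv_gen] by blast
  next
    case (eng h1 h2)
    then show ?case using wball_mult[OF gen_closed] by blast
  qed
qed

lemma wlen_le_iff: "x \<in> carrier G \<Longrightarrow> wlen G A x \<le> n \<longleftrightarrow> x \<in> wball G A n"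
  unfolding wlen_def using wball_exhaust[of x] wball_mono
  by (metis LeastI_ex Least_le subset_iff)

lemma wlen_mem: "x \<in> carrier G \<Longrightarrow> x \<in> wball G A (wlen G A x)"
  using wlen_le_iff by blast

lemma wlen_le: "x \<in> wball G A n \<Longrightarrow> wlen G A x \<le> n"
  using wlen_le_iff wball_closed[OF gen_closed] by blast

lemma wlen_one [simp]: "wlen G A \<one> = 0" using wlen_le[of \<one> 0] by simp

lemma wlen_mult: "x \<in> carrier G \<Longrightarrow> z \<in> carrier G \<Longrightarrow> wlen G A (x \<otimes> z) \<le> wlen G A x + wlen G A z"
  by (intro wlen_le wball_mult gen_closed wlen_mem)

lemma wlen_inv: "x \<in> carrier G \<Longrightarrow> wlen G A (inv x) = wlen G A x"
  using wlen_le[OF wball_inv[OF wlen_mem], of x] wlen_le[OF wball_inv[OF wlen_mem], of "inv x"] by simp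

lemma wlen_pow: "x \<in> carrier G \<Longrightarrow> wlen G A (x [^] (n::nat)) \<le> n * wlen G A x"
proof (induction n)
  case (Suc n)
  then show ?case using wlen_mult[of "x [^] n" x] by simp
qed simp

end

context group begin

lemma commute_pow:
  assumes "a \<in> carrier G" "c \<in> carrier G" "a \<otimes> c = c \<otimes> a"
  shows "a \<otimes> c [^] (n::nat) = c [^] n \<otimes> a"
proof (induction n)
  case (Suc n)
  have "a \<otimes> c [^] Suc n = (a \<otimes> c [^] n) \<otimes> c" using assms by (simp add: m_assoc)
  also have "\<dots> = c [^] n \<otimes> (a \<otimes> c)" unfolding Suc using assms by (simp add: m_assoc)
  finally show ?case unfolding assms(3) using assms(1,2) by (simp add: m_assoc)
qed (use assms in simp)

lemma comm_pow_left:
  assumes "a \<in> carrier G" "b \<in> carrier G" "a \<otimes> comm a b = comm a b \<otimes> a"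
  shows "comm (a [^] (n::nat)) b = comm a b [^] n"
proof (induction n)
  case 0
  then show ?case using assms by simp
next
  case (Suc n)
  define c where "c = comm a b"
  have c: "c \<in> carrier G" unfolding c_def using assms by simp
  have ac: "a \<otimes> c [^] n = c [^] n \<otimes> a"
    by (rule commute_pow[OF assms(1) c]) (use assms(3) in \<open>simp only: c_def\<close>)
  have "comm (a [^] Suc n) b = comm (a \<otimes> a [^] n) b" using assms nat_pow_Suc2 by metis
  also have "\<dots> = (a \<otimes> comm (a [^] n) b \<otimes> inv a) \<otimes> c"
    unfolding c_def by (rule comm_mult_left) (use assms in auto)
  also have "\<dots> = (a \<otimes> c [^] n \<otimes> inv a) \<otimes> c" unfolding Suc c_def ..
  also have "\<dots> = c [^] Suc n" unfolding ac using assms c by (simp add: m_assoc)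
  finally show ?case unfolding c_def .
qed

lemma comm_pow_pow:
  assumes "a \<in> carrier G" "b \<in> carrier G" "a \<otimes> comm a b = comm a b \<otimes> a" "b \<otimes> comm a b = comm a b \<otimes> b"
  shows "comm (a [^] (n::nat)) (b [^] (m::nat)) = comm a b [^] (m * n)"
proof -
  define c where "c = comm a b"
  have c: "c \<in> carrier G" unfolding c_def using assms by simp
  have ci: "comm b a = inv c" unfolding c_def using inv_comm assms by simp
  have "b \<otimes> inv c = inv c \<otimes> b"
    using assms(2,4) c unfolding c_def[symmetric] by (metis inv_closed inv_solve_left inv_solve_right m_assoc m_closed)
  then have "comm (b [^] m) a = inv c [^] m" using comm_pow_left[of b a m] assms ci by simp
  then have "comm a (b [^] m) = inv (inv c [^] m)" using inv_comm[of "b [^] m" a] assms by simp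
  then have cm: "comm a (b [^] m) = c [^] m" using c nat_pow_inv[of c m] by simp
  have "a \<otimes> c [^] m = c [^] m \<otimes> a"
    by (rule commute_pow[OF assms(1) c]) (use assms(3) in \<open>simp only: c_def\<close>)
  then have "comm (a [^] n) (b [^] m) = (c [^] m) [^] n"
    using comm_pow_left[of a "b [^] m" n] assms cm by simp
  then show ?thesis unfolding c_def[symmetric] using c by (simp add: nat_pow_pow)
qed

end

context sym_gen begin

text \<open>The commutator of \<open>n\<close>-th powers of the letters has length \<open>O(n)\<close> and agrees with the
  \<open>n ^ Suc j\<close>-th power of the commutator modulo the next term, because commutators are
  bilinear modulo that term. This is the source of all distortion.\<close>

lemma comm_power_approx:
  assumes "t \<in> simple_comms G A j"
  shows "\<exists>C::nat. \<forall>n\<ge>1. \<exists>v\<in>wball G A (C * n). inv v \<otimes> t [^] (n ^ Suc j) \<in> LC (Suc (Suc j))"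
  using assms
proof (induction j arbitrary: t)
  case 0
  have t: "t \<in> A" "t \<in> carrier G" using 0 gen_closed by auto
  have one: "\<one> \<in> LC (Suc (Suc 0))" using subgroup.one_closed[OF LC_subgroup] .
  have "t [^] n \<in> wball G A n" for n :: nat
    using wlen_pow[OF t(2), of n] wlen_le[OF wball_letter[OF gen_closed t(1)]] wlen_le_iff[of "t [^] n" n] t
    by (metis le_trans mult.right_neutral mult_le_mono2 nat_pow_closed One_nat_def)
  then show ?case using t one by (intro exI[of _ 1]) (auto intro!: bexI[of _ "t [^] _"])
next
  case (Suc j)
  then obtain a s where a: "a \<in> A" "s \<in> simple_comms G A j" and t: "t = comm a s" by auto
  have ac: "a \<in> carrier G" using a gen_closed by auto
  have sL: "s \<in> LC (Suc j)" "s \<in> carrier G" using a simple_comms_LC[OF gen_closed] LC_carrier by blast+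
  obtain C where C: "\<And>n. n \<ge> 1 \<Longrightarrow> \<exists>v\<in>wball G A (C * n). inv v \<otimes> s [^] (n ^ Suc j) \<in> LC (Suc (Suc j))"
    using Suc.IH[OF a(2)] by blast
  define K where "K = LC (Suc (Suc (Suc j)))"
  have Kn: "K \<lhd> G" unfolding K_def by (rule LC_normal)
  obtain Q :: "'a set monoid" and \<pi> where Q: "group_hom G Q \<pi>"
    and one: "\<And>a. a \<in> carrier G \<Longrightarrow> \<pi> a = \<one>\<^bsub>Q\<^esub> \<longleftrightarrow> a \<in> K"
    using quotient_hom[OF Kn] by metis
  interpret h: group_hom G Q \<pi> by (rule Q)
  have central: "\<pi> g \<otimes>\<^bsub>Q\<^esub> \<pi> u = \<pi> u \<otimes>\<^bsub>Q\<^esub> \<pi> g" if g: "g \<in> carrier G" and u: "u \<in> LC (Suc (Suc j))" for g u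
  proof -
    have uc: "u \<in> carrier G" using u LC_carrier by blast
    have "comm g u \<in> K" unfolding K_def using comm_LC_Suc[OF g u] by simp
    then have e: "\<pi> (comm g u) = \<one>\<^bsub>Q\<^esub>" using one[of "comm g u"] g uc by simp
    have "g \<otimes> u = comm g u \<otimes> (u \<otimes> g)" using g uc by (simp add: m_assoc)
    then have "\<pi> (g \<otimes> u) = \<pi> (comm g u) \<otimes>\<^bsub>Q\<^esub> \<pi> (u \<otimes> g)" using g uc h.hom_mult by (metis inv_closed m_closed)
    then show ?thesis unfolding e using g uc by simp
  qed
  have tL: "t \<in> LC (Suc (Suc j))" unfolding t using comm_LC_Suc[OF ac sL(1)] by simp
  have tc: "t \<in> carrier G" using tL LC_carrier by blast
  have "\<exists>v\<in>wball G A ((2 + 2 * C) * n). inv v \<otimes> t [^] (n ^ Suc (Suc j)) \<in> K" if n: "n \<ge> 1" for n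
  proof -
    obtain v where v: "v \<in> wball G A (C * n)" "inv v \<otimes> s [^] (n ^ Suc j) \<in> LC (Suc (Suc j))"
      using C[OF n] by blast
    define u where "u = inv v \<otimes> s [^] (n ^ Suc j)"
    have vc: "v \<in> carrier G" using v wball_closed[OF gen_closed] by blast
    have uc: "u \<in> carrier G" "inv u \<in> LC (Suc (Suc j))" using v(2) LC_inv LC_carrier unfolding u_def by blast+
    have ve: "v = s [^] (n ^ Suc j) \<otimes> inv u" unfolding u_def using vc sL by (simp add: inv_mult_group m_assoc)
    define V where "V = comm (a [^] n) v"
    have an: "a [^] n \<in> wball G A n"
      using wlen_pow[OF ac, of n] wlen_le[OF wball_letter[OF gen_closed a(1)]] wlen_le_iff[of "a [^] n" n] ac
      by (metis le_trans mult.right_neutral mult_le_mono2 nat_pow_closed One_nat_def)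
    have "V \<in> wball G A (n + C * n + n + C * n)" unfolding V_def
      by (intro wball_mult[OF gen_closed] wball_inv an v(1))
    moreover have "n + C * n + n + C * n = (2 + 2 * C) * n" by (simp add: algebra_simps)
    moreover have "inv V \<otimes> t [^] (n ^ Suc (Suc j)) \<in> K"
    proof -
      define \<alpha> where "\<alpha> = \<pi> a"
      define \<sigma> where "\<sigma> = \<pi> s"
      define \<tau> where "\<tau> = \<pi> t"
      define \<nu> where "\<nu> = \<pi> (inv u)"
      have cl: "\<alpha> \<in> carrier Q" "\<sigma> \<in> carrier Q" "\<tau> \<in> carrier Q" "\<nu> \<in> carrier Q"
        unfolding \<alpha>_def \<sigma>_def \<tau>_def \<nu>_def using ac sL tc uc by auto
      have te: "\<tau> = h.H.comm \<alpha> \<sigma>" unfolding \<alpha>_def \<sigma>_def \<tau>_def t using ac sL by simp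
      have c1: "\<alpha> \<otimes>\<^bsub>Q\<^esub> \<tau> = \<tau> \<otimes>\<^bsub>Q\<^esub> \<alpha>" "\<sigma> \<otimes>\<^bsub>Q\<^esub> \<tau> = \<tau> \<otimes>\<^bsub>Q\<^esub> \<sigma>"
        unfolding \<alpha>_def \<sigma>_def \<tau>_def using central tL ac sL by auto
      have cp: "h.H.comm (\<alpha> [^]\<^bsub>Q\<^esub> n) (\<sigma> [^]\<^bsub>Q\<^esub> (n ^ Suc j)) = \<tau> [^]\<^bsub>Q\<^esub> (n ^ Suc j * n)"
        unfolding te by (rule h.H.comm_pow_pow) (use c1 te cl in auto)
      define a' where "a' = \<alpha> [^]\<^bsub>Q\<^esub> n"
      define s' where "s' = \<sigma> [^]\<^bsub>Q\<^esub> (n ^ Suc j)"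
      have cl': "a' \<in> carrier Q" "s' \<in> carrier Q" unfolding a'_def s'_def using cl by auto
      have pa: "\<pi> (a [^] n) = a'" unfolding a'_def \<alpha>_def using ac by (simp add: h.hom_nat_pow)
      have ps: "\<pi> (s [^] (n ^ Suc j)) = s'" unfolding s'_def \<sigma>_def using sL(2) by (rule h.hom_nat_pow)
      have "a' \<otimes>\<^bsub>Q\<^esub> \<nu> = \<nu> \<otimes>\<^bsub>Q\<^esub> a'"
        using central[OF _ uc(2), of "a [^] n"] ac pa unfolding \<nu>_def by simp
      then have "\<nu> \<otimes>\<^bsub>Q\<^esub> inv\<^bsub>Q\<^esub> a' = inv\<^bsub>Q\<^esub> a' \<otimes>\<^bsub>Q\<^esub> \<nu>"
        using cl cl' by (metis h.H.inv_closed h.H.inv_solve_left h.H.inv_solve_right h.H.m_assoc h.H.m_closed)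
      then have "h.H.comm a' (s' \<otimes>\<^bsub>Q\<^esub> \<nu>) = h.H.comm a' s'"
        using cl cl' by (simp add: h.H.inv_mult_group h.H.m_assoc)
      moreover have "\<pi> v = s' \<otimes>\<^bsub>Q\<^esub> \<nu>"
        unfolding ve \<nu>_def ps[symmetric] by (rule h.hom_mult) (use sL uc in auto)
      moreover have "\<pi> V = h.H.comm (\<pi> (a [^] n)) (\<pi> v)" unfolding V_def using ac vc by simp
      ultimately have "\<pi> V = \<tau> [^]\<^bsub>Q\<^esub> (n ^ Suc j * n)" using cp unfolding pa a'_def s'_def by simp
      also have "\<dots> = \<pi> (t [^] (n ^ Suc (Suc j)))"
        unfolding \<tau>_def using h.hom_nat_pow[OF tc, of "n ^ Suc (Suc j)"] by (simp add: mult.commute)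
      finally have pV: "\<pi> V = \<pi> (t [^] (n ^ Suc (Suc j)))" .
      have Vc: "V \<in> carrier G" unfolding V_def using ac vc by simp
      have "\<pi> (inv V \<otimes> t [^] (n ^ Suc (Suc j))) = inv\<^bsub>Q\<^esub> \<pi> V \<otimes>\<^bsub>Q\<^esub> \<pi> (t [^] (n ^ Suc (Suc j)))"
        using h.hom_mult[of "inv V" "t [^] (n ^ Suc (Suc j))"] Vc tc by simp
      also have "\<dots> = \<one>\<^bsub>Q\<^esub>" unfolding pV[symmetric] using Vc by simp
      finally show ?thesis using one[of "inv V \<otimes> t [^] (n ^ Suc (Suc j))"] Vc tc by simp
    qed
    ultimately show ?thesis by metis
  qed
  then show ?case unfolding K_def by blast
qed

end

locale word_letters = sym_gen G A + graded_letters G N y w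
  for G :: "('a, 'b) monoid_scheme" (structure) and A N y w +
  assumes gen_letter: "x \<in> A \<Longrightarrow> \<exists>q<N. y q = x \<and> w q = 1"
    and letter_comm: "q < N \<Longrightarrow> y q \<in> simple_comms G A (w q - 1)"
begin

text \<open>A generator is a letter of weight 1 and costs \<open>1 / r\<close>.\<close>

lemma word_le_wball:
  assumes r: "0 < r" and x: "x \<in> wball G A n" shows "word_le 0 r (real n / r) x"
  using x
proof (induction n arbitrary: x)
  case 0
  then show ?case using r by (auto intro: word_le.one)
next
  case (Suc n)
  then obtain a u where a: "a \<in> A" "u \<in> wball G A n" "x = a \<otimes> u" by auto
  obtain q where q: "q < N" "y q = a" "w q = 1" using gen_letter[OF a(1)] by blast
  have "word_le 0 r (real n / r + 1 / r ^ w q) (y q \<otimes> u)"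
    by (rule word_le.step) (use Suc.IH a q in auto)
  moreover have "real n / r + 1 / r ^ w q = real (Suc n) / r" using q(3) by (simp add: add_divide_distrib)
  ultimately show ?case using q a by simp
qed

definition short_powers :: "nat \<Rightarrow> bool" where
  "short_powers q \<longleftrightarrow> (\<exists>B. \<forall>r\<ge>1. \<forall>m::int. of_int \<bar>m\<bar> \<le> r ^ w q \<longrightarrow> real (wlen G A (y q [^] m)) \<le> B * r)"

lemma wlen_nfprod:
  assumes B: "\<And>q. p \<le> q \<Longrightarrow> q < N \<Longrightarrow> real (wlen G A (y q [^] m q)) \<le> b" "p \<le> N" "0 \<le> b"
  shows "real (wlen G A (nfprod p m)) \<le> real (N - p) * b"
  using assms(2,1)
proof (induction p rule: inc_induct)
  case (step p)
  then have p: "p < N" "Suc p \<le> N" by auto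
  have "real (wlen G A (nfprod p m)) \<le> real (wlen G A (y p [^] m p)) + real (wlen G A (nfprod (Suc p) m))"
    unfolding nfprod_step[OF p(1)] using wlen_mult[of "y p [^] m p" "nfprod (Suc p) m"] p
    by (simp flip: of_nat_add)
  also have "\<dots> \<le> b + real (N - Suc p) * b" using step.IH step.prems p by (intro add_mono) auto
  also have "\<dots> = real (N - p) * b" using p by (simp add: of_nat_diff algebra_simps)
  finally show ?case .
qed simp

text \<open>An element of the \<open>k\<close>-th term has a normal form without letters of smaller weight, so
  that short powers of the remaining letters suffice.\<close>

lemma wlen_word_le_aux:
  assumes k: "1 \<le> k" and sp: "\<And>q. q < N \<Longrightarrow> k \<le> w q \<Longrightarrow> short_powers q"
  shows "\<exists>B\<ge>1. \<forall>r\<ge>1. \<forall>x\<in>LC k. word_le 0 r 1 x \<longrightarrow> real (wlen G A x) \<le> B * r"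
proof -
  have "\<exists>B\<ge>1. \<forall>q\<in>{q. q < N \<and> k \<le> w q}. \<forall>r\<ge>1. \<forall>m::int. of_int \<bar>m\<bar> \<le> r ^ w q \<longrightarrow> real (wlen G A (y q [^] m)) \<le> B * r"
  proof (rule finite_uniform_const)
    fix q and B B' :: real assume B: "\<forall>r\<ge>1. \<forall>m::int. of_int \<bar>m\<bar> \<le> r ^ w q \<longrightarrow> real (wlen G A (y q [^] m)) \<le> B * r"
      and le: "B \<le> B'"
    show "\<forall>r\<ge>1. \<forall>m::int. of_int \<bar>m\<bar> \<le> r ^ w q \<longrightarrow> real (wlen G A (y q [^] m)) \<le> B' * r"
    proof (intro allI impI)
      fix r :: real and m :: int assume r: "1 \<le> r" "of_int \<bar>m\<bar> \<le> r ^ w q"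
      have "real (wlen G A (y q [^] m)) \<le> B * r" using B r by blast
      also have "\<dots> \<le> B' * r" using le r by (intro mult_right_mono) auto
      finally show "real (wlen G A (y q [^] m)) \<le> B' * r" .
    qed
  qed (use sp in \<open>auto simp: short_powers_def\<close>)
  then obtain B where B: "B \<ge> 1" "\<And>q r m. q < N \<Longrightarrow> k \<le> w q \<Longrightarrow> r \<ge> 1 \<Longrightarrow> of_int \<bar>m\<bar> \<le> r ^ w q
      \<Longrightarrow> real (wlen G A (y q [^] (m::int))) \<le> B * r" by blast
  obtain C where C: "C \<ge> 1"
    "\<And>r x. r \<ge> 1 \<Longrightarrow> word_le 0 r 1 x \<Longrightarrow> \<exists>m. x = nfprod 0 m \<and> nf_within (C * r) m"
    using normal_form_within by blast
  have "real (wlen G A x) \<le> (real N * B * C + 1) * r" if r: "r \<ge> 1" and x: "x \<in> LC k" "word_le 0 r 1 x" for r x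
  proof -
    obtain m where m: "x = nfprod 0 m" "nf_exps 0 m" "\<forall>q<N. of_int \<bar>m q\<bar> \<le> (C * r) ^ w q"
      using C(2)[OF r x(2)] unfolding nf_within_def by blast
    have Cr: "C * r \<ge> 1" using mult_mono[of 1 C 1 r] C(1) r by simp
    have "real (wlen G A (nfprod 0 m)) \<le> real (N - 0) * (B * (C * r))"
    proof (rule wlen_nfprod)
      fix q assume q: "q < N"
      show "real (wlen G A (y q [^] m q)) \<le> B * (C * r)"
      proof (cases "k \<le> w q")
        case True
        then show ?thesis using B(2)[OF q True Cr] m(3) q by simp
      next
        case False
        then have "m q = 0" using nfprod_LC[of 0 m k q] m x q by simp
        then show ?thesis using B(1) Cr by simp
      qed
    qed (use B(1) Cr in auto)
    then show ?thesis using m(1) r by (simp add: algebra_simps)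
  qed
  moreover have "real N * B * C + 1 \<ge> 1" using B C by simp
  ultimately show ?thesis by blast
qed

text \<open>Descending induction on the weight \<open>k\<close>. For exponents \<open>n ^ k\<close> the short commutator of
  \<open>comm_power_approx\<close> differs from the power of the letter by an element of the next term.
  Both have cost \<open>O(1)\<close> at the scale \<open>n\<close>, hence so does the difference, and it is short by
  \<open>wlen_word_le_aux\<close>. General exponents are expanded in base \<open>2 ^ k\<close>; the lengths of the
  digits form a geometric series.\<close>

lemma short_powers_step:
  assumes k: "1 \<le> k" and sp: "\<And>q. q < N \<Longrightarrow> Suc k \<le> w q \<Longrightarrow> short_powers q"
    and q: "q < N" "w q = k"
  shows "short_powers q"
proof -
  define t where "t = y q"
  have tc: "t \<in> carrier G" unfolding t_def using q by simp
  obtain B where B: "B \<ge> 1" "\<And>r x. r \<ge> 1 \<Longrightarrow> x \<in> LC (Suc k) \<Longrightarrow> word_le 0 r 1 x \<Longrightarrow> real (wlen G A x) \<le> B * r"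
    using wlen_word_le_aux[of "Suc k"] sp by auto
  obtain C :: nat where C: "\<And>n. n \<ge> 1 \<Longrightarrow> \<exists>v\<in>wball G A (C * n). inv v \<otimes> t [^] (n ^ k) \<in> LC (Suc k)"
    using comm_power_approx[OF letter_comm[OF q(1)]] k unfolding t_def q(2) by auto
  define E where "E = real C + B * (real C + 1)"
  have E: "E \<ge> 0" unfolding E_def using B by simp
  have pw: "real (wlen G A (t [^] (n ^ k))) \<le> E * real n" if n: "n \<ge> 1" for n :: nat
  proof -
    obtain v where v: "v \<in> wball G A (C * n)" "inv v \<otimes> t [^] (n ^ k) \<in> LC (Suc k)" using C[OF n] by blast
    define h where "h = inv v \<otimes> t [^] (n ^ k)"
    have vc: "v \<in> carrier G" using v wball_closed[OF gen_closed] by blast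
    have hc: "h \<in> carrier G" unfolding h_def using vc tc by simp
    have n0: "real n > 0" using n by simp
    have "word_le 0 (real n) (real (C * n) / real n) v" by (rule word_le_wball[OF n0 v(1)])
    then have 1: "word_le 0 (real n) (real C) (inv v)" using n word_le_inv[OF _ n0] by simp
    have "word_le 0 (real n) (real (n ^ k) * (1 / real n ^ w q)) (t [^] (n ^ k))"
      unfolding t_def by (intro word_le_pow word_le_letter) (use q n0 in auto)
    then have 2: "word_le 0 (real n) 1 (t [^] (n ^ k))" using n q by simp
    have "word_le 0 (real n) (real C + 1) h" unfolding h_def by (rule word_le_mult[OF 1 2 n0])
    then have "word_le 0 ((real C + 1) * real n) 1 h" by (rule word_le_unit) (use n0 in auto)
    then have "real (wlen G A h) \<le> B * ((real C + 1) * real n)"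
    proof (rule B(2)[rotated 2])
      have "1 * 1 \<le> (real C + 1) * real n" using n by (intro mult_mono) auto
      then show "1 \<le> (real C + 1) * real n" by simp
      show "h \<in> LC (Suc k)" using v(2) unfolding h_def .
    qed
    moreover have "t [^] (n ^ k) = v \<otimes> h" unfolding h_def using vc tc by simp
    then have "wlen G A (t [^] (n ^ k)) \<le> C * n + wlen G A h"
      using wlen_mult[OF vc hc] wlen_le[OF v(1)] by simp
    then have "real (wlen G A (t [^] (n ^ k))) \<le> real C * real n + real (wlen G A h)"
      by (simp flip: of_nat_add of_nat_mult)
    ultimately show ?thesis unfolding E_def by (simp add: algebra_simps)
  qed
  \<comment> \<open>Expansion in base \<open>2 ^ k\<close>: the digit at position \<open>d\<close> contributes at most \<open>2 ^ k\<close> copies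
    of a power of length \<open>E * 2 ^ d\<close>.\<close>
  have digits: "real (wlen G A (t [^] m)) \<le> 2 ^ k * E * 2 ^ d" if "m < (2 ^ d) ^ k" for d m :: nat
    using that
  proof (induction d arbitrary: m)
    case 0
    then show ?case using E by simp
  next
    case (Suc d)
    define P :: nat where "P = (2 ^ d) ^ k"
    have P: "P > 0" unfolding P_def by simp
    have mP: "m < 2 ^ k * P" using Suc.prems unfolding P_def by (simp add: power_mult_distrib)
    define a where "a = m div P"
    define b where "b = m mod P"
    have a: "a \<le> 2 ^ k" unfolding a_def using mP P by (simp add: less_mult_imp_div_less less_imp_le)
    have b: "b < P" unfolding b_def using P by simp
    have "t [^] m = (t [^] P) [^] a \<otimes> t [^] b"
      using tc unfolding a_def b_def by (simp add: nat_pow_pow nat_pow_mult)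
    then have "wlen G A (t [^] m) \<le> a * wlen G A (t [^] P) + wlen G A (t [^] b)"
      using wlen_mult[of "(t [^] P) [^] a" "t [^] b"] wlen_pow[of "t [^] P" a] tc by simp
    then have "real (wlen G A (t [^] m)) \<le> real a * real (wlen G A (t [^] P)) + real (wlen G A (t [^] b))"
      by (simp flip: of_nat_add of_nat_mult)
    also have "\<dots> \<le> 2 ^ k * (E * 2 ^ d) + 2 ^ k * E * 2 ^ d"
    proof (intro add_mono mult_mono)
      show "real a \<le> 2 ^ k" using a by (metis of_nat_le_iff of_nat_numeral of_nat_power)
      show "real (wlen G A (t [^] P)) \<le> E * 2 ^ d" using pw[of "2 ^ d"] unfolding P_def by simp
      show "real (wlen G A (t [^] b)) \<le> 2 ^ k * E * 2 ^ d" using Suc.IH b unfolding P_def by blast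
    qed auto
    finally show ?case by (simp add: algebra_simps)
  qed
  have "real (wlen G A (y q [^] m)) \<le> (2 ^ k * E * 2) * r" if r: "r \<ge> 1" and m: "of_int \<bar>m\<bar> \<le> r ^ w q" for r and m :: int
  proof -
    obtain d0 where "r < 2 ^ d0" using real_arch_pow[of 2 r] by auto
    define d where "d = (LEAST d. r < 2 ^ d)"
    have d: "r < 2 ^ d" unfolding d_def by (rule LeastI[of _ d0]) fact
    have "d \<noteq> 0" using d r by (cases "d = 0") auto
    then obtain d' where d': "d = Suc d'" by (cases d) auto
    have "\<not> r < 2 ^ d'" using not_less_Least[of d' "\<lambda>d. r < 2 ^ d"] d' unfolding d_def by simp
    then have d2: "2 ^ d \<le> 2 * r" unfolding d' by simp
    have "r ^ k < (2 ^ d) ^ k" using d r k by (intro power_strict_mono) auto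
    then have "real (nat \<bar>m\<bar>) < (2 ^ d) ^ k" using m q by simp
    then have "nat \<bar>m\<bar> < (2 ^ d) ^ k" by (metis of_nat_less_iff of_nat_numeral of_nat_power)
    from digits[OF this] have "real (wlen G A (t [^] nat \<bar>m\<bar>)) \<le> 2 ^ k * E * 2 ^ d" .
    also have "\<dots> \<le> 2 ^ k * E * (2 * r)" using d2 E by (intro mult_left_mono) auto
    finally have le: "real (wlen G A (t [^] nat \<bar>m\<bar>)) \<le> 2 ^ k * E * 2 * r" by simp
    have "wlen G A (t [^] m) = wlen G A (t [^] nat \<bar>m\<bar>)"
    proof (cases "0 \<le> m")
      case True
      then show ?thesis by simp
    next
      case False
      then have "t [^] m = inv (t [^] (- m))" using int_pow_neg[of t "- m"] tc by simp
      also have "\<dots> = inv (t [^] nat \<bar>m\<bar>)" using False by simp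
      finally show ?thesis using wlen_inv[of "t [^] nat \<bar>m\<bar>"] tc by simp
    qed
    then show ?thesis using le unfolding t_def by simp
  qed
  then show ?thesis unfolding short_powers_def by blast
qed

lemma short_powers_all: "q < N \<Longrightarrow> short_powers q"
proof (induction "w (N - 1) - w q" arbitrary: q rule: less_induct)
  case less
  show ?case
  proof (rule short_powers_step[of "w q" q])
    show "1 \<le> w q" using w_pos less.prems .
    fix q' assume q': "q' < N" "Suc (w q) \<le> w q'"
    have "w q' \<le> w (N - 1)" using w_mono[of q' "N - 1"] q' by simp
    then show "short_powers q'" using less.hyps[of q'] q' by simp
  qed (use less.prems in auto)
qed

lemma wlen_word_le: "\<exists>B\<ge>1. \<forall>r\<ge>1. \<forall>x. word_le 0 r 1 x \<longrightarrow> real (wlen G A x) \<le> B * r"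
  using wlen_word_le_aux[of 1] short_powers_all by auto

text \<open>At the scale \<open>r\<close> with \<open>r ^ L = 1 + \<bar>m\<bar>\<close> an element of the \<open>L\<close>-th term costs
  \<open>O(r ^ (- L))\<close>, and its \<open>m\<close>-th power \<open>O(1)\<close>.\<close>

lemma LC_distortion:
  assumes g: "g \<in> LC L" and L: "1 \<le> L"
  shows "\<exists>C\<ge>0. \<forall>m::int. real (wlen G A (g [^] m)) \<le> C * (1 + of_int \<bar>m\<bar>) powr (1 / real L)"
proof -
  obtain B where B: "B \<ge> 1" "\<And>r x. r \<ge> 1 \<Longrightarrow> word_le 0 r 1 x \<Longrightarrow> real (wlen G A x) \<le> B * r"
    using wlen_word_le by blast
  have "g \<in> generate G {y q | q. 0 \<le> q \<and> q < N \<and> L \<le> w q}" using g LC_letters[OF L] by simp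
  from word_le_generate[OF this] obtain C0 where C0: "C0 \<ge> 0" "\<And>r. r \<ge> 1 \<Longrightarrow> word_le 0 r (C0 / r ^ L) g" by blast
  have "real (wlen G A (g [^] m)) \<le> (B * (C0 + 1)) * (1 + of_int \<bar>m\<bar>) powr (1 / real L)" for m :: int
  proof -
    define r where "r = (1 + of_int \<bar>m\<bar> :: real) powr (1 / real L)"
    have r: "r \<ge> 1" unfolding r_def by (rule ge_one_powr_ge_zero) auto
    have rL: "r ^ L = 1 + of_int \<bar>m\<bar>"
      unfolding r_def using L by (simp add: powr_realpow[symmetric] powr_powr)
    have "word_le 0 r (of_int \<bar>m\<bar> * (C0 / r ^ L)) (g [^] m)"
      using C0(2)[OF r] r by (intro word_le_int_pow) auto
    then have "word_le 0 ((C0 + 1) * r) 1 (g [^] m)"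
    proof (rule word_le_unit)
      have "of_int \<bar>m\<bar> * C0 \<le> (1 + of_int \<bar>m\<bar>) * (C0 + 1)"
        using C0(1) by (intro mult_mono) auto
      then show "of_int \<bar>m\<bar> * (C0 / r ^ L) \<le> C0 + 1"
        unfolding rL by (simp add: divide_le_eq mult.commute)
    qed (use r C0 in auto)
    then have "real (wlen G A (g [^] m)) \<le> B * ((C0 + 1) * r)"
    proof (rule B(2)[rotated])
      have "1 * 1 \<le> (C0 + 1) * r" using C0(1) r by (intro mult_mono) auto
      then show "1 \<le> (C0 + 1) * r" by simp
    qed
    then show ?thesis unfolding r_def by simp
  qed
  moreover have "B * (C0 + 1) \<ge> 0" using B C0 by simp
  ultimately show ?thesis by blast
qed

lemma distortion:
  assumes g: "g \<in> carrier G" "g [^] (p::nat) \<in> LC L" and L: "1 \<le> L" and p: "1 \<le> p"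
  shows "\<exists>C\<ge>0. \<forall>m::int. real (wlen G A (g [^] m)) \<le> C * (1 + of_int \<bar>m\<bar>) powr (1 / real L)"
proof -
  obtain C where C: "C \<ge> 0" "\<And>m::int. real (wlen G A ((g [^] p) [^] m)) \<le> C * (1 + of_int \<bar>m\<bar>) powr (1 / real L)"
    using LC_distortion[OF g(2) L] by blast
  have "real (wlen G A (g [^] m)) \<le> (C + real (p * wlen G A g)) * (1 + of_int \<bar>m\<bar>) powr (1 / real L)" for m :: int
  proof -
    define d where "d = m div int p"
    define e where "e = nat (m mod int p)"
    have e: "int e = m mod int p" unfolding e_def using p by simp
    have "e \<le> p" using e p by (metis nat_int_comparison(3) of_nat_0_less_iff order_less_le_trans pos_mod_bound less_imp_le zero_less_one)
    have "m = int p * d + int e" unfolding e d_def by simp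
    then have "g [^] m = (g [^] p) [^] d \<otimes> g [^] e"
      using g int_pow_mult[of g "int p * d" "int e"] int_pow_pow[of g "int p" d] int_pow_int[of G g p] int_pow_int[of G g e]
      by (simp add: mult.commute)
    then have "wlen G A (g [^] m) \<le> wlen G A ((g [^] p) [^] d) + e * wlen G A g"
      using wlen_mult[of "(g [^] p) [^] d" "g [^] e"] wlen_pow[of g e] g by simp
    also have "\<dots> \<le> wlen G A ((g [^] p) [^] d) + p * wlen G A g" using \<open>e \<le> p\<close> by simp
    finally have "real (wlen G A (g [^] m)) \<le> real (wlen G A ((g [^] p) [^] d) + p * wlen G A g)"
      by (simp only: of_nat_le_iff)
    then have "real (wlen G A (g [^] m)) \<le> real (wlen G A ((g [^] p) [^] d)) + real (p * wlen G A g)"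
      by (simp only: of_nat_add)
    also have "\<dots> \<le> C * (1 + of_int \<bar>d\<bar>) powr (1 / real L) + real (p * wlen G A g)" using C(2)[of d] by simp
    also have "\<dots> \<le> C * (1 + of_int \<bar>m\<bar>) powr (1 / real L) + real (p * wlen G A g) * (1 + of_int \<bar>m\<bar>) powr (1 / real L)"
    proof (intro add_mono mult_left_mono C(1))
      have "\<bar>d\<bar> \<le> \<bar>m\<bar>" unfolding d_def by (rule abs_div_le_abs)
      then show "(1 + of_int \<bar>d\<bar>) powr (1 / real L) \<le> (1 + of_int \<bar>m\<bar> :: real) powr (1 / real L)"
        by (intro powr_mono2) auto
      have "1 \<le> (1 + of_int \<bar>m\<bar> :: real) powr (1 / real L)" by (rule ge_one_powr_ge_zero) auto
      then show "real (p * wlen G A g) \<le> real (p * wlen G A g) * (1 + of_int \<bar>m\<bar>) powr (1 / real L)"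
        using mult_left_mono[of 1 _ "real (p * wlen G A g)"] by fastforce
    qed
    finally show ?thesis by (simp add: algebra_simps)
  qed
  moreover have "C + real (p * wlen G A g) \<ge> 0" using C(1) by simp
  ultimately show ?thesis by blast
qed

end

section \<open>Torsion-free ranks and volume growth\<close>

context group begin

text \<open>The sections of the series are abelian because \<open>[LC j, LC j]\<close> lies in \<open>LC (j + j)\<close>.\<close>

lemma LC_section:
  fixes j :: nat
  assumes j: "1 \<le> j"
  defines "Q \<equiv> G\<lparr>carrier := LC j\<rparr> Mod LC (Suc j)"
  shows "\<exists>\<pi>. comm_group Q \<and> (\<forall>x\<in>LC j. \<pi> x \<in> carrier Q) \<and>
    (\<forall>x\<in>LC j. \<forall>z\<in>LC j. \<pi> (x \<otimes> z) = \<pi> x \<otimes>\<^bsub>Q\<^esub> \<pi> z) \<and>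
    (\<forall>x\<in>LC j. \<pi> x = \<one>\<^bsub>Q\<^esub> \<longleftrightarrow> x \<in> LC (Suc j)) \<and>
    (\<forall>a\<in>carrier Q. \<exists>x\<in>LC j. \<pi> x = a) \<and>
    (\<forall>x\<in>LC j. \<forall>n::int. \<pi> (x [^] n) = \<pi> x [^]\<^bsub>Q\<^esub> n)"
proof -
  define H where "H = G\<lparr>carrier := LC j\<rparr>"
  define K where "K = LC (Suc j)"
  have KH: "K \<subseteq> LC j" unfolding K_def by (rule LC_antimono) simp
  interpret H: group H unfolding H_def by (rule subgroup.subgroup_is_group[OF LC_subgroup is_group])
  have "K \<inter> LC j \<lhd> H" unfolding H_def K_def by (rule normal_Int_subgroup[OF LC_subgroup LC_normal])
  moreover have "K \<inter> LC j = K" using KH by auto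
  ultimately interpret K: normal K H by simp
  have Qd: "Q = H Mod K" unfolding Q_def H_def K_def ..
  have gQ: "group (H Mod K)" by (rule K.factorgroup_is_group)
  define \<pi> where "\<pi> = (\<lambda>x. K #>\<^bsub>H\<^esub> x)"
  interpret h: group_hom H "H Mod K" \<pi>
    unfolding \<pi>_def by (intro group_hom.intro group_hom_axioms.intro gQ H.is_group K.r_coset_hom_Mod)
  have carrH: "carrier H = LC j" and multH: "\<And>x z. x \<otimes>\<^bsub>H\<^esub> z = x \<otimes> z" unfolding H_def by auto
  have surj: "\<exists>x\<in>LC j. \<pi> x = a" if "a \<in> carrier (H Mod K)" for a
    using that unfolding \<pi>_def by (auto simp: FactGroup_def RCOSETS_def carrH)
  have ker: "\<pi> x = \<one>\<^bsub>H Mod K\<^esub> \<longleftrightarrow> x \<in> K" if "x \<in> LC j" for x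
    unfolding \<pi>_def using that K.rcos_const H.coset_join1[OF _ _ K.is_subgroup] carrH
    by (auto simp: FactGroup_def)
  have commute: "\<pi> x \<otimes>\<^bsub>H Mod K\<^esub> \<pi> z = \<pi> z \<otimes>\<^bsub>H Mod K\<^esub> \<pi> x" if x: "x \<in> LC j" and z: "z \<in> LC j" for x z
  proof -
    have c: "x \<in> carrier G" "z \<in> carrier G" using x z LC_carrier by auto
    have "comm x z \<in> LC (j + j)" by (rule comm_LC) (use j x z in auto)
    then have "comm x z \<in> K" unfolding K_def using LC_antimono[of "Suc j" "j + j"] j by auto
    then have cz: "comm x z \<in> LC j" "\<pi> (comm x z) = \<one>\<^bsub>H Mod K\<^esub>" using KH ker by auto
    have zx: "z \<otimes> x \<in> LC j" "x \<otimes> z \<in> LC j" using LC_mult x z by auto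
    have "x \<otimes> z = comm x z \<otimes> (z \<otimes> x)" using c by (simp add: m_assoc)
    then have "\<pi> (x \<otimes> z) = \<pi> (comm x z) \<otimes>\<^bsub>H Mod K\<^esub> \<pi> (z \<otimes> x)"
      using h.hom_mult[of "comm x z" "z \<otimes> x"] cz(1) zx carrH multH by simp
    also have "\<dots> = \<pi> (z \<otimes> x)" unfolding cz(2) using h.hom_closed[of "z \<otimes> x"] zx carrH h.H.l_one by blast
    finally show ?thesis using h.hom_mult[of x z] h.hom_mult[of z x] x z carrH multH by simp
  qed
  have "comm_group (H Mod K)"
  proof (rule group.group_comm_groupI[OF gQ])
    fix a b assume "a \<in> carrier (H Mod K)" "b \<in> carrier (H Mod K)"
    then show "a \<otimes>\<^bsub>H Mod K\<^esub> b = b \<otimes>\<^bsub>H Mod K\<^esub> a" using surj commute by metis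
  qed
  moreover have "\<pi> (x [^] n) = \<pi> x [^]\<^bsub>H Mod K\<^esub> n" if "x \<in> LC j" for x and n :: int
    using h.hom_int_pow[of x n] that int_pow_consistent[OF LC_subgroup that, of n] carrH unfolding H_def by simp
  moreover have "\<pi> x \<in> carrier (H Mod K)" if "x \<in> LC j" for x using h.hom_closed that carrH by simp
  moreover have "\<pi> (x \<otimes> z) = \<pi> x \<otimes>\<^bsub>H Mod K\<^esub> \<pi> z" if "x \<in> LC j" "z \<in> LC j" for x z
    using h.hom_mult[of x z] that carrH multH by simp
  ultimately show ?thesis unfolding Qd K_def[symmetric] using surj ker by (intro exI[of _ \<pi>]) blast
qed

end

lemma card_int_box: "card {0..int a} = a + 1"
  by simp

context graded_letters begin

text \<open>The exponents of the letters in \<open>U\<close> that occur in normal forms at the scale \<open>r\<close>.\<close>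

definition exp_box :: "real \<Rightarrow> nat set \<Rightarrow> (nat \<Rightarrow> int) set" where
  "exp_box r U = (\<Pi>\<^sub>E q\<in>U. if rel_ord q = 0 then {- \<lfloor>r ^ w q\<rfloor>..\<lfloor>r ^ w q\<rfloor>} else {0..<int (rel_ord q)})"

lemma finite_exp_box: "finite U \<Longrightarrow> finite (exp_box r U)"
  unfolding exp_box_def by (intro finite_PiE) auto

lemma card_exp_box:
  assumes U: "finite U"
  shows "\<exists>K\<ge>1. \<forall>r\<ge>1. real (card (exp_box r U)) \<le> K * r ^ (\<Sum>q | q \<in> U \<and> rel_ord q = 0. w q)"
proof -
  \<comment> \<open>Three, since there are \<open>2 * k + 1 \<le> 3 * k\<close> integers of absolute value at most \<open>k \<ge> 1\<close>.\<close>
  define c where "c = (\<lambda>q. if rel_ord q = 0 then 3 else real (rel_ord q))"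
  define e where "e = (\<lambda>q. if rel_ord q = 0 then w q else 0)"
  have c1: "1 \<le> c q" for q unfolding c_def by auto
  have "real (card (exp_box r U)) \<le> (\<Prod>q\<in>U. c q) * r ^ (\<Sum>q | q \<in> U \<and> rel_ord q = 0. w q)" if r: "r \<ge> 1" for r
  proof -
    have "real (card (exp_box r U)) = (\<Prod>q\<in>U. real (card (if rel_ord q = 0 then {- \<lfloor>r ^ w q\<rfloor>..\<lfloor>r ^ w q\<rfloor>} else {0..<int (rel_ord q)})))"
      unfolding exp_box_def using U by (simp add: card_PiE)
    also have "\<dots> \<le> (\<Prod>q\<in>U. c q * r ^ e q)"
    proof (rule prod_mono, rule conjI)
      fix q assume "q \<in> U"
      show "real (card (if rel_ord q = 0 then {- \<lfloor>r ^ w q\<rfloor>..\<lfloor>r ^ w q\<rfloor>} else {0..<int (rel_ord q)})) \<le> c q * r ^ e q"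
      proof (cases "rel_ord q = 0")
        case True
        have "1 \<le> r ^ w q" using r by simp
        then have "real (nat (2 * \<lfloor>r ^ w q\<rfloor> + 1)) \<le> 3 * r ^ w q" by linarith
        then show ?thesis using True by (simp add: c_def e_def)
      qed (simp add: c_def e_def)
    qed simp
    also have "\<dots> = (\<Prod>q\<in>U. c q) * r ^ (\<Sum>q\<in>U. e q)" by (simp add: prod.distrib power_sum)
    also have "(\<Sum>q\<in>U. e q) = (\<Sum>q | q \<in> U \<and> rel_ord q = 0. w q)"
      unfolding e_def using U by (simp add: sum.inter_filter)
    finally show ?thesis .
  qed
  moreover have "1 \<le> (\<Prod>q\<in>U. c q)" by (rule prod_ge_1) (rule c1)
  ultimately show ?thesis by blast
qed

lemma restrict_exp_box:
  assumes m: "nf_within r m" and U: "U \<subseteq> {..<N}"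
  shows "restrict m U \<in> exp_box r U"
proof -
  have "m q \<in> (if rel_ord q = 0 then {- \<lfloor>r ^ w q\<rfloor>..\<lfloor>r ^ w q\<rfloor>} else {0..<int (rel_ord q)})" if "q \<in> U" for q
  proof (cases "rel_ord q = 0")
    case True
    have "of_int \<bar>m q\<bar> \<le> r ^ w q" using m U that unfolding nf_within_def by auto
    then have "\<bar>m q\<bar> \<le> \<lfloor>r ^ w q\<rfloor>" by (simp only: le_floor_iff)
    then show ?thesis using True by auto
  next
    case False
    then show ?thesis using m U that unfolding nf_within_def nf_exps_def by auto
  qed
  then show ?thesis unfolding exp_box_def by auto
qed

lemma word_le_nfprod:
  assumes r: "0 < r" and m: "\<And>q. p \<le> q \<Longrightarrow> q < N \<Longrightarrow> of_int \<bar>m q\<bar> \<le> r ^ w q" and p: "p \<le> N"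
  shows "word_le p r (real (N - p)) (nfprod p m)"
  using p m
proof (induction p rule: inc_induct)
  case base
  then show ?case by (simp add: word_le.one)
next
  case (step p)
  then have p: "p < N" by simp
  have "word_le p r (of_int \<bar>m p\<bar> * (1 / r ^ w p)) (y p [^] m p)"
    by (intro word_le_int_pow word_le_letter) (use p r in auto)
  then have "word_le p r 1 (y p [^] m p)"
    by (rule word_le_mono) (use step.prems[of p] p r in \<open>simp add: divide_simps\<close>)
  moreover have "word_le p r (real (N - Suc p)) (nfprod (Suc p) m)"
    using word_le_tail[OF step.IH, of p] step.prems by simp
  ultimately have "word_le p r (1 + real (N - Suc p)) (y p [^] m p \<otimes> nfprod (Suc p) m)"
    by (rule word_le_mult) (rule r)
  moreover have "1 + real (N - Suc p) = real (N - p)" using p by (simp add: of_nat_diff)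
  ultimately show ?case using nfprod_step[OF p, of m] by simp
qed

definition growth_exp :: nat where
  "growth_exp = (\<Sum>q | q < N \<and> rel_ord q = 0. w q)"

text \<open>Letters of weight above \<open>j\<close> do not change a normal form modulo \<open>LC (Suc j)\<close>.\<close>

lemma nfprod_truncate:
  assumes "p \<le> N"
  shows "\<exists>h\<in>LC (Suc j). nfprod p m = nfprod p (\<lambda>q. if w q \<le> j then m q else 0) \<otimes> h"
  using assms
proof (induction p rule: inc_induct)
  case base
  then show ?case using subgroup.one_closed[OF LC_subgroup] by (intro bexI[of _ \<one>]) auto
next
  case (step p)
  then have p: "p < N" "Suc p \<le> N" by auto
  obtain h where h: "h \<in> LC (Suc j)" "nfprod (Suc p) m = nfprod (Suc p) (\<lambda>q. if w q \<le> j then m q else 0) \<otimes> h"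
    using step.IH by blast
  have hc: "h \<in> carrier G" using h LC_carrier by blast
  show ?case
  proof (cases "w p \<le> j")
    case True
    then show ?thesis using h hc p by (intro bexI[of _ h]) (simp_all add: nfprod_step m_assoc)
  next
    case False
    have z: "nfprod p' (\<lambda>q. if w q \<le> j then m q else 0) = \<one>" if "p' \<le> N" "p \<le> p'" for p'
      using that
    proof (induction p' rule: inc_induct)
      case (step n)
      then show ?case using w_mono[of p n] False by (simp add: nfprod_step)
    qed simp
    have "y p \<in> LC (w p)" unfolding LC_letters[OF w_pos[OF p(1)]]
      by (rule generate.incl) (use p in blast)
    then have "y p \<in> LC (Suc j)" using LC_antimono[of "Suc j" "w p"] False by auto
    then have yp: "y p [^] m p \<in> LC (Suc j)"
      using subgroup_int_pow_closed[OF LC_subgroup] by blast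
    have "nfprod (Suc p) m \<in> LC (Suc j)" using h z[of "Suc p"] p hc by simp
    then have "nfprod p m \<in> LC (Suc j)" using LC_mult yp nfprod_step[OF p(1)] by simp
    then show ?thesis using z[of p] p LC_carrier by (intro bexI[of _ "nfprod p m"]) auto
  qed
qed

text \<open>The letters of weight \<open>j\<close> and infinite relative order are independent in the section
  by the uniqueness of normal forms. No independent set \<open>B\<close> can be larger, by counting: the
  products of powers of its elements with exponents up to \<open>n ^ j\<close> are distinct, about
  \<open>n ^ (j * card B)\<close> in number, and they have representatives of cost \<open>O(1)\<close> at the scale
  \<open>n\<close>, whose normal forms modulo \<open>LC (Suc j)\<close> number at most a constant times
  \<open>n ^ (j * card I)\<close>.\<close>

lemma torsion_free_rank_section:
  assumes j: "1 \<le> j"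
  shows "torsion_free_rank (G\<lparr>carrier := LC j\<rparr> Mod LC (Suc j)) = card {q. q < N \<and> rel_ord q = 0 \<and> w q = j}"
proof -
  define Q where "Q = G\<lparr>carrier := LC j\<rparr> Mod LC (Suc j)"
  define I where "I = {q. q < N \<and> rel_ord q = 0 \<and> w q = j}"
  have finI: "finite I" unfolding I_def by simp
  from LC_section[OF j, folded Q_def] obtain \<pi> where \<pi>: "comm_group Q" "\<forall>x\<in>LC j. \<pi> x \<in> carrier Q"
    "\<forall>x\<in>LC j. \<forall>z\<in>LC j. \<pi> (x \<otimes> z) = \<pi> x \<otimes>\<^bsub>Q\<^esub> \<pi> z"
    "\<forall>x\<in>LC j. \<pi> x = \<one>\<^bsub>Q\<^esub> \<longleftrightarrow> x \<in> LC (Suc j)"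
    "\<forall>a\<in>carrier Q. \<exists>x\<in>LC j. \<pi> x = a"
    "\<forall>x\<in>LC j. \<forall>n::int. \<pi> (x [^] n) = \<pi> x [^]\<^bsub>Q\<^esub> n"
    by (elim exE conjE) (rule that)
  note Q = \<pi>(1) and pc = \<pi>(2)[rule_format] and pm = \<pi>(3)[rule_format] and ker = \<pi>(4)[rule_format]
    and surj = \<pi>(5)[rule_format] and pp = \<pi>(6)[rule_format]
  interpret Q: comm_group Q by (rule Q)
  have one_LC: "\<one> \<in> LC k" for k using subgroup.one_closed[OF LC_subgroup] .
  have p1: "\<pi> \<one> = \<one>\<^bsub>Q\<^esub>" using ker[OF one_LC] one_LC by simp
  have yLC: "y q \<in> LC j" if "q \<in> I" for q
  proof -
    have "q < N" "w q = j" using that unfolding I_def by auto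
    then show ?thesis unfolding LC_letters[OF j] by (auto intro: generate.incl)
  qed
  have yLCp: "y q [^] (n::int) \<in> LC j" if "q \<in> I" for q n
    using subgroup_int_pow_closed[OF LC_subgroup yLC[OF that]] .
  have yQ: "\<pi> (y q) \<in> carrier Q" if "q \<in> I" for q using pc yLC that by auto
  have indep: "m q = 0" if fp: "finprod Q (\<lambda>q. \<pi> (y q) [^]\<^bsub>Q\<^esub> (m q :: int)) I = \<one>\<^bsub>Q\<^esub>" and q: "q \<in> I" for m q
  proof -
    define m' where "m' = (\<lambda>q. if q \<in> I then m q else 0)"
    have "nfprod p m' \<in> LC j \<and> \<pi> (nfprod p m') = finprod Q (\<lambda>q. \<pi> (y q) [^]\<^bsub>Q\<^esub> m q) {q\<in>I. p \<le> q}" if "p \<le> N" for p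
      using that
    proof (induction p rule: inc_induct)
      case base
      have e0: "{q \<in> I. N \<le> q} = {}" unfolding I_def by auto
      show ?case unfolding e0 using one_LC p1 by simp
    next
      case (step p)
      then have p: "p < N" by simp
      show ?case
      proof (cases "p \<in> I")
        case True
        have s: "{q\<in>I. p \<le> q} = insert p {q\<in>I. Suc p \<le> q}" using True by auto
        have "\<pi> (nfprod p m') = \<pi> (y p [^] m p) \<otimes>\<^bsub>Q\<^esub> \<pi> (nfprod (Suc p) m')"
          unfolding nfprod_step[OF p] using pm yLCp[OF True] step.IH True by (simp add: m'_def)
        also have "\<dots> = finprod Q (\<lambda>q. \<pi> (y q) [^]\<^bsub>Q\<^esub> m q) {q\<in>I. p \<le> q}"
          unfolding s using step.IH pp[OF yLC[OF True]] finI yQ True by (subst Q.finprod_insert) auto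
        finally show ?thesis using step.IH LC_mult yLCp[OF True] nfprod_step[OF p, of m'] by (simp add: m'_def)
      next
        case False
        then have s: "{q\<in>I. p \<le> q} = {q\<in>I. Suc p \<le> q}" by (auto simp: Suc_le_eq le_less)
        have e: "nfprod p m' = nfprod (Suc p) m'" using nfprod_step[OF p, of m'] False p by (simp add: m'_def)
        show ?thesis unfolding s e by (rule step.IH)
      qed
    qed
    from this[of 0] have "nfprod 0 m' \<in> LC j" "\<pi> (nfprod 0 m') = \<one>\<^bsub>Q\<^esub>" using fp by auto
    then have "nfprod 0 m' \<in> LC (Suc j)" using ker by blast
    moreover have "nf_exps 0 m'" unfolding nf_exps_def m'_def I_def by auto
    moreover have "q < N" "w q < Suc j" using q unfolding I_def by auto
    ultimately have "m' q = 0" using nfprod_LC[of 0 m' "Suc j" q] by simp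
    then show ?thesis using q unfolding m'_def by simp
  qed
  have inj: "inj_on (\<lambda>q. \<pi> (y q)) I"
  proof (rule linorder_inj_onI)
    fix q q' assume qq: "q < q'" "q \<in> I" "q' \<in> I"
    then have qN: "q < N" "q' < N" "w q = j" "rel_ord q = 0" unfolding I_def by auto
    show "\<pi> (y q) \<noteq> \<pi> (y q')"
    proof
      assume eq: "\<pi> (y q) = \<pi> (y q')"
      have iv: "inv (y q') \<in> LC j" using yLC qq LC_inv by blast
      have "\<pi> (y q \<otimes> inv (y q')) = \<pi> (y q' \<otimes> inv (y q'))"
        using pm[OF yLC iv] pm[OF yLC iv] qq eq by simp
      also have "\<dots> = \<one>\<^bsub>Q\<^esub>" using qN p1 by simp
      finally have "y q \<otimes> inv (y q') \<in> LC (Suc j)" using ker[OF LC_mult[OF yLC iv]] qq by simp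
      then have 1: "y q \<otimes> inv (y q') \<in> tail_subgroup (Suc q)" using LC_subset_tail[of q "Suc j"] qN by auto
      have 2: "y q' \<in> tail_subgroup (Suc q)" unfolding tail_subgroup_def
        by (intro generate.incl CollectI exI[of _ q']) (use qq qN in auto)
      have "(y q \<otimes> inv (y q')) \<otimes> y q' \<in> tail_subgroup (Suc q)" by (rule subgroup.m_closed[OF tail_subgroup 1 2])
      then have "y q [^] (1::nat) \<in> tail_subgroup (Suc q)" using qN by (simp add: m_assoc)
      from rel_ord_le(1)[OF this] show False using qN by simp
    qed
  qed auto
  have lower: "\<exists>B. int_independent Q B \<and> card B = card I"
  proof (intro exI[of _ "(\<lambda>q. \<pi> (y q)) ` I"] conjI)
    show "card ((\<lambda>q. \<pi> (y q)) ` I) = card I" by (rule card_image[OF inj])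
    show "int_independent Q ((\<lambda>q. \<pi> (y q)) ` I)"
      unfolding int_independent_def
    proof (intro conjI allI impI)
      fix m :: "_ \<Rightarrow> int"
      assume "finprod Q (\<lambda>b. b [^]\<^bsub>Q\<^esub> m b) ((\<lambda>q. \<pi> (y q)) ` I) = \<one>\<^bsub>Q\<^esub>"
      then have "finprod Q (\<lambda>q. \<pi> (y q) [^]\<^bsub>Q\<^esub> m (\<pi> (y q))) I = \<one>\<^bsub>Q\<^esub>"
        by (subst (asm) Q.finprod_reindex[OF _ inj]) (use yQ in auto)
      from indep[OF this] show "\<forall>b\<in>(\<lambda>q. \<pi> (y q)) ` I. m b = 0" by auto
    qed (use finI yQ in auto)
  qed
  have upper: "card B \<le> card I" if B: "int_independent Q B" for B
  proof -
    have finB: "finite B" and BQ: "B \<subseteq> carrier Q" using B unfolding int_independent_def by auto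
    have indB: "\<forall>m :: _ \<Rightarrow> int. finprod Q (\<lambda>b. b [^]\<^bsub>Q\<^esub> m b) B = \<one>\<^bsub>Q\<^esub> \<longrightarrow> (\<forall>b\<in>B. m b = 0)"
      using B unfolding int_independent_def by (elim conjE)
    have reps: "\<exists>K\<ge>0. \<forall>r\<ge>1. \<forall>m. (\<forall>b\<in>B'. of_int \<bar>m b\<bar> \<le> r ^ j) \<longrightarrow>
        (\<exists>x\<in>LC j. word_le 0 r K x \<and> \<pi> x = finprod Q (\<lambda>b. b [^]\<^bsub>Q\<^esub> (m b :: int)) B')" if "B' \<subseteq> B" for B'
      using finite_subset[OF that finB] that
    proof (induction B' rule: finite_induct)
      case empty
      then show ?case using one_LC p1 by (intro exI[of _ 0]) (auto intro!: bexI[of _ \<one>] word_le.one)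
    next
      case (insert b B')
      have B'B: "B' \<subseteq> B" using insert.prems by auto
      from insert.IH[OF B'B] obtain K where K: "K \<ge> 0" "\<forall>r\<ge>1. \<forall>m. (\<forall>b\<in>B'. of_int \<bar>m b\<bar> \<le> r ^ j) \<longrightarrow>
        (\<exists>x\<in>LC j. word_le 0 r K x \<and> \<pi> x = finprod Q (\<lambda>b. b [^]\<^bsub>Q\<^esub> (m b :: int)) B')"
        by (elim exE conjE) (rule that)
      have bQ: "b \<in> carrier Q" "B' \<subseteq> carrier Q" using insert.prems BQ by auto
      obtain g where g: "g \<in> LC j" "\<pi> g = b" using surj[OF bQ(1)] by blast
      have "g \<in> generate G {y q | q. 0 \<le> q \<and> q < N \<and> j \<le> w q}" using g LC_letters[OF j] by simp
      from word_le_generate[OF this] obtain C where C: "C \<ge> 0" "\<And>r. r \<ge> 1 \<Longrightarrow> word_le 0 r (C / r ^ j) g" by blast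
      have "\<exists>x\<in>LC j. word_le 0 r (C + K) x \<and> \<pi> x = finprod Q (\<lambda>b. b [^]\<^bsub>Q\<^esub> m b) (insert b B')"
        if r: "r \<ge> 1" and m: "\<forall>b\<in>insert b B'. of_int \<bar>m b\<bar> \<le> r ^ j" for r and m :: "_ \<Rightarrow> int"
      proof -
        obtain x where x: "x \<in> LC j" "word_le 0 r K x" "\<pi> x = finprod Q (\<lambda>b. b [^]\<^bsub>Q\<^esub> m b) B'"
          using K(2)[THEN spec, THEN mp, OF r, THEN spec, THEN mp, of m] m by auto
        have "word_le 0 r (of_int \<bar>m b\<bar> * (C / r ^ j)) (g [^] m b)" using C(2)[OF r] r by (intro word_le_int_pow) auto
        then have "word_le 0 r C (g [^] m b)"
        proof (rule word_le_mono)
          have "of_int \<bar>m b\<bar> * C \<le> r ^ j * C" using m C(1) by (intro mult_right_mono) auto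
          then show "of_int \<bar>m b\<bar> * (C / r ^ j) \<le> C" using r by (simp add: divide_le_eq mult.commute)
        qed
        then have "word_le 0 r (C + K) (g [^] m b \<otimes> x)" using x r by (intro word_le_mult) auto
        moreover have gp: "g [^] m b \<in> LC j" using subgroup_int_pow_closed[OF LC_subgroup g(1)] .
        moreover have "\<pi> (g [^] m b \<otimes> x) = finprod Q (\<lambda>b. b [^]\<^bsub>Q\<^esub> m b) (insert b B')"
          using pm[OF gp x(1)] pp[OF g(1)] g(2) x(3) insert.hyps bQ by (subst Q.finprod_insert) auto
        ultimately show ?thesis using LC_mult x(1) by blast
      qed
      moreover have "C + K \<ge> 0" using C K by simp
      ultimately show ?case by (intro exI[of _ "C + K"] conjI allI impI)
    qed
    from reps[OF subset_refl] obtain K0 where K0: "K0 \<ge> 0" "\<forall>r\<ge>1. \<forall>m. (\<forall>b\<in>B. of_int \<bar>m b\<bar> \<le> r ^ j) \<longrightarrow>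
        (\<exists>x\<in>LC j. word_le 0 r K0 x \<and> \<pi> x = finprod Q (\<lambda>b. b [^]\<^bsub>Q\<^esub> (m b :: int)) B)"
      by (elim exE conjE) (rule that)
    define K where "K = K0 + 1"
    obtain C where C: "C \<ge> 1"
      "\<And>r x. r \<ge> 1 \<Longrightarrow> word_le 0 r 1 x \<Longrightarrow> \<exists>m. x = nfprod 0 m \<and> nf_within (C * r) m"
      using normal_form_within by blast
    define U where "U = {q. q < N \<and> w q = j}"
    have U: "finite U" "U \<subseteq> {..<N}" unfolding U_def by auto
    obtain M where M: "M \<ge> 1" "\<And>r. r \<ge> 1 \<Longrightarrow> real (card (exp_box r U)) \<le> M * r ^ (\<Sum>q | q \<in> U \<and> rel_ord q = 0. w q)"
      using card_exp_box[OF U(1)] by blast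
    have "(\<Sum>q | q \<in> U \<and> rel_ord q = 0. w q) = (\<Sum>q\<in>I. j)"
      by (rule sum.cong) (auto simp: U_def I_def)
    then have sumU: "(\<Sum>q | q \<in> U \<and> rel_ord q = 0. w q) = card I * j" by simp
    have KC: "C * K \<ge> 1" using mult_mono[of 1 C 1 K] C(1) K0(1) unfolding K_def by simp
    define \<Psi> where "\<Psi> = (\<lambda>m. \<pi> (nfprod 0 (\<lambda>q. if q \<in> U then m q else 0)))"
    have key: "(real n) ^ (j * card B) \<le> M * (C * K * real n) ^ (card I * j)" if n: "n \<ge> 1" for n :: nat
    proof -
      define F where "F = (\<lambda>m. finprod Q (\<lambda>b. b [^]\<^bsub>Q\<^esub> (m b :: int)) B)"
      define P where "P = (\<Pi>\<^sub>E b\<in>B. {0..int (n ^ j)})"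
      have injF: "inj_on F P"
      proof (rule inj_onI)
        fix m m' assume m: "m \<in> P" "m' \<in> P" and e: "F m = F m'"
        have Fc: "F m \<in> carrier Q" for m unfolding F_def using BQ by (auto intro!: Q.finprod_closed)
        have "finprod Q (\<lambda>b. b [^]\<^bsub>Q\<^esub> m b) B = finprod Q (\<lambda>b. b [^]\<^bsub>Q\<^esub> (m b - m' b) \<otimes>\<^bsub>Q\<^esub> b [^]\<^bsub>Q\<^esub> m' b) B"
          by (rule Q.finprod_cong') (use BQ in \<open>auto simp: Q.int_pow_mult[symmetric] simp del: Q.int_pow_diff\<close>)
        also have "\<dots> = finprod Q (\<lambda>b. b [^]\<^bsub>Q\<^esub> (m b - m' b)) B \<otimes>\<^bsub>Q\<^esub> finprod Q (\<lambda>b. b [^]\<^bsub>Q\<^esub> m' b) B"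
          by (rule Q.finprod_multf) (use BQ in auto)
        finally have "F m = F (\<lambda>b. m b - m' b) \<otimes>\<^bsub>Q\<^esub> F m'" unfolding F_def .
        then have "F (\<lambda>b. m b - m' b) \<otimes>\<^bsub>Q\<^esub> F m' = \<one>\<^bsub>Q\<^esub> \<otimes>\<^bsub>Q\<^esub> F m'"
          unfolding e using Fc(1) by (simp only: Q.l_one)
        then have "F (\<lambda>b. m b - m' b) = \<one>\<^bsub>Q\<^esub>"
          using Q.right_cancel[OF Fc(1) Fc(1) Q.one_closed] by blast
        then have "\<forall>b\<in>B. m b - m' b = 0"
          unfolding F_def by (rule indB[THEN spec, THEN mp])
        then show "m = m'" using m unfolding P_def by (intro PiE_ext[of m B _ m']) auto
      qed
      have sub: "F ` P \<subseteq> \<Psi> ` exp_box (C * K * real n) U"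
      proof
        fix a assume "a \<in> F ` P"
        then obtain m where m: "m \<in> P" "a = F m" by blast
        have "\<forall>b\<in>B. of_int \<bar>m b\<bar> \<le> real n ^ j"
        proof
          fix b assume "b \<in> B"
          then have "0 \<le> m b" "m b \<le> int (n ^ j)" using m(1) unfolding P_def by auto
          then have "of_int \<bar>m b\<bar> \<le> real_of_int (int (n ^ j))" by (simp only: of_int_le_iff abs_of_nonneg)
          then show "of_int \<bar>m b\<bar> \<le> real n ^ j" by simp
        qed
        then obtain x where x: "x \<in> LC j" "word_le 0 (real n) K0 x" "\<pi> x = a"
          using K0(2)[THEN spec, THEN mp, of "real n", THEN spec, THEN mp, of m] n m(2) unfolding F_def by auto
        have wx: "word_le 0 (K * real n) 1 x" by (rule word_le_unit[OF x(2)]) (use n K0 in \<open>auto simp: K_def\<close>)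
        have Kn: "K * real n \<ge> 1" using mult_mono[of 1 K 1 "real n"] n K0 unfolding K_def by simp
        obtain l where l: "x = nfprod 0 l" "nf_within (C * (K * real n)) l"
          using C(2)[OF Kn wx] by blast
        then have l0: "nf_exps 0 l" unfolding nf_within_def by blast
        obtain h where h: "h \<in> LC (Suc j)" "nfprod 0 l = nfprod 0 (\<lambda>q. if w q \<le> j then l q else 0) \<otimes> h"
          using nfprod_truncate[of 0 j l] by auto
        have "l q = 0" if "q < N" "w q < j" for q using nfprod_LC[of 0 l j q] l(1) l0 x that by simp
        then have e: "nfprod 0 (\<lambda>q. if w q \<le> j then l q else 0) = nfprod 0 (\<lambda>q. if q \<in> U then restrict l U q else 0)"
          by (intro nfprod_cong) (auto simp: U_def)
        define z where "z = nfprod 0 (\<lambda>q. if q \<in> U then restrict l U q else 0)"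
        have xz: "x = z \<otimes> h" using h(2) l(1) unfolding z_def e by simp
        have hj: "h \<in> LC j" "h \<in> carrier G" using h(1) LC_antimono[of j "Suc j"] LC_carrier by auto
        have zc: "z \<in> carrier G" unfolding z_def by simp
        have "z = x \<otimes> inv h" unfolding xz using zc hj by (simp add: m_assoc)
        then have zL: "z \<in> LC j" using LC_mult[OF x(1) LC_inv[OF hj(1)]] by simp
        have "\<pi> x = \<pi> z" unfolding xz using pm[OF zL hj(1)] ker[OF hj(1)] h(1) pc[OF zL] by simp
        then have "a = \<Psi> (restrict l U)" unfolding \<Psi>_def z_def[symmetric] using x(3) by simp
        moreover have "restrict l U \<in> exp_box (C * K * real n) U"
          using restrict_exp_box[OF l(2) U(2)] by (simp add: mult.assoc)
        ultimately show "a \<in> \<Psi> ` exp_box (C * K * real n) U" by blast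
      qed
      have "card P = (n ^ j + 1) ^ card B"
        unfolding P_def using finB by (simp add: card_PiE card_int_box del: of_nat_power card_atLeastAtMost_int)
      have "n ^ (j * card B) = (n ^ j) ^ card B" by (simp add: power_mult)
      also have "\<dots> \<le> (n ^ j + 1) ^ card B" by (rule power_mono) auto
      also have "\<dots> = card (F ` P)" using card_image[OF injF] \<open>card P = _\<close> by simp
      also have "\<dots> \<le> card (\<Psi> ` exp_box (C * K * real n) U)"
        by (rule card_mono[OF _ sub]) (use finite_exp_box U in auto)
      also have "\<dots> \<le> card (exp_box (C * K * real n) U)" by (rule card_image_le) (use finite_exp_box U in auto)
      finally have "real (n ^ (j * card B)) \<le> real (card (exp_box (C * K * real n) U))" by (simp only: of_nat_le_iff)
      also have "\<dots> \<le> M * (C * K * real n) ^ (card I * j)"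
      proof -
        have "1 \<le> C * K * real n" using mult_mono[of 1 "C * K" 1 "real n"] KC n by simp
        from M(2)[OF this] show ?thesis unfolding sumU .
      qed
      finally show ?thesis by simp
    qed
    show ?thesis
    proof (rule ccontr)
      assume "\<not> card B \<le> card I"
      then have lt: "card I * j + 1 \<le> j * card B"
        using j by (metis Suc_eq_plus1 Suc_leI mult.commute mult_less_mono2 not_le order_less_le_trans zero_less_one)
      define T where "T = M * (C * K) ^ (card I * j)"
      obtain n :: nat where n: "T < real n" using reals_Archimedean2 by blast
      have "T \<ge> 1" unfolding T_def using M(1) KC mult_mono[of 1 M 1 "(C * K) ^ (card I * j)"] by simp
      then have n1: "n \<ge> 1" using n by auto
      have "real n ^ (card I * j + 1) \<le> real n ^ (j * card B)" using lt n1 by (intro power_increasing) auto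
      also have "\<dots> \<le> T * real n ^ (card I * j)" using key[OF n1] unfolding T_def by (simp add: power_mult_distrib mult.assoc)
      finally have "real n \<le> T" using n1 by (simp add: mult.commute)
      then show False using n by simp
    qed
  qed
  have "torsion_free_rank Q = card I"
    unfolding torsion_free_rank_def
  proof (rule cSup_eq_maximum)
    show "card I \<in> {card B | B. int_independent Q B}"
      using lower by (metis (mono_tags, lifting) mem_Collect_eq)
    show "x \<le> card I" if "x \<in> {card B | B. int_independent Q B}" for x
      using that upper by (elim CollectE exE conjE) simp
  qed
  then show ?thesis unfolding Q_def I_def .
qed

lemma hom_dim_eq: "hom_dim G = real growth_exp"
proof -
  define I where "I = {q. q < N \<and> rel_ord q = 0}"
  have finI: "finite I" unfolding I_def by simp
  have "hom_dim G = (\<Sum>\<^sub>\<infinity>j\<in>{1..}. real j * real (card {q\<in>I. w q = j}))"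
    unfolding hom_dim_def
  proof (rule infsum_cong)
    fix j :: nat assume "j \<in> {1..}"
    moreover have "{q. q < N \<and> rel_ord q = 0 \<and> w q = j} = {q\<in>I. w q = j}" unfolding I_def by auto
    ultimately show "real j * real (torsion_free_rank (G\<lparr>carrier := LC j\<rparr> Mod LC (Suc j))) = real j * real (card {q\<in>I. w q = j})"
      using torsion_free_rank_section[of j] by simp
  qed
  also have "\<dots> = (\<Sum>\<^sub>\<infinity>j\<in>w ` I. real j * real (card {q\<in>I. w q = j}))"
  proof (rule infsum_cong_neutral)
    fix j assume "j \<in> {1..} - w ` I"
    then have e: "{q\<in>I. w q = j} = {}" by auto
    show "real j * real (card {q\<in>I. w q = j}) = 0" unfolding e by simp
  next
    fix j assume "j \<in> w ` I - {1..}"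
    then show "real j * real (card {q\<in>I. w q = j}) = 0" using w_pos unfolding I_def by fastforce
  qed simp
  also have "\<dots> = (\<Sum>j\<in>w ` I. real j * real (card {q\<in>I. w q = j}))" using finI by simp
  also have "\<dots> = (\<Sum>j\<in>w ` I. \<Sum>q\<in>{q\<in>I. w q = j}. real (w q))"
    by (rule sum.cong) (auto simp: mult.commute)
  also have "\<dots> = (\<Sum>q\<in>I. real (w q))" using finI by (intro sum.group) auto
  finally show ?thesis unfolding growth_exp_def I_def by simp
qed

end

context word_letters begin

lemma volume_upper: "\<exists>C. \<forall>n\<ge>1. real (card (wball G A n)) \<le> C * real n ^ growth_exp"
proof -
  obtain C where C: "C \<ge> 1"
    "\<And>r x. r \<ge> 1 \<Longrightarrow> word_le 0 r 1 x \<Longrightarrow> \<exists>m. x = nfprod 0 m \<and> nf_within (C * r) m"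
    using normal_form_within by blast
  define U where "U = {..<N}"
  obtain M where M: "M \<ge> 1" "\<And>r. r \<ge> 1 \<Longrightarrow> real (card (exp_box r U)) \<le> M * r ^ (\<Sum>q | q \<in> U \<and> rel_ord q = 0. w q)"
    using card_exp_box[of U] unfolding U_def by blast
  have gx: "(\<Sum>q | q \<in> U \<and> rel_ord q = 0. w q) = growth_exp" unfolding growth_exp_def U_def by simp
  have "real (card (wball G A n)) \<le> (M * C ^ growth_exp) * real n ^ growth_exp" if n: "n \<ge> 1" for n
  proof -
    have Cn: "C * real n \<ge> 1" using mult_mono[of 1 C 1 "real n"] C(1) n by simp
    have "wball G A n \<subseteq> nfprod 0 ` exp_box (C * real n) U"
    proof
      fix x assume x: "x \<in> wball G A n"
      have wx: "word_le 0 (real n) 1 x" using word_le_wball[of "real n" x n] x n by simp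
      then obtain m where m: "x = nfprod 0 m" "nf_within (C * real n) m"
        using C(2)[OF _ wx] n by auto
      have "x = nfprod 0 (restrict m U)" unfolding m(1) by (rule nfprod_cong) (auto simp: U_def)
      moreover have "restrict m U \<in> exp_box (C * real n) U"
        by (rule restrict_exp_box[OF m(2)]) (simp add: U_def)
      ultimately show "x \<in> nfprod 0 ` exp_box (C * real n) U" by blast
    qed
    then have "card (wball G A n) \<le> card (exp_box (C * real n) U)"
      by (rule surj_card_le[rotated]) (auto simp: U_def intro: finite_exp_box)
    then have "real (card (wball G A n)) \<le> real (card (exp_box (C * real n) U))" by simp
    also have "\<dots> \<le> M * (C * real n) ^ growth_exp" using M(2)[OF Cn] unfolding gx .
    finally show ?thesis by (simp add: power_mult_distrib mult.assoc)
  qed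
  then show ?thesis by blast
qed

text \<open>The normal forms with exponents up to \<open>n ^ w q\<close> at the letters of infinite relative
  order are distinct and have length \<open>O(n)\<close>.\<close>

lemma volume_lower: "\<exists>c>0. \<forall>n\<ge>1. c * real n ^ growth_exp \<le> real (card (wball G A n))"
proof -
  obtain B where B: "B \<ge> 1" "\<And>r x. r \<ge> 1 \<Longrightarrow> word_le 0 r 1 x \<Longrightarrow> real (wlen G A x) \<le> B * r"
    using wlen_word_le by blast
  define K where "K = nat \<lceil>B * (real N + 1)\<rceil>"
  have KB: "B * (real N + 1) \<le> real K" unfolding K_def by linarith
  have "1 * 1 \<le> B * (real N + 1)" using B(1) by (intro mult_mono) auto
  then have K1: "K \<ge> 1" using KB by linarith
  have big: "real n ^ growth_exp \<le> real (card (wball G A (K * n)))" if n: "n \<ge> 1" for n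
  proof -
    define P where "P = (\<Pi>\<^sub>E q\<in>{..<N}. if rel_ord q = 0 then {0..int (n ^ w q)} else {0})"
    have Pm: "nf_exps 0 m" "\<forall>q<N. of_int \<bar>m q\<bar> \<le> real n ^ w q" if "m \<in> P" for m
    proof -
      have mq: "m q \<in> (if rel_ord q = 0 then {0..int (n ^ w q)} else {0})" if "q < N" for q
        using PiE_mem[OF \<open>m \<in> P\<close>[unfolded P_def], of q] that by simp
      show "nf_exps 0 m" unfolding nf_exps_def
      proof (intro allI impI)
        fix q assume "q < N" "0 < rel_ord q"
        then show "0 \<le> m q \<and> m q < int (rel_ord q)" using mq[of q] by simp
      qed
      show "\<forall>q<N. of_int \<bar>m q\<bar> \<le> real n ^ w q"
      proof (intro allI impI)
        fix q assume "q < N"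
        then have "\<bar>m q\<bar> \<le> int (n ^ w q)" using mq[of q] by (auto split: if_splits)
        then have "of_int \<bar>m q\<bar> \<le> real_of_int (int (n ^ w q))" by (simp only: of_int_le_iff)
        then show "of_int \<bar>m q\<bar> \<le> real n ^ w q" by simp
      qed
    qed
    have inj: "inj_on (nfprod 0) P"
    proof (rule inj_onI)
      fix m m' assume m: "m \<in> P" "m' \<in> P" "nfprod 0 m = nfprod 0 m'"
      have "m q = m' q" if "q < N" for q using nfprod_inj[of 0 m m' q] Pm m that by simp
      then show "m = m'" using m unfolding P_def by (intro PiE_ext[of m "{..<N}" _ m']) auto
    qed
    have sub: "nfprod 0 ` P \<subseteq> wball G A (K * n)"
    proof
      fix x assume "x \<in> nfprod 0 ` P"
      then obtain m where m: "m \<in> P" "x = nfprod 0 m" by blast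
      have n0: "real n > 0" using n by simp
      have "word_le 0 (real n) (real (N - 0)) x" unfolding m(2) by (rule word_le_nfprod[OF n0]) (use Pm[OF m(1)] in auto)
      then have "word_le 0 ((real N + 1) * real n) 1 x" by (rule word_le_unit) (use n0 in auto)
      then have "real (wlen G A x) \<le> B * ((real N + 1) * real n)"
      proof (rule B(2)[rotated])
        have "1 * 1 \<le> (real N + 1) * real n" using n by (intro mult_mono) auto
        then show "1 \<le> (real N + 1) * real n" by simp
      qed
      also have "\<dots> \<le> real K * real n" using mult_right_mono[OF KB, of "real n"] by (simp add: mult.assoc)
      finally have "wlen G A x \<le> K * n" by (simp flip: of_nat_mult)
      then show "x \<in> wball G A (K * n)" using wlen_le_iff[of x "K * n"] m(2) by simp
    qed
    have "real n ^ growth_exp = (\<Prod>q\<in>{..<N}. real n ^ (if rel_ord q = 0 then w q else 0))"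
      unfolding growth_exp_def power_sum[symmetric] by (simp add: sum.inter_filter[symmetric] lessThan_def Collect_conj_eq[symmetric])
    also have "\<dots> \<le> (\<Prod>q\<in>{..<N}. real (card (if rel_ord q = 0 then {0..int (n ^ w q)} else {0})))"
      by (rule prod_mono) (auto simp: card_int_box simp del: of_nat_power card_atLeastAtMost_int)
    also have "\<dots> = real (card P)" unfolding P_def by (simp add: card_PiE)
    also have "card P = card (nfprod 0 ` P)" using card_image[OF inj] by simp
    also have "real (card (nfprod 0 ` P)) \<le> real (card (wball G A (K * n)))"
      using card_mono[OF finite_wball[OF finite_gen] sub] by simp
    finally show ?thesis .
  qed
  have "(1 / (2 * real K)) ^ growth_exp * real n ^ growth_exp \<le> real (card (wball G A n))" if n: "n \<ge> 1" for n
  proof (cases "K \<le> n")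
    case True
    define l where "l = n div K"
    have l1: "l \<ge> 1" unfolding l_def using True K1 by (simp add: div_greater_zero_iff Suc_le_eq)
    have "n < (l + 1) * K" unfolding l_def using dividend_less_times_div[of K n] K1 by (simp add: algebra_simps)
    also have "\<dots> \<le> 2 * l * K" using l1 by simp
    finally have "real n \<le> real (2 * l * K)" by (simp only: of_nat_le_iff)
    then have "real n / (2 * real K) \<le> real l" using K1 by (simp add: divide_le_eq mult_ac)
    then have "(real n / (2 * real K)) ^ growth_exp \<le> real l ^ growth_exp" by (intro power_mono) auto
    also have "\<dots> \<le> real (card (wball G A (K * l)))" by (rule big[OF l1])
    also have "\<dots> \<le> real (card (wball G A n))"
      using card_mono[OF finite_wball[OF finite_gen] wball_mono[of "K * l" n]] unfolding l_def by simp
    finally show ?thesis by (simp add: power_divide)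
  next
    case False
    have "real n / (2 * real K) \<le> 1" using False K1 by (simp add: divide_le_eq)
    then have "(real n / (2 * real K)) ^ growth_exp \<le> 1" by (intro power_le_one) auto
    moreover have "\<one> \<in> wball G A n" using wball_mono[of 0 n] by auto
    then have "1 \<le> card (wball G A n)" using finite_wball[OF finite_gen, of G n] by (simp add: Suc_le_eq card_gt_0_iff) blast
    ultimately show ?thesis by (simp add: power_divide)
  qed
  moreover have "(1 / (2 * real K)) ^ growth_exp > 0" using K1 by simp
  ultimately show ?thesis by blast
qed

end

text \<open>The theorem of Bass and Guivarc'h on the growth of balls, and the distortion of
  elements that have a power deep in the lower central series.\<close>

theorem (in sym_gen) volume_and_distortion:
  assumes "nilpotent_group G"
  shows "\<exists>c>0. \<forall>n\<ge>1. c * real n powr hom_dim G \<le> real (card (wball G A n))"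
    and "\<exists>C. \<forall>n\<ge>1. real (card (wball G A n)) \<le> C * real n powr hom_dim G"
    and "\<And>g p L. g \<in> carrier G \<Longrightarrow> g [^] (p::nat) \<in> LC L \<Longrightarrow> 1 \<le> L \<Longrightarrow> 1 \<le> p \<Longrightarrow>
      \<exists>C\<ge>0. \<forall>m::int. real (wlen G A (g [^] m)) \<le> C * (1 + of_int \<bar>m\<bar>) powr (1 / real L)"
proof -
  obtain N y w where gl: "graded_letters G N y w" "\<forall>x\<in>A. \<exists>q<N. y q = x \<and> w q = 1"
    "\<forall>q<N. y q \<in> simple_comms G A (w q - 1)"
    using graded_letters_exist[OF finite_gen gen_closed generates] assms unfolding nilpotent_group_def by blast
  interpret word_letters G A N y w
    by (intro word_letters.intro word_letters_axioms.intro sym_gen_axioms) (use gl in auto)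
  have hp: "real n powr hom_dim G = real n ^ growth_exp" if "n \<ge> 1" for n :: nat
    unfolding hom_dim_eq using that by (simp add: powr_realpow)
  show "\<exists>c>0. \<forall>n\<ge>1. c * real n powr hom_dim G \<le> real (card (wball G A n))"
    using volume_lower hp by auto
  show "\<exists>C. \<forall>n\<ge>1. real (card (wball G A n)) \<le> C * real n powr hom_dim G"
    using volume_upper hp by auto
  show "\<exists>C\<ge>0. \<forall>m::int. real (wlen G A (g [^] m)) \<le> C * (1 + of_int \<bar>m\<bar>) powr (1 / real L)"
    if "g \<in> carrier G" "g [^] (p::nat) \<in> LC L" "1 \<le> L" "1 \<le> p" for g p L
    using distortion[OF that] .
qed

section \<open>Non-negative summable functions and symmetric walks\<close>

lemma tonelli_nonneg:
  fixes f :: "'i \<Rightarrow> 'j \<Rightarrow> real"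
  assumes nn: "\<And>x y. x \<in> A \<Longrightarrow> y \<in> B \<Longrightarrow> 0 \<le> f x y"
    and inner: "\<And>y. y \<in> B \<Longrightarrow> (\<lambda>x. f x y) summable_on A"
    and outer: "(\<lambda>y. \<Sum>\<^sub>\<infinity>x\<in>A. f x y) summable_on B"
  shows "\<And>x. x \<in> A \<Longrightarrow> f x summable_on B"
    and "(\<lambda>x. \<Sum>\<^sub>\<infinity>y\<in>B. f x y) summable_on A"
    and "(\<Sum>\<^sub>\<infinity>x\<in>A. \<Sum>\<^sub>\<infinity>y\<in>B. f x y) = (\<Sum>\<^sub>\<infinity>y\<in>B. \<Sum>\<^sub>\<infinity>x\<in>A. f x y)"
proof -
  have "(\<lambda>(y, x). f x y) summable_on B \<times> A"
    by (rule summable_on_SigmaI[where g = "\<lambda>y. \<Sum>\<^sub>\<infinity>x\<in>A. f x y"])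
       (use assms in \<open>auto intro: has_sum_infsum\<close>)
  then have s: "(\<lambda>(x, y). f x y) summable_on A \<times> B"
    using summable_on_swap[of "\<lambda>(y, x). f x y" B A] by simp
  show "f x summable_on B" if "x \<in> A" for x
  proof -
    have "(\<lambda>(x, y). f x y) summable_on Pair x ` B"
      by (rule summable_on_subset_banach[OF s]) (use that in auto)
    then have "((\<lambda>(x, y). f x y) \<circ> Pair x) summable_on B"
      by (subst (asm) summable_on_reindex) (auto simp: inj_on_def)
    then show ?thesis by (simp add: o_def)
  qed
  show "(\<lambda>x. \<Sum>\<^sub>\<infinity>y\<in>B. f x y) summable_on A" by (rule summable_on_Sigma_banach[OF s])
  show "(\<Sum>\<^sub>\<infinity>x\<in>A. \<Sum>\<^sub>\<infinity>y\<in>B. f x y) = (\<Sum>\<^sub>\<infinity>y\<in>B. \<Sum>\<^sub>\<infinity>x\<in>A. f x y)" by (rule infsum_swap_banach[OF s])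
qed

lemma le_infsum_member:
  fixes f :: "'i \<Rightarrow> real"
  assumes "f summable_on A" "\<And>x. x \<in> A \<Longrightarrow> 0 \<le> f x" "x \<in> A"
  shows "f x \<le> infsum f A"
  using finite_sum_le_infsum[of f A "{x}"] assms by auto

lemma has_sum_finite_sum:
  fixes f :: "'i \<Rightarrow> 'j \<Rightarrow> real"
  assumes "finite F" "\<And>i. i \<in> F \<Longrightarrow> (f i has_sum s i) A"
  shows "((\<lambda>x. \<Sum>i\<in>F. f i x) has_sum (\<Sum>i\<in>F. s i)) A"
  using assms by (induction F rule: finite_induct) (auto intro: has_sum_add)

text \<open>The two values at \<open>a\<close> and \<open>b\<close> cannot both be close to the mean, and their
  contributions bound the variance from below.\<close>

lemma variance_ge_pair:
  fixes p F :: "'i \<Rightarrow> real"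
  assumes p: "(p has_sum 1) A" "\<And>y. y \<in> A \<Longrightarrow> 0 \<le> p y"
    and F: "\<And>y. y \<in> A \<Longrightarrow> 0 \<le> F y" "\<And>y. y \<in> A \<Longrightarrow> F y \<le> M"
    and ab: "a \<in> A" "b \<in> A"
  shows "min (p a) (p b) / 2 * (F a - F b)\<^sup>2 \<le> (\<Sum>\<^sub>\<infinity>y\<in>A. p y * (F y)\<^sup>2) - (\<Sum>\<^sub>\<infinity>y\<in>A. p y * F y)\<^sup>2"
proof -
  have ps: "p summable_on A" using p(1) summable_on_def by blast
  have s1: "(\<lambda>y. p y * F y) summable_on A"
    by (rule summable_on_comparison_test[OF summable_on_cmult_left[OF ps, of M]])
       (use p F in \<open>auto intro!: mult_left_mono\<close>)
  have s2: "(\<lambda>y. p y * (F y)\<^sup>2) summable_on A"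
    by (rule summable_on_comparison_test[OF summable_on_cmult_left[OF ps, of "M\<^sup>2"]])
       (use p F in \<open>auto intro!: mult_left_mono power_mono\<close>)
  define m where "m = (\<Sum>\<^sub>\<infinity>y\<in>A. p y * F y)"
  have h1: "((\<lambda>y. p y * F y) has_sum m) A" unfolding m_def by (rule has_sum_infsum[OF s1])
  have h2: "((\<lambda>y. p y * (F y)\<^sup>2) has_sum (\<Sum>\<^sub>\<infinity>y\<in>A. p y * (F y)\<^sup>2)) A" by (rule has_sum_infsum[OF s2])
  have "((\<lambda>y. p y * (F y)\<^sup>2 + ((- 2 * m) * (p y * F y) + m\<^sup>2 * p y)) has_sum
     ((\<Sum>\<^sub>\<infinity>y\<in>A. p y * (F y)\<^sup>2) + ((- 2 * m) * m + m\<^sup>2 * 1))) A"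
    by (intro has_sum_add has_sum_cmult_right h1 h2 p(1))
  then have v: "((\<lambda>y. p y * (F y - m)\<^sup>2) has_sum ((\<Sum>\<^sub>\<infinity>y\<in>A. p y * (F y)\<^sup>2) - m\<^sup>2)) A"
    by (simp add: power2_eq_square algebra_simps)
  have nn: "0 \<le> p y * (F y - m)\<^sup>2" if "y \<in> A" for y using p(2)[OF that] by simp
  show ?thesis
  proof (cases "a = b")
    case True
    then show ?thesis using has_sum_nonneg[OF v nn] unfolding m_def by simp
  next
    case False
    have "(\<Sum>y\<in>{a, b}. p y * (F y - m)\<^sup>2) \<le> (\<Sum>\<^sub>\<infinity>y\<in>A. p y * (F y)\<^sup>2) - m\<^sup>2"
      by (rule finite_sum_le_has_sum[OF v]) (use ab nn in auto)
    then have le: "p a * (F a - m)\<^sup>2 + p b * (F b - m)\<^sup>2 \<le> (\<Sum>\<^sub>\<infinity>y\<in>A. p y * (F y)\<^sup>2) - m\<^sup>2"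
      using False by simp
    define q where "q = min (p a) (p b)"
    have q: "0 \<le> q" "q \<le> p a" "q \<le> p b" unfolding q_def using p ab by auto
    have "(F a - F b)\<^sup>2 \<le> 2 * (F a - m)\<^sup>2 + 2 * (F b - m)\<^sup>2"
      using sum_squares_bound[of "F a - m" "- (F b - m)"] by (simp add: power2_eq_square algebra_simps)
    then have "q / 2 * (F a - F b)\<^sup>2 \<le> q / 2 * (2 * (F a - m)\<^sup>2 + 2 * (F b - m)\<^sup>2)"
      using q(1) by (intro mult_left_mono) auto
    also have "\<dots> = q * (F a - m)\<^sup>2 + q * (F b - m)\<^sup>2" by (simp add: algebra_simps)
    also have "\<dots> \<le> p a * (F a - m)\<^sup>2 + p b * (F b - m)\<^sup>2"
      using q by (intro add_mono mult_right_mono) auto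
    finally show ?thesis using le unfolding q_def m_def by linarith
  qed
qed

context group begin

text \<open>The non-negative summable functions on \<open>G\<close> are closed under translations, products and
  convolution with a probability, and all double sums over them may be interchanged.\<close>

definition nn_sum :: "('a \<Rightarrow> real) \<Rightarrow> bool" where
  "nn_sum f \<longleftrightarrow> (\<forall>x\<in>carrier G. 0 \<le> f x) \<and> f summable_on carrier G"

definition total :: "('a \<Rightarrow> real) \<Rightarrow> real" where "total f = infsum f (carrier G)"

definition ip :: "('a \<Rightarrow> real) \<Rightarrow> ('a \<Rightarrow> real) \<Rightarrow> real" where "ip f g = total (\<lambda>x. f x * g x)"

definition shift :: "'a \<Rightarrow> ('a \<Rightarrow> real) \<Rightarrow> 'a \<Rightarrow> real" where "shift y f x = f (inv y \<otimes> x)"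

text \<open>The squared distance in \<open>\<ell>\<^sup>2\<close> between \<open>f\<close> and its translate by \<open>y\<close>.\<close>

definition disp :: "'a \<Rightarrow> ('a \<Rightarrow> real) \<Rightarrow> real" where
  "disp y f = total (\<lambda>x. (shift y f x - f x)\<^sup>2)"

lemma bij_left: "y \<in> carrier G \<Longrightarrow> bij_betw (\<lambda>x. y \<otimes> x) (carrier G) (carrier G)"
  by (rule bij_betwI[of _ _ _ "\<lambda>x. inv y \<otimes> x"]) auto

lemma bij_right: "y \<in> carrier G \<Longrightarrow> bij_betw (\<lambda>x. x \<otimes> y) (carrier G) (carrier G)"
  by (rule bij_betwI[of _ _ _ "\<lambda>x. x \<otimes> inv y"]) (auto simp: m_assoc)

lemma bij_inv: "bij_betw (\<lambda>x. inv x) (carrier G) (carrier G)"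
  by (rule bij_betwI[of _ _ _ "\<lambda>x. inv x"]) auto

lemma total_left: "y \<in> carrier G \<Longrightarrow> total (\<lambda>x. f (y \<otimes> x)) = total f"
  unfolding total_def by (rule infsum_reindex_bij_betw[OF bij_left])

lemma total_cong: "(\<And>x. x \<in> carrier G \<Longrightarrow> f x = g x) \<Longrightarrow> total f = total g"
  unfolding total_def by (rule infsum_cong)

lemma nn_sum_left: "y \<in> carrier G \<Longrightarrow> nn_sum f \<Longrightarrow> nn_sum (\<lambda>x. f (y \<otimes> x))"
  unfolding nn_sum_def using summable_on_reindex_bij_betw[OF bij_left, of y f] by auto

lemma nn_sum_shift: "y \<in> carrier G \<Longrightarrow> nn_sum f \<Longrightarrow> nn_sum (shift y f)"
  using nn_sum_left[of "inv y" f] unfolding shift_def by simp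

lemma nn_sum_le_total: "nn_sum f \<Longrightarrow> x \<in> carrier G \<Longrightarrow> f x \<le> total f"
  unfolding nn_sum_def total_def using le_infsum_member[of f] by blast

lemma nn_sum_nonneg: "nn_sum f \<Longrightarrow> x \<in> carrier G \<Longrightarrow> 0 \<le> f x"
  unfolding nn_sum_def by blast

lemma nn_sum_summable: "nn_sum f \<Longrightarrow> f summable_on carrier G"
  unfolding nn_sum_def by blast

lemma nn_sum_mult:
  assumes "nn_sum f" "nn_sum g" shows "nn_sum (\<lambda>x. f x * g x)"
  unfolding nn_sum_def
proof
  show "\<forall>x\<in>carrier G. 0 \<le> f x * g x" using assms unfolding nn_sum_def by simp
  show "(\<lambda>x. f x * g x) summable_on carrier G"
    by (rule summable_on_comparison_test[OF summable_on_cmult_left[OF nn_sum_summable[OF assms(1)], of "total g"]])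
       (use assms nn_sum_le_total in \<open>auto simp: nn_sum_def intro!: mult_left_mono\<close>)
qed

lemma total_nonneg: "nn_sum f \<Longrightarrow> 0 \<le> total f"
  unfolding total_def nn_sum_def by (auto intro: infsum_nonneg)

lemma ip_nonneg: "nn_sum f \<Longrightarrow> nn_sum g \<Longrightarrow> 0 \<le> ip f g"
  unfolding ip_def by (intro total_nonneg nn_sum_mult)

lemma ip_commute: "ip f g = ip g f" unfolding ip_def by (simp add: mult.commute)

lemma ip_shift: "y \<in> carrier G \<Longrightarrow> ip (shift y f) (shift y g) = ip f g"
  unfolding ip_def shift_def using total_left[of "inv y" "\<lambda>x. f x * g x"] by simp

lemma has_sum_ip: "nn_sum f \<Longrightarrow> nn_sum g \<Longrightarrow> ((\<lambda>x. f x * g x) has_sum ip f g) (carrier G)"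
  unfolding ip_def total_def by (rule has_sum_infsum) (rule nn_sum_summable[OF nn_sum_mult])

lemma has_sum_diff_square:
  assumes "nn_sum f" "nn_sum g"
  shows "((\<lambda>x. (f x - t * g x)\<^sup>2) has_sum (ip f f - 2 * t * ip f g + t\<^sup>2 * ip g g)) (carrier G)"
proof -
  have "((\<lambda>x. f x * f x + ((- 2 * t) * (f x * g x) + t\<^sup>2 * (g x * g x))) has_sum
      (ip f f + ((- 2 * t) * ip f g + t\<^sup>2 * ip g g))) (carrier G)"
    by (intro has_sum_add has_sum_cmult_right has_sum_ip assms)
  then show ?thesis by (simp add: power2_eq_square algebra_simps)
qed

lemma ip_cauchy_schwarz:
  assumes "nn_sum f" "nn_sum g" "0 < ip g g"
  shows "(ip f g)\<^sup>2 \<le> ip f f * ip g g"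
proof -
  define t where "t = ip f g / ip g g"
  have "0 \<le> ip f f - 2 * t * ip f g + t\<^sup>2 * ip g g"
    by (rule has_sum_nonneg[OF has_sum_diff_square[OF assms(1,2)]]) simp
  also have "t\<^sup>2 * ip g g = t * ip f g" unfolding t_def using assms(3) by (simp add: power2_eq_square)
  finally have "t * ip f g \<le> ip f f" by simp
  then show ?thesis unfolding t_def using assms(3) by (simp add: divide_le_eq power2_eq_square)
qed

lemma has_sum_disp:
  assumes "nn_sum f" "y \<in> carrier G"
  shows "((\<lambda>x. (shift y f x - f x)\<^sup>2) has_sum (2 * ip f f - 2 * ip (shift y f) f)) (carrier G)"
  using has_sum_diff_square[OF nn_sum_shift[OF assms(2,1)] assms(1), of 1] ip_shift[OF assms(2), of f f]
  by simp

lemma disp_eq: "nn_sum f \<Longrightarrow> y \<in> carrier G \<Longrightarrow> disp y f = 2 * ip f f - 2 * ip (shift y f) f"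
  unfolding disp_def total_def by (rule infsumI) (rule has_sum_disp)

text \<open>The triangle inequality in \<open>\<ell>\<^sup>2\<close>, in a form that avoids square roots: it comes from
  \<open>(a + b)\<^sup>2 \<le> (1 + 1/n) a\<^sup>2 + (1 + n) b\<^sup>2\<close>.\<close>

lemma disp_mult:
  assumes f: "nn_sum f" and c: "y \<in> carrier G" "z \<in> carrier G" and n: "1 \<le> n"
    and D: "disp y f \<le> \<Delta>" "disp z f \<le> (real n)\<^sup>2 * \<Delta>"
  shows "disp (y \<otimes> z) f \<le> (real (Suc n))\<^sup>2 * \<Delta>"
proof -
  have hy: "((\<lambda>x. (shift y f x - f x)\<^sup>2) has_sum disp y f) (carrier G)"
    using has_sum_disp[OF f c(1)] disp_eq[OF f c(1)] by simp
  have "((\<lambda>x. (shift z f x - f x)\<^sup>2) has_sum disp z f) (carrier G)"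
    using has_sum_disp[OF f c(2)] disp_eq[OF f c(2)] by simp
  then have hz: "((\<lambda>x. (shift z f (inv y \<otimes> x) - f (inv y \<otimes> x))\<^sup>2) has_sum disp z f) (carrier G)"
    by (subst has_sum_reindex_bij_betw[OF bij_left[of "inv y"], where f = "\<lambda>x. (shift z f x - f x)\<^sup>2"]) (use c in auto)
  have hyz: "((\<lambda>x. (shift (y \<otimes> z) f x - f x)\<^sup>2) has_sum disp (y \<otimes> z) f) (carrier G)"
    using has_sum_disp[OF f, of "y \<otimes> z"] disp_eq[OF f, of "y \<otimes> z"] c by simp
  define \<theta> where "\<theta> = real n"
  have \<theta>: "\<theta> > 0" unfolding \<theta>_def using n by simp
  have sq: "(a + b)\<^sup>2 \<le> (1 + 1 / \<theta>) * a\<^sup>2 + (1 + \<theta>) * b\<^sup>2" for a b :: real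
  proof -
    have "0 \<le> (a - \<theta> * b)\<^sup>2 / \<theta>" using \<theta> by simp
    also have "\<dots> = a\<^sup>2 / \<theta> - 2 * a * b + \<theta> * b\<^sup>2" using \<theta> by (simp add: power2_eq_square field_simps)
    finally show ?thesis by (simp add: power2_eq_square algebra_simps)
  qed
  have "disp (y \<otimes> z) f \<le> (1 + 1 / \<theta>) * disp z f + (1 + \<theta>) * disp y f"
  proof (rule has_sum_mono[OF hyz has_sum_add[OF has_sum_cmult_right[OF hz] has_sum_cmult_right[OF hy]]])
    fix x assume x: "x \<in> carrier G"
    have "shift (y \<otimes> z) f x = shift z f (inv y \<otimes> x)"
      unfolding shift_def using x c by (simp add: inv_mult_group m_assoc)
    then have "shift (y \<otimes> z) f x - f x = (shift z f (inv y \<otimes> x) - f (inv y \<otimes> x)) + (shift y f x - f x)"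
      unfolding shift_def by simp
    then show "(shift (y \<otimes> z) f x - f x)\<^sup>2 \<le> (1 + 1 / \<theta>) * (shift z f (inv y \<otimes> x) - f (inv y \<otimes> x))\<^sup>2 + (1 + \<theta>) * (shift y f x - f x)\<^sup>2"
      using sq by presburger
  qed
  also have "\<dots> \<le> (1 + 1 / \<theta>) * (\<theta>\<^sup>2 * \<Delta>) + (1 + \<theta>) * \<Delta>"
    using D \<theta> unfolding \<theta>_def[symmetric] by (intro add_mono mult_left_mono) auto
  also have "\<dots> = (real (Suc n))\<^sup>2 * \<Delta>" using \<theta> unfolding \<theta>_def by (simp add: field_simps power2_eq_square)
  finally show ?thesis .
qed

text \<open>The pseudo-Poincare inequality: translating by a word of length \<open>n\<close> costs at most
  \<open>n\<^sup>2\<close> times the price of a letter.\<close>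

lemma disp_wball:
  assumes f: "nn_sum f" and E: "E \<subseteq> carrier G" "\<And>a. a \<in> E \<Longrightarrow> disp a f \<le> \<Delta>" "0 \<le> \<Delta>"
    and x: "x \<in> wball G E n"
  shows "disp x f \<le> (real n)\<^sup>2 * \<Delta>"
  using x
proof (induction n arbitrary: x)
  case 0
  then show ?case using disp_eq[OF f, of \<one>] unfolding ip_def shift_def
    by (simp add: total_cong[of "\<lambda>x. f (\<one> \<otimes> x) * f x" "\<lambda>x. f x * f x"])
next
  case (Suc n)
  then obtain a z where a: "a \<in> E" "z \<in> wball G E n" "x = a \<otimes> z" by auto
  have c: "a \<in> carrier G" "z \<in> carrier G" using a E(1) wball_closed[OF E(1)] by blast+
  show ?case
  proof (cases "n = 0")
    case True
    then show ?thesis using a c E(2)[of a] by simp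
  next
    case False
    then show ?thesis unfolding a(3) using disp_mult[OF f c, of n \<Delta>] E(2)[OF a(1)] Suc.IH[OF a(2)] by simp
  qed
qed

text \<open>Compare \<open>f\<close> with its average over translates by \<open>F\<close>. The average is bounded by
  \<open>total f / card F\<close>, and the difference is controlled by the displacements.\<close>

lemma nash_average:
  assumes f: "nn_sum f" and F: "finite F" "F \<subseteq> carrier G" and D: "\<And>y. y \<in> F \<Longrightarrow> disp y f \<le> \<Delta>"
  shows "real (card F) * ip f f \<le> (total f)\<^sup>2 + real (card F) * \<Delta> / 2"
proof -
  have "ip f f \<le> ip (shift y f) f + \<Delta> / 2" if "y \<in> F" for y
    using D[OF that] disp_eq[OF f, of y] that F by auto
  then have "(\<Sum>y\<in>F. ip f f) \<le> (\<Sum>y\<in>F. ip (shift y f) f + \<Delta> / 2)" by (rule sum_mono)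
  then have 1: "real (card F) * ip f f \<le> (\<Sum>y\<in>F. ip (shift y f) f) + real (card F) * \<Delta> / 2"
    by (simp add: sum.distrib)
  have h: "((\<lambda>x. \<Sum>y\<in>F. shift y f x * f x) has_sum (\<Sum>y\<in>F. ip (shift y f) f)) (carrier G)"
    by (rule has_sum_finite_sum) (use F f in \<open>auto intro!: has_sum_ip nn_sum_shift\<close>)
  have "((\<lambda>x. total f * f x) has_sum (total f * total f)) (carrier G)"
    by (intro has_sum_cmult_right) (simp add: total_def nn_sum_summable[OF f])
  then have "(\<Sum>y\<in>F. ip (shift y f) f) \<le> total f * total f"
  proof (rule has_sum_mono[OF h])
    fix x assume x: "x \<in> carrier G"
    have inj: "inj_on (\<lambda>y. inv y \<otimes> x) F"
      using F x by (intro inj_onI) (metis inv_closed inv_inv right_cancel subset_iff)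
    have "(\<Sum>y\<in>F. shift y f x) = (\<Sum>z\<in>(\<lambda>y. inv y \<otimes> x) ` F. f z)"
      unfolding shift_def using sum.reindex[OF inj, of f] by simp
    also have "\<dots> \<le> total f" unfolding total_def
      by (rule finite_sum_le_infsum[OF nn_sum_summable[OF f]]) (use F x f in \<open>auto simp: nn_sum_def\<close>)
    finally have "(\<Sum>y\<in>F. shift y f x) * f x \<le> total f * f x"
      using nn_sum_nonneg[OF f x] by (rule mult_right_mono)
    then show "(\<Sum>y\<in>F. shift y f x * f x) \<le> total f * f x" by (simp add: sum_distrib_right)
  qed
  with 1 show ?thesis by (simp add: power2_eq_square)
qed

end

locale symmetric_walk = group G for G :: "('a, 'b) monoid_scheme" (structure) +
  fixes p :: "'a \<Rightarrow> real"
  assumes p_nonneg: "\<And>x. x \<in> carrier G \<Longrightarrow> 0 \<le> p x"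
    and p_sym: "\<And>x. x \<in> carrier G \<Longrightarrow> p (inv x) = p x"
    and p_sum: "(p has_sum 1) (carrier G)"
begin

abbreviation P :: "('a \<Rightarrow> real) \<Rightarrow> 'a \<Rightarrow> real" where "P \<equiv> conv G p"

abbreviation u :: "nat \<Rightarrow> 'a \<Rightarrow> real" where "u n \<equiv> conv_power G p n"

lemma p_summable: "p summable_on carrier G" using p_sum summable_on_def by blast

lemma P_def': "P f x = (\<Sum>\<^sub>\<infinity>y\<in>carrier G. p y * shift y f x)"
  unfolding conv_def shift_def ..

lemma tonelli_shift:
  assumes f: "nn_sum f" and g: "\<And>x. x \<in> carrier G \<Longrightarrow> 0 \<le> g x" "\<And>x. x \<in> carrier G \<Longrightarrow> g x \<le> M"
  shows "\<And>x. x \<in> carrier G \<Longrightarrow> (\<lambda>y. p y * (shift y f x * g x)) summable_on carrier G"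
    and "(\<lambda>x. \<Sum>\<^sub>\<infinity>y\<in>carrier G. p y * (shift y f x * g x)) summable_on carrier G"
    and "(\<Sum>\<^sub>\<infinity>x\<in>carrier G. \<Sum>\<^sub>\<infinity>y\<in>carrier G. p y * (shift y f x * g x)) = (\<Sum>\<^sub>\<infinity>y\<in>carrier G. p y * ip (shift y f) g)"
proof -
  have nn: "0 \<le> p y * (shift y f x * g x)" if "x \<in> carrier G" "y \<in> carrier G" for x y
    using that p_nonneg g(1) nn_sum_nonneg[OF nn_sum_shift[OF that(2) f]] by simp
  have s1: "(\<lambda>x. shift y f x * g x) summable_on carrier G" if y: "y \<in> carrier G" for y
    by (rule summable_on_comparison_test[OF summable_on_cmult_left[OF nn_sum_summable[OF nn_sum_shift[OF y f]], of M]])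
       (use g nn_sum_nonneg[OF nn_sum_shift[OF y f]] in \<open>auto intro!: mult_left_mono\<close>)
  have inner: "(\<lambda>x. p y * (shift y f x * g x)) summable_on carrier G" if y: "y \<in> carrier G" for y
    by (rule summable_on_cmult_right[OF s1[OF y]])
  have e: "(\<Sum>\<^sub>\<infinity>x\<in>carrier G. p y * (shift y f x * g x)) = p y * ip (shift y f) g" for y
    unfolding ip_def total_def by (rule infsum_cmult_right')
  have ub: "0 \<le> ip (shift y f) g \<and> ip (shift y f) g \<le> total f * M" if y: "y \<in> carrier G" for y
  proof
    show "0 \<le> ip (shift y f) g" unfolding ip_def total_def
      by (rule infsum_nonneg) (use g nn_sum_nonneg[OF nn_sum_shift[OF y f]] in auto)
    have "ip (shift y f) g \<le> total (\<lambda>x. shift y f x * M)" unfolding ip_def total_def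
      by (rule infsum_mono[OF s1[OF y] summable_on_cmult_left[OF nn_sum_summable[OF nn_sum_shift[OF y f]]]])
         (use g nn_sum_nonneg[OF nn_sum_shift[OF y f]] in \<open>auto intro!: mult_left_mono\<close>)
    also have "\<dots> = total f * M"
      using total_left[of "inv y" f] y unfolding total_def shift_def by (simp add: infsum_cmult_left')
    finally show "ip (shift y f) g \<le> total f * M" .
  qed
  have outer: "(\<lambda>y. \<Sum>\<^sub>\<infinity>x\<in>carrier G. p y * (shift y f x * g x)) summable_on carrier G"
    unfolding e
    by (rule summable_on_comparison_test[OF summable_on_cmult_left[OF p_summable, of "total f * M"]])
       (use ub p_nonneg in \<open>auto intro!: mult_left_mono\<close>)
  note t = tonelli_nonneg[of "carrier G" "carrier G" "\<lambda>x y. p y * (shift y f x * g x)", OF nn inner outer]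
  show "\<And>x. x \<in> carrier G \<Longrightarrow> (\<lambda>y. p y * (shift y f x * g x)) summable_on carrier G" by (rule t(1))
  show "(\<lambda>x. \<Sum>\<^sub>\<infinity>y\<in>carrier G. p y * (shift y f x * g x)) summable_on carrier G" by (rule t(2))
  show "(\<Sum>\<^sub>\<infinity>x\<in>carrier G. \<Sum>\<^sub>\<infinity>y\<in>carrier G. p y * (shift y f x * g x)) = (\<Sum>\<^sub>\<infinity>y\<in>carrier G. p y * ip (shift y f) g)"
    using t(3) unfolding e .
qed

lemma P_summand: "nn_sum f \<Longrightarrow> x \<in> carrier G \<Longrightarrow> (\<lambda>y. p y * shift y f x) summable_on carrier G"
  using tonelli_shift(1)[of f "\<lambda>_. 1" 1 x] by simp

lemma nn_sum_P:
  assumes f: "nn_sum f" shows "nn_sum (P f)"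
  unfolding nn_sum_def
proof
  show "\<forall>x\<in>carrier G. 0 \<le> P f x"
    unfolding P_def' using p_nonneg nn_sum_nonneg[OF nn_sum_shift[OF _ f]] by (auto intro!: infsum_nonneg)
  show "P f summable_on carrier G"
    using tonelli_shift(2)[OF f, of "\<lambda>_. 1" 1] unfolding P_def' by simp
qed

lemma total_P:
  assumes f: "nn_sum f" shows "total (P f) = total f"
proof -
  have "total (P f) = (\<Sum>\<^sub>\<infinity>y\<in>carrier G. p y * ip (shift y f) (\<lambda>_. 1))"
    using tonelli_shift(3)[OF f, of "\<lambda>_. 1" 1] unfolding P_def' total_def by simp
  also have "\<dots> = (\<Sum>\<^sub>\<infinity>y\<in>carrier G. p y * total f)"
    by (rule infsum_cong) (use total_left[of "inv _" f] in \<open>simp add: ip_def shift_def\<close>)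
  also have "\<dots> = total f" using infsumI[OF p_sum] by (simp add: infsum_cmult_left')
  finally show ?thesis .
qed

lemma ip_P:
  assumes f: "nn_sum f" and g: "nn_sum g"
  shows "ip (P f) g = (\<Sum>\<^sub>\<infinity>y\<in>carrier G. p y * ip (shift y f) g)"
proof -
  have "ip (P f) g = (\<Sum>\<^sub>\<infinity>x\<in>carrier G. \<Sum>\<^sub>\<infinity>y\<in>carrier G. p y * (shift y f x * g x))"
    unfolding ip_def total_def P_def'
    by (rule infsum_cong) (simp add: infsum_cmult_left'[symmetric] mult.assoc)
  then show ?thesis using tonelli_shift(3)[OF f, of g "total g"] nn_sum_nonneg[OF g] nn_sum_le_total[OF g] by simp
qed

lemma ip_P_adjoint:
  assumes f: "nn_sum f" and g: "nn_sum g"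
  shows "ip (P f) g = ip f (P g)"
proof -
  have "(\<Sum>\<^sub>\<infinity>y\<in>carrier G. p y * ip (shift y f) g) = (\<Sum>\<^sub>\<infinity>y\<in>carrier G. p (inv y) * ip (shift (inv y) f) g)"
    using infsum_reindex_bij_betw[OF bij_inv, of "\<lambda>y. p y * ip (shift y f) g"] by simp
  also have "\<dots> = (\<Sum>\<^sub>\<infinity>y\<in>carrier G. p y * ip (shift y g) f)"
  proof (rule infsum_cong)
    fix y assume y: "y \<in> carrier G"
    have "ip (shift (inv y) f) g = ip (shift y (shift (inv y) f)) (shift y g)" using ip_shift[OF y] by simp
    also have "\<dots> = ip f (shift y g)" unfolding ip_def
      by (rule total_cong) (use y in \<open>simp add: shift_def\<close>)
    finally show "p (inv y) * ip (shift (inv y) f) g = p y * ip (shift y g) f"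
      using p_sym[OF y] ip_commute by simp
  qed
  finally show ?thesis using ip_P[OF f g] ip_P[OF g f] ip_commute by metis
qed

text \<open>At each point, \<open>P f\<close> is the mean of the values of the translates of \<open>f\<close>, and by
  \<open>variance_ge_pair\<close> the loss of energy there is at least a multiple of the squared
  difference of two of these values.\<close>

lemma dissipation:
  assumes f: "nn_sum f" and a: "a \<in> carrier G" and b: "b \<in> carrier G"
  shows "min (p a) (p b) / 2 * disp (inv a \<otimes> b) f \<le> ip f f - ip (P f) (P f)"
proof -
  define f2 where "f2 = (\<lambda>x. f x * f x)"
  have f2: "nn_sum f2" unfolding f2_def by (rule nn_sum_mult[OF f f])
  have h1: "(P f2 has_sum ip f f) (carrier G)"
    using has_sum_infsum[OF nn_sum_summable[OF nn_sum_P[OF f2]]] total_P[OF f2]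
    unfolding total_def ip_def by (simp add: f2_def)
  have h2: "((\<lambda>x. P f x * P f x) has_sum ip (P f) (P f)) (carrier G)"
    by (intro has_sum_ip nn_sum_P f)
  have h12: "((\<lambda>x. P f2 x - (P f x)\<^sup>2) has_sum (ip f f - ip (P f) (P f))) (carrier G)"
    using has_sum_add[OF h1 has_sum_uminusI[OF h2]]
    by (simp add: power2_eq_square)
  define c where "c = inv a \<otimes> b"
  have c: "c \<in> carrier G" unfolding c_def using a b by simp
  have "((\<lambda>x. (shift c f x - f x)\<^sup>2) has_sum disp c f) (carrier G)"
    using has_sum_disp[OF f c] disp_eq[OF f c] by simp
  then have h3: "((\<lambda>x. (shift c f (inv a \<otimes> x) - f (inv a \<otimes> x))\<^sup>2) has_sum disp c f) (carrier G)"
    by (subst has_sum_reindex_bij_betw[OF bij_left[of "inv a"], where f = "\<lambda>x. (shift c f x - f x)\<^sup>2"]) (use a in auto)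
  show ?thesis unfolding c_def[symmetric]
  proof (rule has_sum_mono[OF has_sum_cmult_right[OF h3] h12])
    fix x assume x: "x \<in> carrier G"
    have "shift c f (inv a \<otimes> x) = shift b f x"
      unfolding shift_def c_def using x a b by (simp add: inv_mult_group m_assoc)
    then have "min (p a) (p b) / 2 * (shift c f (inv a \<otimes> x) - f (inv a \<otimes> x))\<^sup>2
        = min (p b) (p a) / 2 * (shift b f x - shift a f x)\<^sup>2"
      unfolding shift_def by (simp add: min.commute)
    also have "\<dots> \<le> (\<Sum>\<^sub>\<infinity>y\<in>carrier G. p y * (shift y f x)\<^sup>2) - (\<Sum>\<^sub>\<infinity>y\<in>carrier G. p y * shift y f x)\<^sup>2"
      by (rule variance_ge_pair[OF p_sum p_nonneg _ _ b a, of "\<lambda>y. shift y f x" "total f"])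
         (use x f in \<open>auto simp: shift_def intro!: nn_sum_nonneg[OF f] nn_sum_le_total[OF f]\<close>)
    also have "\<dots> = P f2 x - (P f x)\<^sup>2"
      unfolding P_def' f2_def shift_def by (simp add: power2_eq_square)
    finally show "min (p a) (p b) / 2 * (shift c f (inv a \<otimes> x) - f (inv a \<otimes> x))\<^sup>2 \<le> P f2 x - (P f x)\<^sup>2" .
  qed
qed

lemma u_0: "u 0 = indicator {\<one>}" and u_Suc: "u (Suc n) = P (u n)"
  unfolding conv_power_def by auto

lemma nn_sum_u: "nn_sum (u n)" and total_u: "total (u n) = 1"
proof -
  have "nn_sum (u n) \<and> total (u n) = 1"
  proof (induction n)
    case 0
    have "(indicator {\<one>} :: 'a \<Rightarrow> real) summable_on carrier G"
      by (rule finite_nonzero_values_imp_summable_on) (auto simp: indicator_def)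
    moreover have "infsum (indicator {\<one>} :: 'a \<Rightarrow> real) (carrier G) = infsum (\<lambda>_. 1) {\<one>}"
      by (rule infsum_cong_neutral) auto
    ultimately show ?case unfolding u_0 nn_sum_def total_def by simp
  next
    case (Suc n)
    then show ?case unfolding u_Suc using nn_sum_P total_P by simp
  qed
  then show "nn_sum (u n)" "total (u n) = 1" by auto
qed

lemma ip_u: "ip (u m) (u n) = u (m + n) \<one>"
proof (induction m arbitrary: n)
  case 0
  have "ip (u 0) (u n) = infsum (\<lambda>x. u n x) {\<one>}"
    unfolding ip_def total_def u_0 by (rule infsum_cong_neutral) auto
  then show ?case by simp
next
  case (Suc m)
  have "ip (u (Suc m)) (u n) = ip (u m) (P (u n))" unfolding u_Suc by (rule ip_P_adjoint[OF nn_sum_u nn_sum_u])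
  then show ?case using Suc[of "Suc n"] unfolding u_Suc by (simp add: u_Suc)
qed

text \<open>At even times the probability of return is the squared norm of the distribution at
  half the time, which is what makes it monotone.\<close>

definition ret2 :: "nat \<Rightarrow> real" where "ret2 n = u (2 * n) \<one>"

lemma ret2_ip: "ret2 n = ip (u n) (u n)"
  unfolding ret2_def ip_u by (simp add: mult_2)

lemma ret2_nonneg: "0 \<le> ret2 n" unfolding ret2_ip by (rule ip_nonneg[OF nn_sum_u nn_sum_u])

lemma ret2_antimono: "ret2 (Suc n) \<le> ret2 n"
proof -
  have "0 \<le> disp (inv \<one> \<otimes> \<one>) (u n)" unfolding disp_def total_def by (rule infsum_nonneg) simp
  then have "0 \<le> min (p \<one>) (p \<one>) / 2 * disp (inv \<one> \<otimes> \<one>) (u n)" using p_nonneg[of \<one>] by simp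
  also have "\<dots> \<le> ip (u n) (u n) - ip (P (u n)) (P (u n))" by (rule dissipation[OF nn_sum_u]) auto
  finally show ?thesis unfolding ret2_ip u_Suc by simp
qed

text \<open>The averages run over products of elements \<open>inv a \<otimes> b\<close> rather than over steps of the
  walk, so that walks with a parity are covered.\<close>

lemma ret2_nash:
  assumes E: "finite E" "\<And>x. x \<in> E \<Longrightarrow> \<exists>a\<in>carrier G. \<exists>b\<in>carrier G. x = inv a \<otimes> b \<and> 0 < p a \<and> 0 < p b"
  shows "\<exists>K>0. \<forall>r n. real (card (wball G E r)) * ret2 n \<le> 1 + real (card (wball G E r)) * (K * (real r)\<^sup>2 * (ret2 n - ret2 (Suc n)))"
proof -
  have Ec: "E \<subseteq> carrier G" using E(2) by force
  have "\<exists>K\<ge>1. \<forall>x\<in>E. \<forall>n. disp x (u n) \<le> K * (ret2 n - ret2 (Suc n))"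
  proof (rule finite_uniform_const[OF E(1)])
    fix x assume "x \<in> E"
    then obtain a b where ab: "a \<in> carrier G" "b \<in> carrier G" "x = inv a \<otimes> b" "0 < p a" "0 < p b" using E(2) by blast
    define q where "q = min (p a) (p b) / 2"
    have q: "q > 0" unfolding q_def using ab by simp
    have "disp x (u n) \<le> (1 / q) * (ret2 n - ret2 (Suc n))" for n
      using dissipation[OF nn_sum_u ab(1,2), of n] q unfolding q_def[symmetric] ab(3) ret2_ip u_Suc
      by (simp add: divide_simps mult.commute)
    then show "\<exists>K. \<forall>n. disp x (u n) \<le> K * (ret2 n - ret2 (Suc n))" by blast
  next
    fix x and K K' :: real assume K: "\<forall>n. disp x (u n) \<le> K * (ret2 n - ret2 (Suc n))" "K \<le> K'"
    have "K * (ret2 n - ret2 (Suc n)) \<le> K' * (ret2 n - ret2 (Suc n))" for n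
      using K(2) ret2_antimono[of n] by (intro mult_right_mono) auto
    then show "\<forall>n. disp x (u n) \<le> K' * (ret2 n - ret2 (Suc n))" using K(1) order_trans by blast
  qed
  then obtain K where K: "K \<ge> 1" "\<And>x n. x \<in> E \<Longrightarrow> disp x (u n) \<le> K * (ret2 n - ret2 (Suc n))" by blast
  have "real (card (wball G E r)) * ret2 n \<le> 1 + real (card (wball G E r)) * (K / 2 * (real r)\<^sup>2 * (ret2 n - ret2 (Suc n)))" for r n
  proof -
    have "disp x (u n) \<le> (real r)\<^sup>2 * (K * (ret2 n - ret2 (Suc n)))" if "x \<in> wball G E r" for x
      by (rule disp_wball[OF nn_sum_u Ec K(2) _ that]) (use K(1) ret2_antimono[of n] in auto)
    from nash_average[OF nn_sum_u finite_wball[OF E(1)] wball_closed[OF Ec] this]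
    show ?thesis unfolding total_u ret2_ip by (simp add: mult_ac)
  qed
  then show ?thesis using K(1) by (intro exI[of _ "K / 2"]) auto
qed

end

section \<open>Return probabilities from volume growth\<close>

text \<open>Summing the inequality over \<open>N \<le> n < 2 * N\<close> makes the differences telescope and gives
  \<open>a (2 * N) \<le> C / r ^ d + (K * r\<^sup>2 / N) * a N\<close>. With \<open>r\<close> a small multiple of \<open>sqrt N\<close> the
  second term is contracting after multiplication by \<open>N ^ (d / 2)\<close>.\<close>

lemma nash_decay:
  fixes a :: "nat \<Rightarrow> real"
  assumes a: "\<And>n. 0 \<le> a n" "\<And>n. a (Suc n) \<le> a n" and d: "0 \<le> d" and v: "0 < v" and K: "0 < K"
    and nash: "\<And>r n. 1 \<le> r \<Longrightarrow> a n \<le> 1 / (v * real r powr d) + K * (real r)\<^sup>2 * (a n - a (Suc n))"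
  shows "\<exists>C>0. \<forall>n\<ge>1. a n \<le> C * real n powr (- d / 2)"
proof -
  have anti: "a n \<le> a m" if "m \<le> n" for m n
    by (rule lift_Suc_antimono_le[of a, OF a(2) that])
  \<comment> \<open>The choice makes the second term below at most half of \<open>a N\<close> even after the loss of
    \<open>4 powr (d / 2)\<close> caused by odd indices.\<close>
  define \<epsilon> where "\<epsilon> = sqrt (4 powr (- d / 2) / (2 * K))"
  have \<epsilon>: "0 < \<epsilon>" "\<epsilon>\<^sup>2 = 4 powr (- d / 2) / (2 * K)" unfolding \<epsilon>_def using K by auto
  have K\<epsilon>: "K * \<epsilon>\<^sup>2 = 4 powr (- d / 2) / 2" unfolding \<epsilon>(2) using K by simp
  define C1 where "C1 = (\<epsilon> / 2) powr (- d) / v"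
  have C1: "C1 > 0" unfolding C1_def using \<epsilon> v by simp
  have half: "a (2 * N) \<le> C1 * real N powr (- d / 2) + 4 powr (- d / 2) / 2 * a N"
    if N: "1 \<le> \<epsilon> * sqrt (real N)" for N
  proof -
    have N0: "N \<noteq> 0" using N by (intro notI) simp
    define r where "r = nat \<lfloor>\<epsilon> * sqrt (real N)\<rfloor>"
    have r1: "1 \<le> r" unfolding r_def using N by (simp add: le_nat_iff)
    have ru: "real r \<le> \<epsilon> * sqrt (real N)" unfolding r_def using N by simp
    have "1 \<le> \<lfloor>\<epsilon> * sqrt (real N)\<rfloor>" using N by simp
    then have "1 \<le> real r" "\<epsilon> * sqrt (real N) < real r + 1" unfolding r_def by linarith+
    then have rl: "\<epsilon> * sqrt (real N) / 2 \<le> real r" by linarith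
    have "(real r)\<^sup>2 \<le> (\<epsilon> * sqrt (real N))\<^sup>2" using ru by (intro power_mono) auto
    then have r2: "(real r)\<^sup>2 \<le> \<epsilon>\<^sup>2 * real N" by (simp add: power_mult_distrib)
    have "real r powr (- d) \<le> (\<epsilon> * sqrt (real N) / 2) powr (- d)"
      using rl d N by (intro powr_mono2') auto
    also have "\<dots> = (\<epsilon> / 2) powr (- d) * real N powr (- d / 2)"
      using \<epsilon> powr_mult[of "\<epsilon> / 2" "sqrt (real N)" "- d"]
      by (simp add: powr_half_sqrt[symmetric] powr_powr mult.commute)
    finally have "real r powr (- d) / v \<le> (\<epsilon> / 2) powr (- d) * real N powr (- d / 2) / v"
      using v by (intro divide_right_mono) auto
    moreover have "1 / (v * real r powr d) = real r powr (- d) / v"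
      using powr_minus[of "real r" d] by (simp add: field_simps)
    ultimately have t: "1 / (v * real r powr d) \<le> C1 * real N powr (- d / 2)"
      unfolding C1_def by simp
    have tel: "(\<Sum>n = N..<2 * N. a n - a (Suc n)) = a N - a (2 * N)"
      using sum_Suc_diff'[of N "2 * N" "\<lambda>n. - a n"] by (simp add: sum_negf[symmetric] algebra_simps)
    have "(\<Sum>n = N..<2 * N. a (2 * N)) \<le> (\<Sum>n = N..<2 * N. C1 * real N powr (- d / 2) + K * (real r)\<^sup>2 * (a n - a (Suc n)))"
    proof (rule sum_mono)
      fix n assume n: "n \<in> {N..<2 * N}"
      have "a (2 * N) \<le> a n" using anti n by simp
      also have "\<dots> \<le> 1 / (v * real r powr d) + K * (real r)\<^sup>2 * (a n - a (Suc n))" by (rule nash[OF r1])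
      finally show "a (2 * N) \<le> C1 * real N powr (- d / 2) + K * (real r)\<^sup>2 * (a n - a (Suc n))" using t by simp
    qed
    also have "\<dots> = real N * (C1 * real N powr (- d / 2)) + K * (real r)\<^sup>2 * (a N - a (2 * N))"
      by (simp add: sum.distrib sum_distrib_left[symmetric] tel)
    also have "\<dots> \<le> real N * (C1 * real N powr (- d / 2)) + K * (\<epsilon>\<^sup>2 * real N) * a N"
    proof -
      have "K * (real r)\<^sup>2 * (a N - a (2 * N)) \<le> K * (real r)\<^sup>2 * a N"
        using K a(1)[of "2 * N"] by (intro mult_left_mono) auto
      also have "\<dots> \<le> K * (\<epsilon>\<^sup>2 * real N) * a N"
        using r2 K a(1)[of N] by (intro mult_right_mono mult_left_mono) auto
      finally show ?thesis by simp
    qed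
    also have "\<dots> = real N * (C1 * real N powr (- d / 2) + 4 powr (- d / 2) / 2 * a N)"
      unfolding K\<epsilon>[symmetric] by (simp add: algebra_simps)
    finally have "real N * a (2 * N) \<le> real N * (C1 * real N powr (- d / 2) + 4 powr (- d / 2) / 2 * a N)" by simp
    then show ?thesis using N0 by simp
  qed
  obtain N0 :: nat where N0: "1 / \<epsilon>\<^sup>2 < real N0" using reals_Archimedean2 by blast
  have big: "1 \<le> \<epsilon> * sqrt (real N)" if "N0 \<le> N" for N
  proof -
    have "1 / \<epsilon>\<^sup>2 \<le> real N" using N0 that by linarith
    then have "1 \<le> \<epsilon>\<^sup>2 * real N" using \<epsilon>(1) by (simp add: divide_le_eq mult.commute)
    then have "sqrt 1 \<le> sqrt (\<epsilon>\<^sup>2 * real N)" by (rule real_sqrt_le_mono)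
    then show ?thesis using \<epsilon>(1) by (simp add: real_sqrt_mult)
  qed
  have N01: "N0 \<ge> 1" using N0 \<epsilon>(1) by (cases N0) (auto simp: not_less[symmetric])
  define M where "M = 2 * (4 powr (d / 2) * C1) + (2 * real N0) powr (d / 2) * a 0"
  have M0: "0 \<le> (2 * real N0) powr (d / 2) * a 0" "0 \<le> 4 powr (d / 2) * C1" using a(1) C1 by auto
  have main: "a n * real n powr (d / 2) \<le> M" if "1 \<le> n" for n
    using that
  proof (induction n rule: less_induct)
    case (less n)
    show ?case
    proof (cases "n < 2 * N0")
      case True
      have "a n * real n powr (d / 2) \<le> a 0 * (2 * real N0) powr (d / 2)"
        using True anti[of 0 n] a(1) d by (intro mult_mono powr_mono2) auto
      then show ?thesis using M0 unfolding M_def by (simp add: mult.commute)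
    next
      case False
      define N where "N = n div 2"
      have N: "N0 \<le> N" "N < n" "1 \<le> N" "2 * N \<le> n" "n \<le> 4 * N" unfolding N_def using False N01 by auto
      have IH: "a N * real N powr (d / 2) \<le> M" by (rule less.IH) (use N in auto)
      have f: "(4 * real N) powr (d / 2) = 4 powr (d / 2) * real N powr (d / 2)" by (rule powr_mult)
      have i1: "x powr (- d / 2) * x powr (d / 2) = 1" if "0 < x" for x :: real
        using powr_add[of x "- d / 2" "d / 2"] that by (metis add_divide_distrib add.left_inverse div_0 less_irrefl powr_zero_eq_one)
      have "a n * real n powr (d / 2) \<le> a (2 * N) * (4 * real N) powr (d / 2)"
        using N anti[of "2 * N" n] a(1) d by (intro mult_mono powr_mono2) auto
      also have "\<dots> \<le> (C1 * real N powr (- d / 2) + 4 powr (- d / 2) / 2 * a N) * (4 * real N) powr (d / 2)"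
        using half[OF big[OF N(1)]] by (intro mult_right_mono) auto
      also have "\<dots> = C1 * 4 powr (d / 2) * (real N powr (- d / 2) * real N powr (d / 2))
          + (4 powr (- d / 2) * 4 powr (d / 2)) * (a N * real N powr (d / 2)) / 2"
        unfolding f by (simp add: algebra_simps)
      also have "\<dots> = C1 * 4 powr (d / 2) + a N * real N powr (d / 2) / 2" using i1[of 4] i1[of "real N"] N by (simp only: mult_1 mult_1_right of_nat_0_less_iff)
      also have "\<dots> \<le> C1 * 4 powr (d / 2) + M / 2" using IH by simp
      also have "\<dots> \<le> M" unfolding M_def using M0 by (simp add: mult_ac)
      finally show ?thesis .
    qed
  qed
  have "a n \<le> (M + 1) * real n powr (- d / 2)" if n: "1 \<le> n" for n
  proof -
    have "a n = (a n * real n powr (d / 2)) * real n powr (- d / 2)"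
      using n by (simp add: mult.assoc powr_add[symmetric])
    also have "\<dots> \<le> (M + 1) * real n powr (- d / 2)" using main[OF n] by (intro mult_right_mono) auto
    finally show ?thesis .
  qed
  moreover have "M + 1 > 0" using M0 unfolding M_def by linarith
  ultimately show ?thesis by blast
qed

context group begin

lemma has_sum_indicator:
  assumes "finite W" "W \<subseteq> carrier G"
  shows "((indicator W :: 'a \<Rightarrow> real) has_sum real (card W)) (carrier G)"
proof -
  have "((\<lambda>_. 1::real) has_sum real (card W)) W" using has_sum_finite[OF assms(1), of "\<lambda>_. 1::real"] by simp
  also have "((\<lambda>_. 1::real) has_sum real (card W)) W \<longleftrightarrow> ((indicator W :: 'a \<Rightarrow> real) has_sum real (card W)) (carrier G)"
    by (rule has_sum_cong_neutral) (use assms in auto)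
  finally show ?thesis .
qed

end

context symmetric_walk begin

theorem ret2_upper:
  assumes E: "finite E" "\<And>x. x \<in> E \<Longrightarrow> \<exists>a\<in>carrier G. \<exists>b\<in>carrier G. x = inv a \<otimes> b \<and> 0 < p a \<and> 0 < p b"
    and v: "0 < v" "\<And>r. 1 \<le> r \<Longrightarrow> v * real r powr d \<le> real (card (wball G E r))" and d: "0 \<le> d"
  shows "\<exists>C>0. \<forall>n\<ge>1. ret2 n \<le> C * real n powr (- d / 2)"
proof -
  obtain K where K: "K > 0" "\<And>r n. real (card (wball G E r)) * ret2 n
      \<le> 1 + real (card (wball G E r)) * (K * (real r)\<^sup>2 * (ret2 n - ret2 (Suc n)))"
    using ret2_nash[OF E] by blast
  show ?thesis
  proof (rule nash_decay[where a = ret2, OF ret2_nonneg ret2_antimono d v(1) K(1)])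
    fix r n :: nat assume r: "1 \<le> r"
    define V where "V = real (card (wball G E r))"
    have pv: "0 < v * real r powr d" using v(1) r by simp
    then have V: "0 < V" "v * real r powr d \<le> V" using v(2)[OF r] unfolding V_def by linarith+
    have "V * ret2 n \<le> V * (1 / V + K * (real r)\<^sup>2 * (ret2 n - ret2 (Suc n)))"
      using K(2)[of r n] V unfolding V_def[symmetric] by (simp add: algebra_simps)
    then have "ret2 n \<le> 1 / V + K * (real r)\<^sup>2 * (ret2 n - ret2 (Suc n))" using V by simp
    moreover have "1 / V \<le> 1 / (v * real r powr d)" by (rule frac_le[OF _ _ pv V(2)]) simp_all
    ultimately show "ret2 n \<le> 1 / (v * real r powr d) + K * (real r)\<^sup>2 * (ret2 n - ret2 (Suc n))" by linarith
  qed
qed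

lemma nn_sum_iterate: "nn_sum f \<Longrightarrow> nn_sum ((P ^^ n) f)"
  by (induction n) (auto intro: nn_sum_P)

text \<open>The squared norms \<open>D n\<close> of the iterates are log-convex, since \<open>D (Suc n)\<close> is the inner
  product of the iterates with indices \<open>n\<close> and \<open>n + 2\<close>. Hence the decay is at most
  geometric, with the ratio of the first step.\<close>

lemma iterate_energy:
  assumes f: "nn_sum f" and pos: "0 < ip f f" and q: "0 \<le> q" "q \<le> 1"
    and c: "(1 - q) * ip f f \<le> ip (P f) f"
  shows "(1 - q) ^ (2 * n) * ip f f \<le> ip ((P ^^ n) f) ((P ^^ n) f)"
proof (cases "q = 1")
  case True
  then show ?thesis using pos ip_nonneg[OF nn_sum_iterate[OF f] nn_sum_iterate[OF f], of n n] by (cases n) auto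
next
  case False
  define \<rho> where "\<rho> = (1 - q)\<^sup>2"
  have \<rho>: "0 < \<rho>" unfolding \<rho>_def using False by simp
  define D where "D = (\<lambda>n. ip ((P ^^ n) f) ((P ^^ n) f))"
  have step: "0 < D n \<and> \<rho> * D n \<le> D (Suc n)" for n
  proof (induction n)
    case 0
    have "((1 - q) * ip f f)\<^sup>2 \<le> (ip (P f) f)\<^sup>2" using c q pos by (intro power_mono) auto
    also have "\<dots> \<le> ip (P f) (P f) * ip f f" by (rule ip_cauchy_schwarz[OF nn_sum_P[OF f] f pos])
    finally have "ip f f * (\<rho> * ip f f) \<le> ip f f * ip (P f) (P f)"
      unfolding \<rho>_def by (simp add: power2_eq_square mult_ac)
    then show ?case using pos unfolding D_def by simp
  next
    case (Suc n)
    define g where "g = (P ^^ n) f"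
    have g: "nn_sum g" unfolding g_def by (rule nn_sum_iterate[OF f])
    have Dn: "D n = ip g g" "D (Suc n) = ip (P g) (P g)" "D (Suc (Suc n)) = ip (P (P g)) (P (P g))"
      unfolding D_def g_def by auto
    have IH: "0 < ip g g" "\<rho> * ip g g \<le> ip (P g) (P g)" using Suc unfolding Dn by auto
    have "ip (P g) (P g) = ip (P (P g)) g" using ip_P_adjoint[OF nn_sum_P[OF g] g] by simp
    then have "(ip (P g) (P g))\<^sup>2 \<le> ip (P (P g)) (P (P g)) * ip g g"
      using ip_cauchy_schwarz[OF nn_sum_P[OF nn_sum_P[OF g]] g IH(1)] by simp
    moreover have "(\<rho> * ip g g) * ip (P g) (P g) \<le> (ip (P g) (P g))\<^sup>2"
      unfolding power2_eq_square using IH(2) ip_nonneg[OF nn_sum_P[OF g] nn_sum_P[OF g]] by (intro mult_right_mono)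
    ultimately have "ip g g * (\<rho> * ip (P g) (P g)) \<le> ip g g * ip (P (P g)) (P (P g))"
      by (simp add: mult_ac)
    then have "\<rho> * ip (P g) (P g) \<le> ip (P (P g)) (P (P g))" using IH(1) by simp
    moreover have "0 < ip (P g) (P g)" using IH \<rho> mult_pos_pos[OF \<rho> IH(1)] by linarith
    ultimately show ?case unfolding Dn by blast
  qed
  have "\<rho> ^ n * D 0 \<le> D n" for n
  proof (induction n)
    case (Suc n)
    have "\<rho> ^ Suc n * D 0 = \<rho> * (\<rho> ^ n * D 0)" by simp
    also have "\<dots> \<le> \<rho> * D n" using Suc \<rho> by (intro mult_left_mono) auto
    also have "\<dots> \<le> D (Suc n)" using step by blast
    finally show ?case .
  qed simp
  then show ?thesis unfolding D_def \<rho>_def by (simp add: power_mult)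
qed

text \<open>Linearity of \<open>P\<close>, and its commutation with right translations.\<close>

lemma iterate_eq_sum:
  assumes W: "finite W" "W \<subseteq> carrier G" and f: "\<And>x. x \<in> carrier G \<Longrightarrow> x \<notin> W \<Longrightarrow> f x = 0"
    and x: "x \<in> carrier G"
  shows "(P ^^ n) f x = (\<Sum>z\<in>W. f z * u n (x \<otimes> inv z))"
  using x
proof (induction n arbitrary: x)
  case 0
  have eq: "x \<otimes> inv z = \<one> \<longleftrightarrow> z = x" if "z \<in> W" for z
    using that W 0 by (metis inv_closed inv_equality inv_inv r_inv subset_iff)
  have "(\<Sum>z\<in>W. f z * u 0 (x \<otimes> inv z)) = (\<Sum>z\<in>W. if z = x then f z else 0)"
    by (rule sum.cong) (use eq in \<open>auto simp: u_0\<close>)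
  also have "\<dots> = f x" using W f[OF 0] by simp
  finally show ?case by simp
next
  case (Suc n)
  have "(P ^^ Suc n) f x = (\<Sum>\<^sub>\<infinity>y\<in>carrier G. p y * (P ^^ n) f (inv y \<otimes> x))"
    by (simp add: P_def' shift_def)
  also have "\<dots> = (\<Sum>\<^sub>\<infinity>y\<in>carrier G. \<Sum>z\<in>W. f z * (p y * u n (inv y \<otimes> (x \<otimes> inv z))))"
  proof (rule infsum_cong)
    fix y assume y: "y \<in> carrier G"
    have "p y * (P ^^ n) f (inv y \<otimes> x) = p y * (\<Sum>z\<in>W. f z * u n (inv y \<otimes> x \<otimes> inv z))"
      using Suc.IH[of "inv y \<otimes> x"] y Suc.prems by simp
    also have "\<dots> = (\<Sum>z\<in>W. f z * (p y * u n (inv y \<otimes> (x \<otimes> inv z))))"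
      unfolding sum_distrib_left
    proof (rule sum.cong)
      fix z assume "z \<in> W"
      then have "z \<in> carrier G" using W by auto
      then show "p y * (f z * u n (inv y \<otimes> x \<otimes> inv z)) = f z * (p y * u n (inv y \<otimes> (x \<otimes> inv z)))"
        using y Suc.prems by (simp add: m_assoc)
    qed simp
    finally show "p y * (P ^^ n) f (inv y \<otimes> x) = (\<Sum>z\<in>W. f z * (p y * u n (inv y \<otimes> (x \<otimes> inv z))))" .
  qed
  also have "\<dots> = (\<Sum>z\<in>W. f z * u (Suc n) (x \<otimes> inv z))"
  proof (rule infsumI, rule has_sum_finite_sum[OF W(1)], rule has_sum_cmult_right)
    fix z assume "z \<in> W"
    then have z: "x \<otimes> inv z \<in> carrier G" using W Suc.prems by auto
    show "((\<lambda>y. p y * u n (inv y \<otimes> (x \<otimes> inv z))) has_sum u (Suc n) (x \<otimes> inv z)) (carrier G)"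
      using has_sum_infsum[OF P_summand[OF nn_sum_u z], of n] unfolding u_Suc P_def' shift_def .
  qed
  finally show ?case .
qed

text \<open>The iterate is a superposition of right translates of the distribution of the walk,
  and these all have the same norm.\<close>

lemma iterate_le_ret2:
  assumes f: "nn_sum f" and W: "finite W" "W \<subseteq> carrier G" and f0: "\<And>x. x \<in> carrier G \<Longrightarrow> x \<notin> W \<Longrightarrow> f x = 0"
  shows "ip ((P ^^ n) f) ((P ^^ n) f) \<le> (total f)\<^sup>2 * ret2 n"
proof -
  define s where "s = (\<Sum>z\<in>W. f z)"
  have s: "total f = s"
  proof -
    have "total f = infsum f W" unfolding total_def by (rule infsum_cong_neutral) (use f0 W in auto)
    then show ?thesis unfolding s_def using W by simp
  qed
  have fz: "0 \<le> f z" if "z \<in> W" for z using nn_sum_nonneg[OF f] that W by auto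
  have h1: "((\<lambda>x. (P ^^ n) f x * (P ^^ n) f x) has_sum ip ((P ^^ n) f) ((P ^^ n) f)) (carrier G)"
    by (intro has_sum_ip nn_sum_iterate f)
  have hz: "((\<lambda>x. (u n (x \<otimes> inv z))\<^sup>2) has_sum ret2 n) (carrier G)" if "z \<in> W" for z
    using has_sum_ip[OF nn_sum_u nn_sum_u, of n n] has_sum_reindex_bij_betw[OF bij_right[of "inv z"], of "\<lambda>x. u n x * u n x" "ret2 n"]
      that W unfolding ret2_ip by (auto simp: power2_eq_square)
  have h2: "((\<lambda>x. s * (\<Sum>z\<in>W. f z * (u n (x \<otimes> inv z))\<^sup>2)) has_sum (s * (\<Sum>z\<in>W. f z * ret2 n))) (carrier G)"
    by (intro has_sum_cmult_right has_sum_finite_sum W(1) hz)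
  have "ip ((P ^^ n) f) ((P ^^ n) f) \<le> s * (\<Sum>z\<in>W. f z * ret2 n)"
  proof (rule has_sum_mono[OF h1 h2])
    fix x assume x: "x \<in> carrier G"
    define t where "t = (\<lambda>z. u n (x \<otimes> inv z))"
    have "(\<Sum>z\<in>W. f z * t z)\<^sup>2 = (\<Sum>z\<in>W. sqrt (f z) * (sqrt (f z) * t z))\<^sup>2"
      using fz by (intro arg_cong[of _ _ "\<lambda>a. a\<^sup>2"] sum.cong) (auto simp flip: mult.assoc)
    also have "\<dots> \<le> (\<Sum>z\<in>W. (sqrt (f z))\<^sup>2) * (\<Sum>z\<in>W. (sqrt (f z) * t z)\<^sup>2)"
      by (rule Cauchy_Schwarz_ineq_sum)
    also have "\<dots> = s * (\<Sum>z\<in>W. f z * (t z)\<^sup>2)" unfolding s_def using fz by (simp add: power_mult_distrib)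
    finally show "(P ^^ n) f x * (P ^^ n) f x \<le> s * (\<Sum>z\<in>W. f z * (u n (x \<otimes> inv z))\<^sup>2)"
      using iterate_eq_sum[OF W f0 x] unfolding t_def by (simp add: power2_eq_square)
  qed
  also have "\<dots> = (total f)\<^sup>2 * ret2 n" unfolding s by (simp add: s_def sum_distrib_right power2_eq_square mult.assoc)
  finally show ?thesis .
qed

end

locale moment_walk = symmetric_walk G p + sym_gen G A
  for G :: "('a, 'b) monoid_scheme" (structure) and p A +
  assumes moment: "(\<lambda>y. p y * (real (wlen G A y))\<^sup>2) summable_on carrier G"
begin

definition M2 :: real where "M2 = (\<Sum>\<^sub>\<infinity>y\<in>carrier G. p y * (real (wlen G A y))\<^sup>2)"

text \<open>Truncated subtraction makes this function vanish outside the ball of radius \<open>R\<close>.\<close>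

definition tent :: "nat \<Rightarrow> 'a \<Rightarrow> real" where "tent R x = real (R - wlen G A x)"

abbreviation V :: "nat \<Rightarrow> real" where "V n \<equiv> real (card (wball G A n))"

lemma M2_nonneg: "0 \<le> M2" unfolding M2_def by (rule infsum_nonneg) (use p_nonneg in auto)

lemma ball_facts: "finite (wball G A n)" "wball G A n \<subseteq> carrier G"
  using finite_wball[OF finite_gen] wball_closed[OF gen_closed] by auto

lemma V_pos: "1 \<le> V n"
proof -
  have "\<one> \<in> wball G A n" using wball_mono[of 0 n] by auto
  then have "wball G A n \<noteq> {}" by blast
  then show ?thesis using ball_facts(1)[of n] by (simp add: Suc_le_eq card_gt_0_iff)
qed

lemma tent_0: "x \<in> carrier G \<Longrightarrow> x \<notin> wball G A R \<Longrightarrow> tent R x = 0"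
  unfolding tent_def using wlen_le_iff[of x R] by simp

lemma nn_sum_tent: "nn_sum (tent R)"
  unfolding nn_sum_def
proof
  show "\<forall>x\<in>carrier G. 0 \<le> tent R x" by (simp add: tent_def)
  have "{x \<in> carrier G. tent R x \<noteq> 0} \<subseteq> wball G A R" using tent_0 by blast
  then show "tent R summable_on carrier G"
    using finite_nonzero_values_imp_summable_on finite_subset ball_facts(1) by blast
qed

lemma tent_lipschitz:
  assumes "x \<in> carrier G" "y \<in> carrier G"
  shows "\<bar>shift y (tent R) x - tent R x\<bar> \<le> real (wlen G A y)"
proof -
  have "wlen G A (inv y \<otimes> x) \<le> wlen G A y + wlen G A x"
    using wlen_mult[of "inv y" x] wlen_inv[of y] assms by simp
  moreover have "wlen G A x \<le> wlen G A y + wlen G A (inv y \<otimes> x)"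
    using wlen_mult[of y "inv y \<otimes> x"] assms by simp
  ultimately show ?thesis unfolding tent_def shift_def by linarith
qed

lemma disp_tent:
  assumes y: "y \<in> carrier G" shows "disp y (tent R) \<le> 2 * (real (wlen G A y))\<^sup>2 * V R"
proof -
  define W where "W = wball G A R"
  have hW: "((indicator W :: 'a \<Rightarrow> real) has_sum V R) (carrier G)"
    unfolding W_def by (rule has_sum_indicator[OF ball_facts])
  then have hW': "((\<lambda>x. indicator W (inv y \<otimes> x) :: real) has_sum V R) (carrier G)"
    using has_sum_reindex_bij_betw[OF bij_left[of "inv y"], of "indicator W" "V R"] y by simp
  have h: "((\<lambda>x. (real (wlen G A y))\<^sup>2 * (indicator W x + indicator W (inv y \<otimes> x))) has_sum
      ((real (wlen G A y))\<^sup>2 * (V R + V R))) (carrier G)"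
    by (intro has_sum_cmult_right has_sum_add hW hW')
  have "((\<lambda>x. (shift y (tent R) x - tent R x)\<^sup>2) has_sum disp y (tent R)) (carrier G)"
    using has_sum_disp[OF nn_sum_tent y] disp_eq[OF nn_sum_tent y] by simp
  then have "disp y (tent R) \<le> (real (wlen G A y))\<^sup>2 * (V R + V R)"
  proof (rule has_sum_mono[OF _ h])
    fix x assume x: "x \<in> carrier G"
    show "(shift y (tent R) x - tent R x)\<^sup>2 \<le> (real (wlen G A y))\<^sup>2 * (indicator W x + indicator W (inv y \<otimes> x))"
    proof (cases "x \<in> W \<or> inv y \<otimes> x \<in> W")
      case True
      have "\<bar>shift y (tent R) x - tent R x\<bar>\<^sup>2 \<le> (real (wlen G A y))\<^sup>2"
        using tent_lipschitz[OF x y] by (intro power_mono) auto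
      then have "(shift y (tent R) x - tent R x)\<^sup>2 \<le> (real (wlen G A y))\<^sup>2 * 1" by simp
      also have "\<dots> \<le> (real (wlen G A y))\<^sup>2 * (indicator W x + indicator W (inv y \<otimes> x))"
        using True by (intro mult_left_mono) (auto simp: indicator_def)
      finally show ?thesis .
    next
      case False
      then have "tent R x = 0" "tent R (inv y \<otimes> x) = 0" using tent_0 x y unfolding W_def by auto
      then show ?thesis by (simp add: shift_def)
    qed
  qed
  then show ?thesis by simp
qed

text \<open>The loss of energy is the mean, over one step \<open>y\<close>, of half the displacement by \<open>y\<close>.
  The tent is 1-Lipschitz and supported in a ball, so this is at most the squared length of
  \<open>y\<close> times the volume.\<close>

lemma tent_energy: "ip (tent R) (tent R) - M2 * V R \<le> ip (P (tent R)) (tent R)"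
proof -
  define e where "e = ip (tent R) (tent R)"
  have b: "e - (real (wlen G A y))\<^sup>2 * V R \<le> ip (shift y (tent R)) (tent R)"
      "0 \<le> ip (shift y (tent R)) (tent R)" "ip (shift y (tent R)) (tent R) \<le> e" if y: "y \<in> carrier G" for y
  proof -
    have "0 \<le> disp y (tent R)" unfolding disp_def total_def by (rule infsum_nonneg) simp
    then show "ip (shift y (tent R)) (tent R) \<le> e" "e - (real (wlen G A y))\<^sup>2 * V R \<le> ip (shift y (tent R)) (tent R)"
      using disp_tent[OF y, of R] disp_eq[OF nn_sum_tent y, of R] unfolding e_def by linarith+
    show "0 \<le> ip (shift y (tent R)) (tent R)" by (intro ip_nonneg nn_sum_shift nn_sum_tent y)
  qed
  have "(\<lambda>y. p y * ip (shift y (tent R)) (tent R)) summable_on carrier G"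
    by (rule summable_on_comparison_test[OF summable_on_cmult_left[OF p_summable, of e]])
       (use b p_nonneg in \<open>auto intro!: mult_left_mono\<close>)
  then have h1: "((\<lambda>y. p y * ip (shift y (tent R)) (tent R)) has_sum ip (P (tent R)) (tent R)) (carrier G)"
    unfolding ip_P[OF nn_sum_tent nn_sum_tent] by (rule has_sum_infsum)
  have hm: "((\<lambda>y. p y * (real (wlen G A y))\<^sup>2) has_sum M2) (carrier G)"
    unfolding M2_def by (rule has_sum_infsum[OF moment])
  have h2: "((\<lambda>y. e * p y + (- V R) * (p y * (real (wlen G A y))\<^sup>2)) has_sum (e * 1 + (- V R) * M2)) (carrier G)"
    by (intro has_sum_add has_sum_cmult_right hm p_sum)
  have "e * 1 + (- V R) * M2 \<le> ip (P (tent R)) (tent R)"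
  proof (rule has_sum_mono[OF h2 h1])
    fix y assume y: "y \<in> carrier G"
    have "p y * (e - (real (wlen G A y))\<^sup>2 * V R) \<le> p y * ip (shift y (tent R)) (tent R)"
      using b(1)[OF y] p_nonneg[OF y] by (rule mult_left_mono)
    then show "e * p y + (- V R) * (p y * (real (wlen G A y))\<^sup>2) \<le> p y * ip (shift y (tent R)) (tent R)"
      by (simp add: algebra_simps)
  qed
  then show ?thesis unfolding e_def by (simp add: mult.commute)
qed

lemma tent_norm: "(real l)\<^sup>2 * V l \<le> ip (tent (2 * l)) (tent (2 * l))"
proof -
  have "(real l)\<^sup>2 * V l = (\<Sum>x\<in>wball G A l. (real l)\<^sup>2)" by simp
  also have "\<dots> \<le> (\<Sum>x\<in>wball G A l. tent (2 * l) x * tent (2 * l) x)"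
  proof (rule sum_mono)
    fix x assume "x \<in> wball G A l"
    then have "wlen G A x \<le> l" by (rule wlen_le)
    then have "real l \<le> tent (2 * l) x" unfolding tent_def by simp
    then show "(real l)\<^sup>2 \<le> tent (2 * l) x * tent (2 * l) x" unfolding power2_eq_square by (intro mult_mono) auto
  qed
  also have "\<dots> \<le> ip (tent (2 * l)) (tent (2 * l))" unfolding ip_def total_def
    by (rule finite_sum_le_infsum) (use ball_facts nn_sum_mult[OF nn_sum_tent nn_sum_tent] in \<open>auto simp: nn_sum_def\<close>)
  finally show ?thesis .
qed

lemma tent_total: "(total (tent R))\<^sup>2 \<le> V R * ip (tent R) (tent R)"
proof -
  define W where "W = wball G A R"
  have hW: "((indicator W :: 'a \<Rightarrow> real) has_sum V R) (carrier G)"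
    unfolding W_def by (rule has_sum_indicator[OF ball_facts])
  then have nW: "nn_sum (indicator W)" unfolding nn_sum_def using summable_on_def by (auto simp: indicator_def)
  have WW: "ip (indicator W) (indicator W) = V R"
    unfolding ip_def total_def using infsumI[OF hW] by (simp flip: indicator_inter_arith)
  have "ip (tent R) (indicator W) = total (tent R)"
    unfolding ip_def by (rule total_cong) (use tent_0 in \<open>auto simp: indicator_def W_def\<close>)
  then show ?thesis using ip_cauchy_schwarz[OF nn_sum_tent nW, of R] V_pos[of R] unfolding WW by (simp add: mult.commute)
qed

text \<open>For the tent \<open>f\<close> of height \<open>2 * l\<close>, \<open>ip (P f) f\<close> is at least
  \<open>(1 - 1 / (4 * n)) * ip f f\<close>, so half of the squared norm is left after \<open>n\<close> steps.
  Comparing with \<open>iterate_le_ret2\<close> and using the Cauchy-Schwarz inequality for the total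
  mass gives the bound.\<close>

lemma ret2_lower_volume:
  assumes l: "1 \<le> l" and n: "1 \<le> n" and small: "4 * real n * M2 * V (2 * l) \<le> (real l)\<^sup>2 * V l"
  shows "1 / (2 * V (2 * l)) \<le> ret2 n"
proof -
  define f where "f = tent (2 * l)"
  define W where "W = wball G A (2 * l)"
  define v where "v = V (2 * l)"
  have v: "v \<ge> 1" unfolding v_def by (rule V_pos)
  have f: "nn_sum f" unfolding f_def by (rule nn_sum_tent)
  have "1 * 1 \<le> (real l)\<^sup>2 * V l" using l V_pos[of l] by (intro mult_mono) auto
  then have e0: "0 < ip f f" "(real l)\<^sup>2 * V l \<le> ip f f" using tent_norm[of l] unfolding f_def by linarith+
  define q where "q = M2 * v / ip f f"
  have q0: "0 \<le> q" unfolding q_def using M2_nonneg v e0 by simp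
  have "4 * real n * (M2 * v) \<le> ip f f" using small e0(2) unfolding v_def by (simp add: mult_ac)
  then have q4: "4 * real n * q \<le> 1" unfolding q_def using e0(1) by simp
  have "1 * q \<le> (4 * real n) * q" using n q0 by (intro mult_right_mono) auto
  then have q1: "q \<le> 1" using q4 by simp
  have "(1 - q) * ip f f \<le> ip (P f) f"
    using tent_energy[of "2 * l"] e0(1) unfolding f_def[symmetric] v_def[symmetric] q_def by (simp add: algebra_simps)
  from iterate_energy[OF f e0(1) q0 q1 this, of n]
  have "(1 - q) ^ (2 * n) * ip f f \<le> ip ((P ^^ n) f) ((P ^^ n) f)" .
  also have "\<dots> \<le> (total f)\<^sup>2 * ret2 n"
    by (rule iterate_le_ret2[OF f, of W]) (use ball_facts tent_0 in \<open>auto simp: W_def f_def\<close>)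
  also have "\<dots> \<le> (v * ip f f) * ret2 n"
    using tent_total[of "2 * l"] ret2_nonneg unfolding f_def v_def by (rule mult_right_mono)
  finally have "ip f f * (1 - q) ^ (2 * n) \<le> ip f f * (v * ret2 n)" by (simp add: mult_ac)
  then have "(1 - q) ^ (2 * n) \<le> v * ret2 n" using e0(1) by simp
  moreover have "1 + real (2 * n) * (- q) \<le> (1 + (- q)) ^ (2 * n)" by (rule Bernoulli_inequality) (use q1 in simp)
  ultimately have "1 / 2 \<le> v * ret2 n" using q4 by simp
  then show ?thesis unfolding v_def[symmetric] using v by (simp add: divide_simps mult_ac)
qed

text \<open>Volume doubling makes the hypothesis of \<open>ret2_lower_volume\<close> hold when \<open>l\<close> is a large
  multiple of \<open>sqrt n\<close>.\<close>

theorem ret2_lower: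
  assumes c: "0 < c" "\<And>n. 1 \<le> n \<Longrightarrow> c * real n powr d \<le> V n"
    and C: "\<And>n. 1 \<le> n \<Longrightarrow> V n \<le> C * real n powr d" and d: "0 \<le> d"
  shows "\<exists>c>0. \<forall>n\<ge>1. c * real n powr (- d / 2) \<le> ret2 n"
proof -
  have "0 < c * real 1 powr d" using c(1) by simp
  also have "\<dots> \<le> C * real 1 powr d" using c(2)[of 1] C[of 1] by simp
  finally have C0: "0 < C" by simp
  define K where "K = C * 2 powr d / c"
  have K0: "0 < K" unfolding K_def using C0 c(1) by simp
  have doubling: "V (2 * l) \<le> K * V l" if l: "1 \<le> l" for l
  proof -
    have "V (2 * l) \<le> C * (2 * real l) powr d" using C[of "2 * l"] l by simp
    also have "\<dots> = K * (c * real l powr d)" unfolding K_def using c(1) powr_mult[of 2 "real l" d] by simp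
    also have "\<dots> \<le> K * V l" using c(2)[OF l] K0 by (intro mult_left_mono) auto
    finally show ?thesis .
  qed
  \<comment> \<open>Then \<open>l \<ge> L * sqrt n\<close> gives \<open>4 * n * M2 * K \<le> l\<^sup>2\<close>, the smallness required for \<open>n\<close>
    steps.\<close>
  define L where "L = 1 + sqrt (4 * M2 * K)"
  have L1: "1 \<le> L" unfolding L_def using M2_nonneg K0 by simp
  have "(sqrt (4 * M2 * K))\<^sup>2 \<le> L\<^sup>2" unfolding L_def using M2_nonneg K0 by (intro power_mono) auto
  then have L2: "4 * M2 * K \<le> L\<^sup>2" using M2_nonneg K0 by simp
  have main: "(1 / (2 * C * (4 * L) powr d)) * real n powr (- d / 2) \<le> ret2 n" if n: "1 \<le> n" for n
  proof -
    define l where "l = nat \<lceil>L * sqrt (real n)\<rceil>"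
    have s1: "1 \<le> L * sqrt (real n)" using L1 n mult_mono[of 1 L 1 "sqrt (real n)"] by simp
    have lu: "L * sqrt (real n) \<le> real l" unfolding l_def by linarith
    have ll: "real l \<le> 2 * (L * sqrt (real n))" unfolding l_def using s1 by linarith
    have l1: "1 \<le> l" using s1 lu by linarith
    have "4 * real n * M2 * V (2 * l) \<le> 4 * real n * M2 * (K * V l)"
      using doubling[OF l1] M2_nonneg by (intro mult_left_mono) auto
    also have "\<dots> = (4 * M2 * K) * real n * V l" by simp
    also have "\<dots> \<le> L\<^sup>2 * real n * V l" using L2 by (intro mult_right_mono) auto
    also have "L\<^sup>2 * real n = (L * sqrt (real n))\<^sup>2" by (simp add: power_mult_distrib)
    also have "(L * sqrt (real n))\<^sup>2 * V l \<le> (real l)\<^sup>2 * V l" using lu s1 by (intro mult_right_mono power_mono) auto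
    finally have "1 / (2 * V (2 * l)) \<le> ret2 n" by (rule ret2_lower_volume[OF l1 n])
    moreover have "V (2 * l) \<le> C * (4 * L) powr d * real n powr (d / 2)"
    proof -
      have "V (2 * l) \<le> C * (2 * real l) powr d" using C[of "2 * l"] l1 by simp
      also have "\<dots> \<le> C * ((4 * L) * sqrt (real n)) powr d"
        using ll C0 d by (intro mult_left_mono powr_mono2) auto
      also have "((4 * L) * sqrt (real n)) powr d = (4 * L) powr d * real n powr (d / 2)"
        using L1 powr_mult[of "4 * L" "sqrt (real n)" d] by (simp add: powr_half_sqrt[symmetric] powr_powr)
      finally show ?thesis by simp
    qed
    then have "1 / (2 * (C * (4 * L) powr d * real n powr (d / 2))) \<le> 1 / (2 * V (2 * l))"
      using V_pos[of "2 * l"] C0 L1 n by (intro divide_left_mono mult_pos_pos) auto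
    moreover have "(1 / (2 * C * (4 * L) powr d)) * real n powr (- d / 2) = 1 / (2 * (C * (4 * L) powr d * real n powr (d / 2)))"
      using powr_minus[of "real n" "d / 2"] by (simp add: divide_simps)
    ultimately show ?thesis by linarith
  qed
  moreover have "0 < 1 / (2 * C * (4 * L) powr d)" using C0 L1 by simp
  ultimately show ?thesis by blast
qed

end

section \<open>Walks with power-law steps\<close>

lemma summable_on_int_powr:
  assumes b: "1 < b"
  shows "(\<lambda>m::int. (1 + of_int \<bar>m\<bar> :: real) powr (- b)) summable_on UNIV"
proof -
  have "summable (\<lambda>n. real n powr (- b))" using b by (subst summable_real_powr_iff) simp
  then have s: "summable (\<lambda>n. (1 + real n) powr (- b))"
    by (subst (asm) summable_Suc_iff[symmetric]) (simp add: add.commute)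
  then have 1: "(\<lambda>n. (1 + real n) powr (- b)) summable_on UNIV"
    by (rule summable_nonneg_imp_summable_on) simp
  have a: "(\<lambda>m::int. (1 + of_int \<bar>m\<bar> :: real) powr (- b)) summable_on range int"
    using 1 by (subst summable_on_reindex) (auto simp: o_def inj_on_def)
  have b: "(\<lambda>m::int. (1 + of_int \<bar>m\<bar> :: real) powr (- b)) summable_on range (\<lambda>n. - int n)"
    using 1 by (subst summable_on_reindex) (auto simp: o_def inj_on_def)
  have "m \<in> range int \<union> range (\<lambda>n. - int n)" for m :: int
    by (cases m rule: int_cases2) auto
  then have "UNIV = range int \<union> range (\<lambda>n. - int n)" by blast
  then show ?thesis using summable_on_union[OF a b] by simp
qed

lemma stable_weight_nonneg: "0 \<le> stable_weight \<alpha> m"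
  unfolding stable_weight_def by simp

lemma stable_weight_minus: "stable_weight \<alpha> (- m) = stable_weight \<alpha> m"
  unfolding stable_weight_def by auto

lemma stable_weight_pos: "m \<in> {-1, 0, 1} \<Longrightarrow> 0 < stable_weight \<alpha> m"
  unfolding stable_weight_def by auto

lemma stable_weight_moment:
  assumes \<alpha>: "0 < \<alpha>" and e: "0 \<le> e" "\<alpha> = \<infinity> \<or> e < real_of_ereal \<alpha>"
  shows "(\<lambda>m. stable_weight \<alpha> m * (1 + of_int \<bar>m\<bar>) powr e) summable_on UNIV"
proof (cases "\<alpha> = \<infinity>")
  case True
  have "{m \<in> UNIV. stable_weight \<alpha> m * (1 + of_int \<bar>m\<bar>) powr e \<noteq> 0} \<subseteq> {-1, 0, 1}"
    using True unfolding stable_weight_def by auto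
  then show ?thesis by (intro finite_nonzero_values_imp_summable_on) (rule finite_subset, auto)
next
  case False
  have "stable_weight \<alpha> m * (1 + of_int \<bar>m\<bar>) powr e = (1 + of_int \<bar>m\<bar>) powr (- (real_of_ereal \<alpha> + 1 - e))" for m
    using False unfolding stable_weight_def by (simp add: powr_add[symmetric] algebra_simps)
  then show ?thesis using summable_on_int_powr[of "real_of_ereal \<alpha> + 1 - e"] e False by simp
qed

lemma real_of_ereal_pos: "0 < \<alpha> \<Longrightarrow> \<alpha> = \<infinity> \<or> 0 < real_of_ereal \<alpha>"
  by (cases \<alpha>) auto

lemma stable_weight_summable: "0 < \<alpha> \<Longrightarrow> stable_weight \<alpha> summable_on UNIV"
proof -
  have nz: "1 + \<bar>real_of_int m\<bar> \<noteq> 0" for m by linarith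
  show "stable_weight \<alpha> summable_on UNIV" if "0 < \<alpha>"
    using stable_weight_moment[of \<alpha> 0] real_of_ereal_pos[of \<alpha>] that nz by simp
qed

lemma stable_const_pos:
  assumes "0 < \<alpha>"
  shows "0 < stable_const \<alpha>" and "stable_const \<alpha> * (\<Sum>\<^sub>\<infinity>m. stable_weight \<alpha> m) = 1"
proof -
  have "stable_weight \<alpha> 0 \<le> (\<Sum>\<^sub>\<infinity>m. stable_weight \<alpha> m)"
    by (rule le_infsum_member[OF stable_weight_summable[OF assms]]) (auto simp: stable_weight_nonneg)
  then have "0 < (\<Sum>\<^sub>\<infinity>m. stable_weight \<alpha> m)" using stable_weight_pos[of 0 \<alpha>] by simp
  then show "0 < stable_const \<alpha>" "stable_const \<alpha> * (\<Sum>\<^sub>\<infinity>m. stable_weight \<alpha> m) = 1"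
    unfolding stable_const_def by auto
qed

context group begin

text \<open>The distribution of \<open>s [^] m\<close> when the integer \<open>m\<close> has the weights \<open>wt\<close>.\<close>

definition power_law :: "'a \<Rightarrow> (int \<Rightarrow> real) \<Rightarrow> 'a \<Rightarrow> real" where
  "power_law s wt g = (\<Sum>\<^sub>\<infinity>m. wt m * indicator {s [^] m} g)"

lemma power_law_has_sum:
  assumes s: "s \<in> carrier G" and wt: "\<And>m. 0 \<le> wt m" and h: "\<And>x. x \<in> carrier G \<Longrightarrow> 0 \<le> h x"
    and sm: "(\<lambda>m. wt m * h (s [^] m)) summable_on UNIV"
  shows "((\<lambda>g. power_law s wt g * h g) has_sum (\<Sum>\<^sub>\<infinity>m. wt m * h (s [^] m))) (carrier G)"
proof -
  define f where "f = (\<lambda>g m. wt m * indicator {s [^] m} g * h g)"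
  have h1: "((\<lambda>g. f g m) has_sum (wt m * h (s [^] m))) (carrier G)" for m
  proof -
    have "((\<lambda>g. wt m * h g) has_sum (\<Sum>g\<in>{s [^] m}. wt m * h g)) {s [^] m}" by (rule has_sum_finite) simp
    also have "((\<lambda>g. wt m * h g) has_sum (\<Sum>g\<in>{s [^] m}. wt m * h g)) {s [^] m}
        \<longleftrightarrow> ((\<lambda>g. f g m) has_sum (\<Sum>g\<in>{s [^] m}. wt m * h g)) (carrier G)"
      by (rule has_sum_cong_neutral) (use s in \<open>auto simp: f_def\<close>)
    finally show ?thesis by simp
  qed
  have e: "(\<Sum>\<^sub>\<infinity>g\<in>carrier G. f g m) = wt m * h (s [^] m)" for m by (rule infsumI[OF h1])
  have t: "(\<lambda>g. \<Sum>\<^sub>\<infinity>m. f g m) summable_on carrier G"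
    "(\<Sum>\<^sub>\<infinity>g\<in>carrier G. \<Sum>\<^sub>\<infinity>m. f g m) = (\<Sum>\<^sub>\<infinity>m. \<Sum>\<^sub>\<infinity>g\<in>carrier G. f g m)"
    by (rule tonelli_nonneg(2) tonelli_nonneg(3); use wt h h1 sm e in \<open>auto simp: f_def summable_on_def\<close>)+
  have "(\<Sum>\<^sub>\<infinity>m. f g m) = power_law s wt g * h g" for g
    unfolding f_def power_law_def by (rule infsum_cmult_left')
  then show ?thesis using has_sum_infsum[OF t(1)] t(2) unfolding e by simp
qed

lemma power_law_nonneg: "(\<And>m. 0 \<le> wt m) \<Longrightarrow> 0 \<le> power_law s wt g"
  unfolding power_law_def by (rule infsum_nonneg) simp

lemma power_law_inv:
  assumes s: "s \<in> carrier G" and g: "g \<in> carrier G" and wt: "\<And>m. wt (- m) = wt m"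
  shows "power_law s wt (inv g) = power_law s wt g"
proof -
  have "bij_betw (\<lambda>m::int. - m) UNIV UNIV" by (rule bij_betwI[of _ _ _ "\<lambda>m. - m"]) auto
  then have "power_law s wt (inv g) = (\<Sum>\<^sub>\<infinity>m. wt (- m) * indicator {s [^] (- m)} (inv g))"
    unfolding power_law_def
    by (rule infsum_reindex_bij_betw[of "\<lambda>m. - m", where f = "\<lambda>m. wt m * indicator {s [^] m} (inv g)", symmetric])
  also have "\<dots> = power_law s wt g" unfolding power_law_def
  proof (rule infsum_cong)
    fix m :: int
    have "inv g = inv (s [^] m) \<longleftrightarrow> g = s [^] m" using s g by (metis inv_inv int_pow_closed)
    then show "wt (- m) * indicator {s [^] (- m)} (inv g) = wt m * indicator {s [^] m} g"
      using wt s by (simp add: int_pow_neg indicator_def)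
  qed
  finally show ?thesis .
qed

lemma power_law_ge:
  assumes "\<And>m. 0 \<le> wt m" "wt summable_on UNIV"
  shows "wt m \<le> power_law s wt (s [^] m)"
proof -
  have "(\<lambda>n. wt n * indicator {s [^] n} (s [^] m)) summable_on UNIV"
    by (rule summable_on_comparison_test[OF assms(2)]) (use assms in \<open>auto simp: indicator_def\<close>)
  from le_infsum_member[OF this, of m] show ?thesis
    unfolding power_law_def using assms(1) by simp
qed

lemma stable_measure_eq:
  "stable_measure G k s \<alpha> g = (\<Sum>i\<in>{1..k}. (1 / real k * stable_const (\<alpha> i)) * power_law (s i) (stable_weight (\<alpha> i)) g)"
  unfolding stable_measure_def power_law_def by (simp add: sum_distrib_left mult.assoc)

text \<open>The supremum that defines the commutator length need not be attained when \<open>g\<close> is a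
  torsion element, but some exponent \<open>L\<close> of the set satisfies the strict inequality
  already.\<close>

lemma commutator_length_witness:
  assumes \<alpha>: "0 < \<alpha>" and gt: "\<alpha> * ereal_of_enat (commutator_length G g) > 2" and g: "g \<in> carrier G"
  shows "\<exists>L\<ge>1. \<exists>q\<ge>1::nat. g [^] q \<in> LC L \<and> (\<alpha> = \<infinity> \<or> 2 / real L < real_of_ereal \<alpha>)"
proof (cases "\<alpha> = \<infinity>")
  case True
  then show ?thesis using g by (intro exI[of _ 1] conjI exI[of _ "1::nat"]) auto
next
  case False
  then obtain a where a: "\<alpha> = ereal a" "0 < a" using \<alpha> by (cases \<alpha>) auto
  define S where "S = {enat l | l. l \<ge> 1 \<and> (\<exists>m::nat. m \<ge> 1 \<and> g [^] m \<in> LC l)}"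
  show ?thesis
  proof (rule ccontr)
    assume no: "\<not> ?thesis"
    define b where "b = nat \<lfloor>2 / a\<rfloor>"
    have "x \<le> enat b" if x: "x \<in> S" for x
    proof -
      obtain l m where l: "x = enat l" "l \<ge> 1" "m \<ge> 1" "g [^] (m::nat) \<in> LC l" using x unfolding S_def by blast
      then have "\<not> 2 / real l < a" using no a by auto
      then have "real l \<le> 2 / a" using l(2) a(2) by (simp add: field_simps not_less)
      then have "l \<le> b" unfolding b_def by (simp add: le_nat_floor)
      then show ?thesis using l by simp
    qed
    then have "Sup S \<le> enat b" by (rule Sup_least)
    then obtain c where c: "Sup S = enat c" "c \<le> b" by (cases "Sup S") auto
    have "real c \<le> 2 / a" using c(2) a(2) unfolding b_def by (simp add: le_nat_iff) linarith
    then have "a * real c \<le> 2" using a(2) by (simp add: field_simps)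
    moreover have "\<alpha> * ereal_of_enat (commutator_length G g) = ereal (a * real c)"
      unfolding commutator_length_def S_def[symmetric] c a by simp
    ultimately show False using gt by simp
  qed
qed

end

lemma hom_dim_nonneg: "0 \<le> hom_dim G"
  unfolding hom_dim_def by (rule infsum_nonneg) simp

lemma (in group) generate_symmetrized:
  assumes S: "finite S" "S \<subseteq> carrier G" "generate G S = carrier G"
  shows "sym_gen G (insert \<one> (S \<union> (\<lambda>x. inv x) ` S))"
proof
  let ?A = "insert \<one> (S \<union> (\<lambda>x. inv x) ` S)"
  show "finite ?A" "\<one> \<in> ?A" using S by auto
  show A: "?A \<subseteq> carrier G" using S by auto
  show "inv x \<in> ?A" if "x \<in> ?A" for x using that S by auto
  have "generate G S \<subseteq> generate G ?A" by (rule mono_generate) auto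
  then show "generate G ?A = carrier G" using S(3) generate_incl[OF A] by auto
qed

text \<open>The walk may be periodic, and then the steps of the squared walk, the set \<open>E\<close> of all
  \<open>inv a \<otimes> b\<close>, generate only a subgroup of index two. Still its balls are at least half as
  large as those of \<open>G\<close>: an element of length at most \<open>n\<close>, possibly after multiplication by
  one fixed letter \<open>inv a0\<close>, is a product of \<open>n\<close> elements of \<open>E\<close>.\<close>

theorem uniform_walk_bounds:
  fixes G :: "('a, 'b) monoid_scheme" (structure)
  assumes nil: "nilpotent_group G" and A: "symmetric_generating_set G A"
  shows "\<exists>c>0. \<exists>C>0. \<forall>n\<ge>1. c * real n powr (- hom_dim G / 2) \<le> Phi G A n \<and>
    Phi G A n \<le> C * real n powr (- hom_dim G / 2)"
proof -
  interpret group G using nil unfolding nilpotent_group_def by simp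
  have fA: "finite A" "A \<noteq> {}" "A \<subseteq> carrier G" "\<And>x. x \<in> A \<Longrightarrow> inv x \<in> A" "generate G A = carrier G"
    using A unfolding symmetric_generating_set_def by auto
  define B where "B = insert \<one> A"
  have "sym_gen G (insert \<one> (A \<union> (\<lambda>x. inv x) ` A))" by (rule generate_symmetrized[OF fA(1,3,5)])
  moreover have "insert \<one> (A \<union> (\<lambda>x. inv x) ` A) = B" unfolding B_def using fA(4) by auto
  ultimately interpret sym_gen G B by simp
  define p where "p = uniform_on A"
  have cA: "0 < card A" using fA by (simp add: card_gt_0_iff)
  have pA: "0 < p x" if "x \<in> A" for x unfolding p_def uniform_on_def using that cA by simp
  have "((\<lambda>x. indicator A x * (1 / real (card A))) has_sum (real (card A) * (1 / real (card A)))) (carrier G)"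
    by (intro has_sum_cmult_left has_sum_indicator fA)
  then have ps: "(p has_sum 1) (carrier G)" unfolding p_def uniform_on_def[abs_def] using cA by simp
  interpret symmetric_walk G p
  proof
    show "0 \<le> p x" for x unfolding p_def uniform_on_def by simp
    show "p (inv x) = p x" if "x \<in> carrier G" for x
    proof -
      have "inv x \<in> A \<longleftrightarrow> x \<in> A" using fA(4)[of x] fA(4)[of "inv x"] that by auto
      then show ?thesis unfolding p_def uniform_on_def by (simp add: indicator_def)
    qed
  qed (rule ps)
  interpret moment_walk G p B
  proof
    have "{y \<in> carrier G. p y * (real (wlen G B y))\<^sup>2 \<noteq> 0} \<subseteq> A" unfolding p_def uniform_on_def by (auto simp: indicator_def)
    then show "(\<lambda>y. p y * (real (wlen G B y))\<^sup>2) summable_on carrier G"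
      by (intro finite_nonzero_values_imp_summable_on) (rule finite_subset[OF _ fA(1)])
  qed
  obtain c where c: "0 < c" "\<And>n. 1 \<le> n \<Longrightarrow> c * real n powr hom_dim G \<le> V n"
    using volume_and_distortion(1)[OF nil] by blast
  obtain C where C: "\<And>n. 1 \<le> n \<Longrightarrow> V n \<le> C * real n powr hom_dim G"
    using volume_and_distortion(2)[OF nil] by blast
  have lower: "\<exists>c>0. \<forall>n\<ge>1. c * real n powr (- hom_dim G / 2) \<le> ret2 n"
    by (rule ret2_lower[OF c C hom_dim_nonneg])
  define E where "E = (\<lambda>(a, b). inv a \<otimes> b) ` (A \<times> A)"
  have Ec: "E \<subseteq> carrier G" "finite E" unfolding E_def using fA by auto
  have Emem: "inv a \<otimes> b \<in> E" if "a \<in> A" "b \<in> A" for a b unfolding E_def using that by force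
  obtain a0 where a0: "a0 \<in> A" using fA(2) by blast
  have a0c: "a0 \<in> carrier G" using a0 fA by auto
  have oneE: "\<one> \<in> E" using Emem[OF a0 a0] a0c by simp
  \<comment> \<open>In the step, either \<open>b z\<close> is written as \<open>(b a0) (inv a0 z)\<close>, or \<open>inv a0 (b z)\<close> as
    \<open>(inv a0 b) z\<close>.\<close>
  have cover: "x \<in> wball G E n \<or> inv a0 \<otimes> x \<in> wball G E n" if "x \<in> wball G B n" for x n
    using that
  proof (induction n arbitrary: x)
    case (Suc n)
    then obtain b z where b: "b \<in> B" "z \<in> wball G B n" "x = b \<otimes> z" by auto
    have zc: "z \<in> carrier G" "b \<in> carrier G" using b wball_closed[OF gen_closed] gen_closed by blast+
    have cases: "z \<in> wball G E n \<or> inv a0 \<otimes> z \<in> wball G E n" by (rule Suc.IH[OF b(2)])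
    have step: "e \<otimes> t \<in> wball G E (Suc n)" if "e \<in> E" "t \<in> wball G E n" for e t using that by auto
    show ?case
    proof (cases "b = \<one>")
      case True
      then have "x = \<one> \<otimes> z" "inv a0 \<otimes> x = \<one> \<otimes> (inv a0 \<otimes> z)" using b zc a0c by auto
      then show ?thesis using step[OF oneE] cases by metis
    next
      case False
      then have bA: "b \<in> A" using b unfolding B_def by auto
      show ?thesis using cases
      proof
        assume "z \<in> wball G E n"
        then have "(inv a0 \<otimes> b) \<otimes> z \<in> wball G E (Suc n)" using step Emem[OF a0 bA] by blast
        then show ?thesis using b zc a0c by (simp add: m_assoc del: wball.simps)
      next
        assume z: "inv a0 \<otimes> z \<in> wball G E n"
        have "inv (inv b) \<otimes> a0 \<in> E" by (rule Emem[OF fA(4)[OF bA] a0])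
        from step[OF this z] have "inv (inv b) \<otimes> a0 \<otimes> (inv a0 \<otimes> z) \<in> wball G E (Suc n)" .
        then show ?thesis using b zc a0c by (simp add: m_assoc del: wball.simps)
      qed
    qed
  qed simp
  have vol: "c / 2 * real r powr hom_dim G \<le> real (card (wball G E r))" if r: "1 \<le> r" for r
  proof -
    define F where "F = wball G E r"
    have F: "finite F" "F \<subseteq> carrier G" unfolding F_def using finite_wball[OF Ec(2)] wball_closed[OF Ec(1)] by auto
    have "wball G B r \<subseteq> F \<union> (\<lambda>x. a0 \<otimes> x) ` F"
    proof
      fix x assume x: "x \<in> wball G B r"
      have xc: "x \<in> carrier G" using x wball_closed[OF gen_closed] by blast
      have "x = a0 \<otimes> (inv a0 \<otimes> x)" using xc a0c by simp
      then show "x \<in> F \<union> (\<lambda>x. a0 \<otimes> x) ` F" using cover[OF x] unfolding F_def by blast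
    qed
    then have "card (wball G B r) \<le> card (F \<union> (\<lambda>x. a0 \<otimes> x) ` F)" by (rule card_mono[rotated]) (use F in auto)
    also have "\<dots> \<le> card F + card ((\<lambda>x. a0 \<otimes> x) ` F)" by (rule card_Un_le)
    also have "\<dots> \<le> card F + card F" using card_image_le[OF F(1)] by simp
    finally have "V r \<le> 2 * real (card F)" by simp
    then show ?thesis using c(2)[OF r] unfolding F_def by simp
  qed
  have upper: "\<exists>C>0. \<forall>n\<ge>1. ret2 n \<le> C * real n powr (- hom_dim G / 2)"
  proof (rule ret2_upper[OF Ec(2) _ _ vol hom_dim_nonneg])
    fix x assume "x \<in> E"
    then obtain a b where "a \<in> A" "b \<in> A" "x = inv a \<otimes> b" unfolding E_def by auto
    then show "\<exists>a\<in>carrier G. \<exists>b\<in>carrier G. x = inv a \<otimes> b \<and> 0 < p a \<and> 0 < p b"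
      using fA(3) pA by blast
  qed (use c in auto)
  have "ret2 n = Phi G A n" for n unfolding Phi_def p_def[symmetric] by (rule ret2_def)
  then show ?thesis using lower upper by metis
qed

context symmetric_walk begin

text \<open>Odd times are compared with even ones by the inequality between arithmetic and
  geometric means from above, and by a step that stays in place from below.\<close>

lemma return_all_times:
  assumes p1: "0 < p \<one>" and d: "0 \<le> d"
    and lower: "\<exists>c>0. \<forall>n\<ge>1. c * real n powr (- d / 2) \<le> ret2 n"
    and upper: "\<exists>C>0. \<forall>n\<ge>1. ret2 n \<le> C * real n powr (- d / 2)"
  shows "\<exists>c>0. \<exists>C>0. \<forall>n\<ge>2. c * real n powr (- d / 2) \<le> u n \<one> \<and> u n \<one> \<le> C * real n powr (- d / 2)"
proof -
  obtain c where c: "c > 0" "\<And>n. 1 \<le> n \<Longrightarrow> c * real n powr (- d / 2) \<le> ret2 n" using lower by blast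
  obtain C where C: "C > 0" "\<And>n. 1 \<le> n \<Longrightarrow> ret2 n \<le> C * real n powr (- d / 2)" using upper by blast
  have ple: "p \<one> \<le> 1" using le_infsum_member[OF p_summable p_nonneg, of \<one>] infsumI[OF p_sum] by simp
  have odd_le: "u (Suc (2 * m)) \<one> \<le> ret2 m" for m
  proof -
    have "0 \<le> ip (u m) (u m) - 2 * 1 * ip (u m) (u (Suc m)) + 1\<^sup>2 * ip (u (Suc m)) (u (Suc m))"
      by (rule has_sum_nonneg[OF has_sum_diff_square[OF nn_sum_u nn_sum_u]]) simp
    moreover have "ip (u m) (u (Suc m)) = u (Suc (2 * m)) \<one>"
      unfolding ip_u by (rule arg_cong[of _ _ "\<lambda>n. u n \<one>"]) simp
    ultimately have "2 * u (Suc (2 * m)) \<one> \<le> ret2 m + ret2 (Suc m)"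
      unfolding ret2_ip[symmetric] by simp
    also have "\<dots> \<le> 2 * ret2 m" using ret2_antimono[of m] by simp
    finally show ?thesis by linarith
  qed
  have odd_ge: "p \<one> * ret2 m \<le> u (Suc (2 * m)) \<one>" for m
  proof -
    have "p \<one> * shift \<one> (u (2 * m)) \<one> \<le> (\<Sum>\<^sub>\<infinity>y\<in>carrier G. p y * shift y (u (2 * m)) \<one>)"
      by (rule le_infsum_member[OF P_summand[OF nn_sum_u]])
         (use p_nonneg nn_sum_nonneg[OF nn_sum_shift[OF _ nn_sum_u]] in auto)
    then show ?thesis unfolding u_Suc P_def' ret2_def by (simp add: shift_def)
  qed
  have both: "p \<one> * ret2 (n div 2) \<le> u n \<one> \<and> u n \<one> \<le> ret2 (n div 2)" for n
  proof (cases "even n")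
    case True
    then have "u n \<one> = ret2 (n div 2)" unfolding ret2_def by simp
    then show ?thesis using ple ret2_nonneg[of "n div 2"] mult_right_mono[OF ple, of "ret2 (n div 2)"] by simp
  next
    case False
    then have "n = Suc (2 * (n div 2))" by presburger
    then show ?thesis using odd_le[of "n div 2"] odd_ge[of "n div 2"] by simp
  qed
  have main: "p \<one> * c * real n powr (- d / 2) \<le> u n \<one> \<and> u n \<one> \<le> C * 3 powr (d / 2) * real n powr (- d / 2)" if n: "2 \<le> n" for n
  proof
    define m where "m = n div 2"
    have m: "1 \<le> m" "m \<le> n" "n \<le> 3 * m" unfolding m_def using n by auto
    have "p \<one> * c * real n powr (- d / 2) \<le> p \<one> * c * real m powr (- d / 2)"
      using m d p1 c by (intro mult_left_mono powr_mono2') auto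
    also have "\<dots> \<le> p \<one> * ret2 m" using c(2)[OF m(1)] p1 by (simp add: mult.assoc mult_left_mono)
    finally show "p \<one> * c * real n powr (- d / 2) \<le> u n \<one>" using both[of n] unfolding m_def by linarith
    have "ret2 m \<le> C * real m powr (- d / 2)" by (rule C(2)[OF m(1)])
    also have "\<dots> \<le> C * (real n / 3) powr (- d / 2)"
      using m n d C by (intro mult_left_mono powr_mono2') auto
    also have "(real n / 3) powr (- d / 2) = 3 powr (d / 2) * real n powr (- d / 2)"
      using n by (simp add: powr_divide powr_minus divide_simps)
    finally show "u n \<one> \<le> C * 3 powr (d / 2) * real n powr (- d / 2)" using both[of n] unfolding m_def by simp
  qed
  moreover have "0 < p \<one> * c" "0 < C * 3 powr (d / 2)" using p1 c C by auto
  ultimately show ?thesis by blast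
qed

end

text \<open>By \<open>commutator_length_witness\<close> and the distortion estimate, the word length of
  \<open>s i [^] m\<close> is \<open>O(\<bar>m\<bar> powr (1 / L))\<close> with \<open>2 / L\<close> less than the exponent of the law of
  \<open>m\<close>. This is exactly what makes the second moment finite.\<close>

theorem stable_walk_bounds:
  fixes G :: "('a, 'b) monoid_scheme" (structure)
  assumes nil: "nilpotent_group G" and k: "1 \<le> k"
    and s: "\<And>i. i \<in> {1..k} \<Longrightarrow> s i \<in> carrier G" and gen: "generate G (s ` {1..k}) = carrier G"
    and \<alpha>: "\<And>i. i \<in> {1..k} \<Longrightarrow> \<alpha> i > 0"
    and long: "\<And>i. i \<in> {1..k} \<Longrightarrow> \<alpha> i * ereal_of_enat (commutator_length G (s i)) > 2"
  shows "\<exists>c>0. \<exists>C>0. \<forall>n\<ge>2. c * real n powr (- hom_dim G / 2) \<le> conv_power G (stable_measure G k s \<alpha>) n \<one> \<and>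
    conv_power G (stable_measure G k s \<alpha>) n \<one> \<le> C * real n powr (- hom_dim G / 2)"
proof -
  interpret group G using nil unfolding nilpotent_group_def by simp
  define S where "S = s ` {1..k}"
  define A where "A = insert \<one> (S \<union> (\<lambda>x. inv x) ` S)"
  interpret sym_gen G A unfolding A_def
    by (rule generate_symmetrized) (use s gen in \<open>auto simp: S_def\<close>)
  define p where "p = stable_measure G k s \<alpha>"
  define c where "c = (\<lambda>i. 1 / real k * stable_const (\<alpha> i))"
  define \<nu> where "\<nu> = (\<lambda>i. power_law (s i) (stable_weight (\<alpha> i)))"
  have p_eq: "p g = (\<Sum>i\<in>{1..k}. c i * \<nu> i g)" for g
    unfolding p_def c_def \<nu>_def by (rule stable_measure_eq)
  have c0: "0 < c i" if "i \<in> {1..k}" for i unfolding c_def using stable_const_pos(1)[OF \<alpha>[OF that]] k by simp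
  have \<nu>0: "0 \<le> \<nu> i g" for i g unfolding \<nu>_def by (rule power_law_nonneg) (rule stable_weight_nonneg)
  have sum_h: "((\<lambda>g. p g * h g) has_sum (\<Sum>i\<in>{1..k}. c i * (\<Sum>\<^sub>\<infinity>m. stable_weight (\<alpha> i) m * h (s i [^] m)))) (carrier G)"
    if h: "\<And>x. x \<in> carrier G \<Longrightarrow> 0 \<le> h x"
      and sm: "\<And>i. i \<in> {1..k} \<Longrightarrow> (\<lambda>m. stable_weight (\<alpha> i) m * h (s i [^] m)) summable_on UNIV" for h
  proof -
    have "((\<lambda>g. \<Sum>i\<in>{1..k}. c i * (\<nu> i g * h g)) has_sum (\<Sum>i\<in>{1..k}. c i * (\<Sum>\<^sub>\<infinity>m. stable_weight (\<alpha> i) m * h (s i [^] m)))) (carrier G)"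
      unfolding \<nu>_def
      by (intro has_sum_finite_sum has_sum_cmult_right power_law_has_sum finite_atLeastAtMost s stable_weight_nonneg h sm)
    then show ?thesis unfolding p_eq by (simp add: sum_distrib_right mult.assoc)
  qed
  have "(p has_sum 1) (carrier G)"
  proof -
    have "c i * (\<Sum>\<^sub>\<infinity>m. stable_weight (\<alpha> i) m * 1) = 1 / real k" if "i \<in> {1..k}" for i
      using stable_const_pos(2)[OF \<alpha>[OF that]] unfolding c_def by simp
    then have e: "(\<Sum>i\<in>{1..k}. c i * (\<Sum>\<^sub>\<infinity>m. stable_weight (\<alpha> i) m * 1)) = 1" using k by simp
    show ?thesis using sum_h[of "\<lambda>_. 1"] stable_weight_summable[OF \<alpha>] unfolding e by simp
  qed
  then interpret symmetric_walk G p
  proof (unfold_locales, goal_cases)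
    case (1 x)
    then show ?case unfolding p_eq using c0 \<nu>0 by (intro sum_nonneg mult_nonneg_nonneg) (auto simp: less_imp_le)
  next
    case (2 x)
    then show ?case unfolding p_eq \<nu>_def using power_law_inv[OF s] stable_weight_minus by simp
  qed
  have wlen_pow_bound: "\<exists>e C. 0 \<le> e \<and> (\<alpha> i = \<infinity> \<or> e < real_of_ereal (\<alpha> i)) \<and> 0 \<le> C \<and>
      (\<forall>m::int. (real (wlen G A (s i [^] m)))\<^sup>2 \<le> C * (1 + of_int \<bar>m\<bar>) powr e)" if i: "i \<in> {1..k}" for i
  proof -
    obtain L q where L: "L \<ge> 1" "q \<ge> (1::nat)" "s i [^] q \<in> LC L" "\<alpha> i = \<infinity> \<or> 2 / real L < real_of_ereal (\<alpha> i)"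
      using commutator_length_witness[OF \<alpha>[OF i] long[OF i] s[OF i]] by blast
    obtain C where C: "C \<ge> 0" "\<And>m::int. real (wlen G A (s i [^] m)) \<le> C * (1 + of_int \<bar>m\<bar>) powr (1 / real L)"
      using volume_and_distortion(3)[OF nil s[OF i] L(3,1,2)] by blast
    have "(real (wlen G A (s i [^] m)))\<^sup>2 \<le> C\<^sup>2 * (1 + of_int \<bar>m\<bar>) powr (2 / real L)" for m :: int
    proof -
      have "(real (wlen G A (s i [^] m)))\<^sup>2 \<le> (C * (1 + of_int \<bar>m\<bar>) powr (1 / real L))\<^sup>2"
        using C(2) by (intro power_mono) auto
      also have "\<dots> = C\<^sup>2 * (1 + of_int \<bar>m\<bar>) powr (2 / real L)"
        by (simp add: power_mult_distrib powr_power)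
      finally show ?thesis .
    qed
    then show ?thesis using L(4) by (intro exI[of _ "2 / real L"] exI[of _ "C\<^sup>2"]) auto
  qed
  interpret moment_walk G p A
  proof
    have "(\<lambda>m. stable_weight (\<alpha> i) m * (real (wlen G A (s i [^] m)))\<^sup>2) summable_on UNIV" if i: "i \<in> {1..k}" for i
    proof -
      obtain e C where e: "0 \<le> e" "\<alpha> i = \<infinity> \<or> e < real_of_ereal (\<alpha> i)" "0 \<le> C"
        "\<And>m::int. (real (wlen G A (s i [^] m)))\<^sup>2 \<le> C * (1 + of_int \<bar>m\<bar>) powr e"
        using wlen_pow_bound[OF i] by blast
      show ?thesis
      proof (rule summable_on_comparison_test[OF summable_on_cmult_right[OF stable_weight_moment[OF \<alpha>[OF i] e(1,2)], of C]])
        fix m :: int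
        have "stable_weight (\<alpha> i) m * (real (wlen G A (s i [^] m)))\<^sup>2 \<le> stable_weight (\<alpha> i) m * (C * (1 + of_int \<bar>m\<bar>) powr e)"
          using e(4) stable_weight_nonneg by (rule mult_left_mono)
        then show "stable_weight (\<alpha> i) m * (real (wlen G A (s i [^] m)))\<^sup>2 \<le> C * (stable_weight (\<alpha> i) m * (1 + of_int \<bar>m\<bar>) powr e)"
          by (simp add: mult_ac)
      qed (simp add: stable_weight_nonneg)
    qed
    then show "(\<lambda>y. p y * (real (wlen G A y))\<^sup>2) summable_on carrier G"
      using sum_h[of "\<lambda>y. (real (wlen G A y))\<^sup>2"] unfolding summable_on_def[of _ "carrier G"] by auto
  qed
  have p_pos: "0 < p (s i [^] m)" if i: "i \<in> {1..k}" and m: "m \<in> {-1, 0, 1}" for i and m :: int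
  proof -
    have "0 < c i * stable_weight (\<alpha> i) m" using c0[OF i] stable_weight_pos[OF m] by simp
    also have "\<dots> \<le> c i * \<nu> i (s i [^] m)" unfolding \<nu>_def
      using c0[OF i] power_law_ge[OF stable_weight_nonneg stable_weight_summable[OF \<alpha>[OF i]], of m "s i"]
      by (intro mult_left_mono) auto
    also have "\<dots> \<le> p (s i [^] m)" unfolding p_eq
      by (rule member_le_sum[OF i]) (use c0 \<nu>0 in \<open>auto simp: less_imp_le\<close>)
    finally show ?thesis .
  qed
  have p1: "0 < p \<one>" using p_pos[of 1 0] k by simp
  have pA: "0 < p x" if xA: "x \<in> A" for x
  proof -
    consider "x = \<one>" | i where "i \<in> {1..k}" "x = s i" | i where "i \<in> {1..k}" "x = inv (s i)"
      using xA unfolding A_def S_def by auto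
    then show ?thesis
    proof cases
      case 1
      then show ?thesis using p1 by simp
    next
      case 2
      then show ?thesis using p_pos[of i 1] s[of i] by simp
    next
      case 3
      then show ?thesis using p_pos[of i "-1"] s[of i] by (simp add: int_pow_neg)
    qed
  qed
  obtain v where v: "0 < v" "\<And>n. 1 \<le> n \<Longrightarrow> v * real n powr hom_dim G \<le> V n"
    using volume_and_distortion(1)[OF nil] by blast
  obtain C where C: "\<And>n. 1 \<le> n \<Longrightarrow> V n \<le> C * real n powr hom_dim G"
    using volume_and_distortion(2)[OF nil] by blast
  have lower: "\<exists>c>0. \<forall>n\<ge>1. c * real n powr (- hom_dim G / 2) \<le> ret2 n"
    by (rule ret2_lower[OF v C hom_dim_nonneg])
  have upper: "\<exists>C>0. \<forall>n\<ge>1. ret2 n \<le> C * real n powr (- hom_dim G / 2)"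
  proof (rule ret2_upper[OF finite_gen _ v hom_dim_nonneg])
    fix x assume x: "x \<in> A"
    then have "x = inv \<one> \<otimes> x" "x \<in> carrier G" using gen_closed by auto
    then show "\<exists>a\<in>carrier G. \<exists>b\<in>carrier G. x = inv a \<otimes> b \<and> 0 < p a \<and> 0 < p b"
      using pA[OF x] p1 by blast
  qed
  show ?thesis using return_all_times[OF p1 hom_dim_nonneg lower upper] unfolding p_def .
qed

text \<open>Both dilation constants may be taken to be 1.\<close>

lemma asymp_similar_of_bounds:
  fixes f g h :: "real \<Rightarrow> real"
  assumes f: "0 < a" "\<And>t. t \<ge> t0 \<Longrightarrow> a * h t \<le> f t" "\<And>t. t \<ge> t0 \<Longrightarrow> f t \<le> b * h t"
    and g: "0 < a'" "\<And>t. t \<ge> t0 \<Longrightarrow> a' * h t \<le> g t" "\<And>t. t \<ge> t0 \<Longrightarrow> g t \<le> b' * h t"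
    and b: "0 < b" "0 < b'"
  shows "f \<simeq> g"
  unfolding asymp_similar_def
proof (intro exI conjI)
  show "0 < a' / b" "0 < (1::real)" "0 < b' / a" "0 < (1::real)" using f g b by auto
  have "a' / b * f (1 * t) \<le> g t \<and> g t \<le> b' / a * f (1 * t)" if t: "t \<ge> t0" for t
  proof
    have "a' / b * f t \<le> a' / b * (b * h t)" using f(3)[OF t] g(1) b(1) by (intro mult_left_mono) auto
    then show "a' / b * f (1 * t) \<le> g t" using g(2)[OF t] b(1) by simp
    have "b' / a * (a * h t) \<le> b' / a * f t" using f(2)[OF t] f(1) b(2) by (intro mult_left_mono) auto
    then show "g t \<le> b' / a * f (1 * t)" using g(3)[OF t] f(1) by simp
  qed
  then show "\<forall>\<^sub>F t in at_top. a' / b * f (1 * t) \<le> g t \<and> g t \<le> b' / a * f (1 * t)"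
    by (auto intro: eventually_at_top_linorderI[of t0])
qed

lemma step_ext_bounds:
  assumes d: "0 \<le> d" and c: "0 < c" "0 < C"
    and b: "\<And>n. 2 \<le> n \<Longrightarrow> c * real n powr (- d) \<le> f n \<and> f n \<le> C * real n powr (- d)" and t: "2 \<le> t"
  shows "c * t powr (- d) \<le> step_ext f t" and "step_ext f t \<le> C * 2 powr d * t powr (- d)"
proof -
  define n where "n = nat \<lfloor>t\<rfloor>"
  have n: "2 \<le> n" "real n \<le> t" "t / 2 \<le> real n" unfolding n_def using t by linarith+
  have "c * t powr (- d) \<le> c * real n powr (- d)" using n t d c by (intro mult_left_mono powr_mono2') auto
  then show "c * t powr (- d) \<le> step_ext f t" using b[OF n(1)] unfolding step_ext_def n_def by linarith
  have "C * real n powr (- d) \<le> C * (t / 2) powr (- d)" using n t d c by (intro mult_left_mono powr_mono2') auto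
  also have "(t / 2) powr (- d) = 2 powr d * t powr (- d)" using t by (simp add: powr_divide powr_minus divide_simps)
  finally show "step_ext f t \<le> C * 2 powr d * t powr (- d)" using b[OF n(1)] unfolding step_ext_def n_def by simp
qed

theorem corollary1p12:
  fixes G :: "('a, 'b) monoid_scheme"
    and k :: nat
    and s :: "nat \<Rightarrow> 'a"
    and \<alpha> :: "nat \<Rightarrow> ereal"
  assumes "nilpotent_group G"
    and "k \<ge> 1"
    and "\<And>i. i \<in> {1..k} \<Longrightarrow> s i \<in> carrier G"
    and "generate G (s ` {1..k}) = carrier G"
    and "\<And>i. i \<in> {1..k} \<Longrightarrow> \<alpha> i > 0"
    and "\<And>i. i \<in> {1..k} \<Longrightarrow> \<alpha> i * ereal_of_enat (commutator_length G (s i)) > 2"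
  defines "ret \<equiv> \<lambda>n. conv_power G (stable_measure G k s \<alpha>) n \<one>\<^bsub>G\<^esub>"
  shows "(\<forall>A. symmetric_generating_set G A \<longrightarrow>
            step_ext ret \<simeq> step_ext (Phi G A) \<and>
            step_ext (Phi G A) \<simeq> (\<lambda>t. t powr (- hom_dim G / 2)))
       \<and> (\<exists>c>0. \<exists>C>0. \<forall>\<^sub>F n in sequentially.
            c * real n powr (- hom_dim G / 2) \<le> ret n \<and>
            ret n \<le> C * real n powr (- hom_dim G / 2))"
proof -
  define d where "d = hom_dim G / 2"
  have d: "0 \<le> d" "- hom_dim G / 2 = - d" unfolding d_def using hom_dim_nonneg[of G] by auto
  obtain c C where c: "0 < c" "0 < C"
    "\<And>n. 2 \<le> n \<Longrightarrow> c * real n powr (- d) \<le> ret n \<and> ret n \<le> C * real n powr (- d)"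
    using stable_walk_bounds[OF assms(1-6)] unfolding ret_def d(2) by blast
  note ret = step_ext_bounds[OF d(1) c]
  have C2: "0 < C * 2 powr d" using c by simp
  show ?thesis unfolding d(2)
  proof (intro conjI allI impI)
    fix A assume A: "symmetric_generating_set G A"
    obtain a b where ab: "0 < a" "0 < b"
      "\<And>n. 1 \<le> n \<Longrightarrow> a * real n powr (- d) \<le> Phi G A n \<and> Phi G A n \<le> b * real n powr (- d)"
      using uniform_walk_bounds[OF assms(1) A] unfolding d(2) by blast
    have ab2: "a * real n powr (- d) \<le> Phi G A n \<and> Phi G A n \<le> b * real n powr (- d)" if "2 \<le> n" for n
      using ab(3)[of n] that by simp
    note Phi = step_ext_bounds[OF d(1) ab(1,2) ab2]
    have b2: "0 < b * 2 powr d" using ab by simp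
    show "step_ext ret \<simeq> step_ext (Phi G A)"
      by (rule asymp_similar_of_bounds[where h = "\<lambda>t. t powr (- d)", OF c(1) ret ab(1) Phi C2 b2])
    show "step_ext (Phi G A) \<simeq> (\<lambda>t. t powr (- d))"
      by (rule asymp_similar_of_bounds[where h = "\<lambda>t. t powr (- d)" and a' = 1 and b' = 1, OF ab(1) Phi _ _ _ b2]) auto
  next
    show "\<exists>c>0. \<exists>C>0. \<forall>\<^sub>F n in sequentially. c * real n powr (- d) \<le> ret n \<and> ret n \<le> C * real n powr (- d)"
      using c by (intro exI[of _ c] exI[of _ C] conjI eventually_sequentiallyI[of 2]) auto
  qed
qed

end
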